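(* Let $x=p/q$ with $p\in\mathbb Z$, $q\in\mathbb N$, $\gcd(p,q)=1$, and let $\theta=7/64$. Let $\{y_n\}_{n\in\mathbb N}$ be positive numbers with $y_n\asymp n^{-\alpha}$ for some fixed $\alpha\in[\tfrac{2}{1+2\theta},2)$. Then $\delta_{n,x,y_n}\to\mu_{\mathcal M}$ weakly as $n\to\infty$ along $n\in\mathbb N_q$, and $\delta^{\rm pr}_{n,x,y_n}\to\mu_{\mathcal M}$ weakly as $n\to\infty$ along $n\in\mathbb N_q^{\rm pr}$, where $\mathbb N_q=\{n\in\mathbb N:\gcd(n^2,q)\mid n\}$ and $\mathbb N_q^{\rm pr}=\{n\in\mathbb N:\gcd(n,q)=1\}$.
   Context: $\mathcal M=\mathrm{SL}_2(\mathbb Z)\backslash\mathbb H$ is the modular surface, $\Gamma=\mathrm{SL}_2(\mathbb Z)$, and $\mu_{\mathcal M}$ is the normalized hyperbolic area, $d\mu_{\mathcal M}=\frac{3}{\pi}\frac{dx\,dy}{y^2}$. For $n\in\mathbb N$, $x\in\mathbb R/\mathbb Z$, $y>0$, $\delta_{n,x,y}$ is the probability measure $\frac1n\sum_{j=0}^{n-1}\delta_{\Gamma(x+j/n+iy)}$ and $\delta^{\rm pr}_{n,x,y}=\frac{1}{\varphi(n)}\sum_{j\in(\mathbb Z/n\mathbb Z)^\times}\delta_{\Gamma(x+j/n+iy)}$ on $\mathcal M$. Weak convergence means convergence against every $\Psi\in C_c^\infty(\mathcal M)$ (equivalently $C_c(\mathcal M)$). $A\asymp B$ means $A\ll B\ll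 A$. *)

theory Defs
  imports "HOL-Analysis.Analysis" "HOL-Number_Theory.Number_Theory"
begin

definition sl2_act :: "int \<Rightarrow> int \<Rightarrow> int \<Rightarrow> int \<Rightarrow> complex \<Rightarrow> complex" where
  "sl2_act a b c d z = (of_int a * z + of_int b) / (of_int c * z + of_int d)"

definition upper_half :: "complex set" where
  "upper_half = {z. Im z > 0}"

text \<open>Functions in C_c(M), M = SL_2(Z)\H, realised as their lifts to H:
  continuous on H, SL_2(Z)-invariant, and vanishing high in the cusp
  (which is exactly compact support on the quotient).\<close>
definition Cc_modular :: "(complex \<Rightarrow> real) set" where
  "Cc_modular = {f. continuous_on upper_half f \<and>
     (\<forall>a b c d z. a * d - b * c = 1 \<and> z \<in> upper_half \<longrightarrow> f (sl2_act a b c d z) = f z) \<and>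
     (\<exists>Y. \<forall>z. Im z > Y \<longrightarrow> f z = 0)}"

definition fund_dom :: "complex set" where
  "fund_dom = {z. Im z > 0 \<and> \<bar>Re z\<bar> \<le> 1/2 \<and> cmod z \<ge> 1}"

definition mu_M_integral :: "(complex \<Rightarrow> real) \<Rightarrow> real" where
  "mu_M_integral f = 3 / pi * (LINT z : fund_dom | lborel. f z / (Im z)^2)"

definition delta_integral :: "nat \<Rightarrow> real \<Rightarrow> real \<Rightarrow> (complex \<Rightarrow> real) \<Rightarrow> real" where
  "delta_integral n x y f = (1 / real n) * (\<Sum>j<n. f (Complex (x + real j / real n) y))"

definition delta_pr_integral :: "nat \<Rightarrow> real \<Rightarrow> real \<Rightarrow> (complex \<Rightarrow> real) \<Rightarrow> real" where
  "delta_pr_integral n x y f =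
     (1 / real (totient n)) * (\<Sum>j\<in>{j. j < n \<and> coprime j n}. f (Complex (x + real j / real n) y))"

definition N_q :: "nat \<Rightarrow> nat set" where
  "N_q q = {n. n \<ge> 1 \<and> gcd (n^2) q dvd n}"

definition N_q_pr :: "nat \<Rightarrow> nat set" where
  "N_q_pr q = {n. n \<ge> 1 \<and> coprime n q}"

end

theory Submission
  imports Defs "HOL-Probability.Sinc_Integral"
begin

text \<open>
  The proof is elementary. If $\gcd(n,q)=1$, every point of the primitive set at $p/q$ is moved by a
  suitable element of $SL_2(\mathbb Z)$ to height $1/(q^2n^2y)$, and the images form the primitive set
  of some other base point; so $y \asymp n^{-\alpha}$ is exchanged for the much larger height
  $n^{\alpha-2}$, at which $n$ points are far denser than the hyperbolic scale. Uniform continuity and a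
  sieve count of integers coprime to $n$ in short intervals then reduce the primitive case to the
  equidistribution of long closed horocycles. The full set splits into primitive sets of the divisors
  $m$ of $n$, and the divisor bound makes the small $m$ negligible. For $n \in \mathbb N_q$ the part of
  $q$ sharing primes with $n$ divides $n$ and is absorbed by a shift of $j$.

  For the long horocycles, write $f$ as the sum over $SL_2(\mathbb Z)$ of its restriction to the
  standard fundamental domain and unfold: for each fixed horocycle parameter $u$ the horocycle average
  becomes a weighted sum over coprime pairs $(a, c)$ with $c^2 y$ bounded. The sum over all pairs is a
  Riemann sum, and passing to coprime pairs divides the limit by $\zeta(2)$.
\<close>

subsection \<open>Riemann sums, dilated sums and integrals\<close>

text \<open>The normalisation of the limit is produced by the computation rather than assumed:
  coprimality contributes 6/pi^2, the substitution eta = 1/r^2 contributes 1/2, and the integral of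
  1/(1+u^2) contributes pi; the product is the 3/pi of \<open>mu_M_integral\<close>. The restriction
  of f to the fundamental domain jumps across the boundary, which shapes the analytic tools: limits
  of sums are stated with convergence only almost everywhere, and the points of a horocycle with two
  competing reductions are discarded as a countable set. In the unfolded average the upper left
  entry a of a matrix is an inverse of d modulo c; once t is integrated out, d survives only through
  a, so the sum runs freely over the residues a prime to c. The number e = (2 - alpha)/4 balances
  the last part: for divisors m between n^(1-e) and n the dual height lies between constant
  multiples of n^(-4e) and n^(-2e), hence tends to 0 while staying above m^(-1/2) for large n. The
  base point obtained by duality is uncontrolled, so the primitive equidistribution must be uniform
  in it.\<close>

lemma riemann_sum_tendsto:
  fixes h :: "nat \<Rightarrow> real" and \<phi> :: "nat \<Rightarrow> real \<Rightarrow> real"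
  assumes h: "\<And>n. h n > 0" "h \<longlonglongrightarrow> 0"
    and bound: "\<And>n r. 0 < r \<Longrightarrow> r \<le> R \<Longrightarrow> \<bar>\<phi> n r\<bar> \<le> B"
    and [measurable]: "g \<in> borel_measurable borel"
    and lim: "AE r in lborel. 0 < r \<longrightarrow> r < R \<longrightarrow> (\<forall>X. X \<longlonglongrightarrow> r \<longrightarrow> (\<lambda>n. \<phi> n (X n)) \<longlonglongrightarrow> g r)"
  shows "(\<lambda>n. \<Sum>k\<in>{1..nat \<lfloor>R / h n\<rfloor>}. h n * \<phi> n (real k * h n)) \<longlonglongrightarrow> (LINT r:{0<..<R}|lborel. g r)"
proof -
  define N where "N = (\<lambda>n. nat \<lfloor>R / h n\<rfloor>)"
  \<comment> \<open>\<open>S n\<close> is the step function that takes, on each interval of length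
    \<open>h n\<close>, the value of \<open>\<phi> n\<close> at the right endpoint; its integral is
    the sum in question. Right endpoints are positive and at most R, where the bound on
    \<open>\<phi> n\<close> is available.\<close>
  define S where "S = (\<lambda>n r. \<Sum>k\<in>{1..N n}. indicator {real (k-1) * h n<..real k * h n} r * \<phi> n (real k * h n))"
  have N_le: "real k * h n \<le> R" if "k \<in> {1..N n}" for k n
  proof -
    have "int k \<le> \<lfloor>R / h n\<rfloor>" using that by (auto simp: N_def)
    hence "real k \<le> R / h n" by (simp add: le_floor_iff)
    thus ?thesis using h(1)[of n] by (simp add: field_simps)
  qed
  have S_nonpos: "S n r = 0" if "r \<le> 0" for n r
    unfolding S_def
  proof (intro sum.neutral ballI)
    fix k
    have "0 \<le> real (k-1) * h n" using h(1)[of n] by simp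
    thus "indicator {real (k-1) * h n<..real k * h n} r * \<phi> n (real k * h n) = 0" using that by simp
  qed
  \<comment> \<open>For r > 0 exactly one of the half-open intervals contains r, the one numbered by
    the ceiling of r / h.\<close>
  define idx where "idx = (\<lambda>n r. nat \<lceil>r / h n\<rceil>)"
  have ind: "indicator {real (k-1) * h n<..real k * h n} r = (if k = idx n r then 1 else 0 :: real)"
    if "k \<ge> 1" "r > 0" for k n r
  proof -
    have hn: "h n > 0" using h by simp
    have "r / h n > 0" using that hn by simp
    hence "k = idx n r \<longleftrightarrow> \<lceil>r / h n\<rceil> = int k" using that by (auto simp: idx_def)
    also have "\<dots> \<longleftrightarrow> real k - 1 < r / h n \<and> r / h n \<le> real k" by (auto simp: ceiling_eq_iff)
    also have "\<dots> \<longleftrightarrow> real (k-1) * h n < r \<and> r \<le> real k * h n"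
      using that hn by (auto simp: of_nat_diff field_simps)
    finally show ?thesis by (auto simp: indicator_def)
  qed
  have S_pos: "S n r = (if idx n r \<in> {1..N n} then \<phi> n (real (idx n r) * h n) else 0)" if "r > 0" for n r
  proof -
    have "S n r = (\<Sum>k\<in>{1..N n}. if k = idx n r then \<phi> n (real k * h n) else 0)"
      unfolding S_def
    proof (intro sum.cong refl)
      fix k assume "k \<in> {1..N n}"
      hence "k \<ge> 1" by simp
      from ind[OF this that] show "indicator {real (k-1) * h n<..real k * h n} r * \<phi> n (real k * h n) =
          (if k = idx n r then \<phi> n (real k * h n) else 0)" by simp
    qed
    thus ?thesis by (simp add: sum.delta)
  qed
  have near: "r \<le> real (idx n r) * h n" "real (idx n r) * h n \<le> r + h n" if "r > 0" for r n
  proof -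
    have hn: "h n > 0" using h by simp
    have "r / h n > 0" using that hn by simp
    hence "r / h n \<le> real (idx n r)" "real (idx n r) \<le> r / h n + 1"
      unfolding idx_def by linarith+
    thus "r \<le> real (idx n r) * h n" "real (idx n r) * h n \<le> r + h n"
      using hn by (simp_all add: field_simps)
  qed
  have Sbound: "norm (S n r) \<le> \<bar>B\<bar> * indicator {0<..R} r" for n r
  proof (cases "r > 0")
    case True
    show ?thesis
    proof (cases "idx n r \<in> {1..N n}")
      case T: True
      have 1: "real (idx n r) * h n \<le> R" using N_le[OF T] .
      hence "r \<le> R" using near(1)[OF True, of n] by linarith
      moreover have "\<bar>\<phi> n (real (idx n r) * h n)\<bar> \<le> B"
        by (rule bound[OF _ 1]) (use near(1)[OF True, of n] True in linarith)
      ultimately show ?thesis using True T by (simp add: S_pos)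
    next
      case False
      hence "S n r = 0" using True by (simp only: S_pos if_False)
      thus ?thesis by simp
    qed
  qed (simp add: S_nonpos)
  have int: "integral\<^sup>L lborel (S n) = (\<Sum>k\<in>{1..N n}. h n * \<phi> n (real k * h n))" for n
  proof -
    have hn: "h n > 0" using h by simp
    have "integral\<^sup>L lborel (S n) = (\<Sum>k\<in>{1..N n}. LINT r|lborel. indicator {real (k-1) * h n<..real k * h n} r * \<phi> n (real k * h n))"
      unfolding S_def using hn
      by (intro Bochner_Integration.integral_sum) (auto intro!: integrable_mult_left)
    also have "\<dots> = (\<Sum>k\<in>{1..N n}. h n * \<phi> n (real k * h n))"
    proof (intro sum.cong refl)
      fix k assume "k \<in> {1..N n}"
      hence "real (k - 1) = real k - 1" by auto
      thus "(LINT r|lborel. indicator {real (k-1) * h n<..real k * h n} r * \<phi> n (real k * h n)) = h n * \<phi> n (real k * h n)"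
        using hn by (simp add: algebra_simps)
    qed
    finally show ?thesis .
  qed
  \<comment> \<open>Dominated convergence allows \<open>g\<close> to be the limit only almost
    everywhere. At a good r the sampled points lie within \<open>h n\<close> of r, and the
    hypothesis on all sequences tending to r supplies the limit although \<open>\<phi> n\<close>
    varies with n.\<close>
  have "(\<lambda>n. integral\<^sup>L lborel (S n)) \<longlonglongrightarrow> (LINT r|lborel. indicator {0<..<R} r * g r)"
  proof (rule integral_dominated_convergence[where w = "\<lambda>r. \<bar>B\<bar> * indicator {0<..R} r"])
    show "S n \<in> borel_measurable lborel" for n unfolding S_def by measurable
    show "integrable lborel (\<lambda>r. \<bar>B\<bar> * indicator {0<..R} r)"
    proof (cases "0 \<le> R")
      case False
      hence "{0<..R} = {}" by auto
      thus ?thesis by simp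
    qed (auto intro!: integrable_mult_right)
    show "AE r in lborel. norm (S n r) \<le> \<bar>B\<bar> * indicator {0<..R} r" for n
      using Sbound by simp
    show "AE r in lborel. (\<lambda>n. S n r) \<longlonglongrightarrow> indicator {0<..<R} r * g r"
      using lim AE_lborel_singleton[of R]
    proof eventually_elim
      case (elim r)
      consider "r \<le> 0" | "r > R" | "0 < r" "r < R" using elim(2) by fastforce
      thus ?case
      proof cases
        case 1 thus ?thesis by (simp add: S_nonpos)
      next
        case 2
        hence "S n r = 0" for n using Sbound[of n r] by simp
        thus ?thesis using 2 by simp
      next
        case 3
        define X where "X = (\<lambda>n. real (idx n r) * h n)"
        have X: "X \<longlonglongrightarrow> r"
        proof (rule tendsto_sandwich[of "\<lambda>_. r" _ _ "\<lambda>n. r + h n"])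
          show "(\<lambda>n. r + h n) \<longlonglongrightarrow> r" using tendsto_add[OF tendsto_const h(2), of r] by simp
          show "\<forall>\<^sub>F n in sequentially. r \<le> X n" "\<forall>\<^sub>F n in sequentially. X n \<le> r + h n"
            using near[OF 3(1)] by (auto simp: X_def)
        qed (rule tendsto_const)
        have "eventually (\<lambda>n. X n < R) sequentially" using X 3 by (auto intro: order_tendstoD)
        hence "eventually (\<lambda>n. \<phi> n (X n) = S n r) sequentially"
        proof eventually_elim
          case (elim n)
          have hn: "h n > 0" using h by simp
          have "r / h n > 0" using 3 hn by simp
          hence 1: "idx n r \<ge> 1" unfolding idx_def by linarith
          have "real (idx n r) \<le> R / h n" using elim hn by (simp add: X_def field_simps)
          hence "idx n r \<le> N n" unfolding N_def by (simp add: le_nat_floor)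
          thus ?case using 1 3 by (simp add: S_pos X_def)
        qed
        moreover have "(\<lambda>n. \<phi> n (X n)) \<longlonglongrightarrow> g r" using elim 3 X by blast
        ultimately show ?thesis using 3 by (auto intro: Lim_transform_eventually)
      qed
    qed
  qed measurable
  thus ?thesis unfolding int N_def by (simp add: set_lebesgue_integral_def)
qed

section \<open>Inverting a sum over square dilates\<close>

lemma inverse_squares_tail_sums: "(\<lambda>d. 1 / (real d + 2)\<^sup>2) sums (pi\<^sup>2 / 6 - 1)"
  using sums_split_initial_segment[OF inverse_squares_sums, of 1] by (simp add: add.commute)

text \<open>The inversion below needs zeta(2) - 1 bounded away from 1. The bound is 1/4 for the
  first term plus a telescoping 1/2 for the others, so no numerical estimate of pi enters.\<close>

lemma inverse_squares_tail_le: "pi\<^sup>2 / 6 - 1 \<le> 3/4"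
proof -
  have "(\<lambda>d. 1 / (real d + 1) - 1 / (real d + 2)) sums 1"
  proof -
    have "(\<lambda>n. 1 / (real n + 1)) \<longlonglongrightarrow> 0" by real_asymp
    from telescope_sums'[OF this] show ?thesis by (simp add: algebra_simps)
  qed
  from sums_split_initial_segment[OF this, of 1]
  have 1: "(\<lambda>d. 1 / (real d + 2) - 1 / (real d + 3)) sums (1/2)"
    by (simp add: add_ac)
  have 2: "(\<lambda>d. 1 / (real d + 3)\<^sup>2) sums (pi\<^sup>2 / 6 - 1 - 1/4)"
    using sums_split_initial_segment[OF inverse_squares_tail_sums, of 1] by (simp add: add_ac)
  have "pi\<^sup>2 / 6 - 1 - 1/4 \<le> 1/2"
  proof (rule sums_le[OF _ 2 1])
    fix d :: nat
    show "1 / (real d + 3)\<^sup>2 \<le> 1 / (real d + 2) - 1 / (real d + 3)"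
      by (simp add: divide_simps power2_eq_square)
  qed
  thus ?thesis by simp
qed

text \<open>Inverts $A(y) = \sum_d d^{-2} Q(d^2 y)$ without the Moebius function: since $\zeta(2) - 1 < 1$,
  the limsup of $|Q - \text{limit}|$ is bounded by a proper fraction of itself.\<close>
lemma tendsto_of_dilated_sum:
  fixes Q A :: "real \<Rightarrow> real"
  assumes bound: "\<And>y. y > 0 \<Longrightarrow> \<bar>Q y\<bar> \<le> B"
    and sums: "\<And>y. y > 0 \<Longrightarrow> (\<lambda>d. Q ((real d + 1)\<^sup>2 * y) / (real d + 1)\<^sup>2) sums A y"
    and lim: "(A \<longlongrightarrow> A0) (at_right 0)"
  shows "(Q \<longlongrightarrow> 6 / pi\<^sup>2 * A0) (at_right 0)"
proof -
  define L where "L = 6 / pi\<^sup>2 * A0"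
  define B' where "B' = \<bar>B\<bar> + \<bar>L\<bar> + 1"
  define e where "e = (\<lambda>y. Q y - L)"
  have e_bound: "\<bar>e y\<bar> \<le> B'" if "y > 0" for y
    using bound[OF that] unfolding e_def B'_def by linarith
  \<comment> \<open>The value of \<open>L\<close> makes the constant part cancel, since L * zeta(2)
    = A0. Isolating the undilated term leaves the dilates by 2, 3, ..., of total weight zeta(2) -
    1.\<close>
  have e_sums: "(\<lambda>d. e ((real d + 2)\<^sup>2 * y) / (real d + 2)\<^sup>2) sums (A y - A0 - e y)" if "y > 0" for y
  proof -
    have "(\<lambda>d. Q ((real d + 1)\<^sup>2 * y) / (real d + 1)\<^sup>2 - L * (1 / (real d + 1)\<^sup>2)) sums (A y - L * (pi\<^sup>2 / 6))"
      using inverse_squares_sums by (intro sums_diff sums sums_mult that) (simp add: add.commute)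
    moreover have "L * (pi\<^sup>2 / 6) = A0" by (simp add: L_def)
    ultimately have "(\<lambda>d. e ((real d + 1)\<^sup>2 * y) / (real d + 1)\<^sup>2) sums (A y - A0)"
      by (simp add: e_def diff_divide_distrib)
    from sums_split_initial_segment[OF this, of 1] show ?thesis by (simp add: add_ac)
  qed
  have summ: "summable (\<lambda>d. 1 / (real d + 2)\<^sup>2)" using inverse_squares_tail_sums by (simp add: sums_iff)
  \<comment> \<open>The factor 95/100 is 3/4 + 1/10 + 1/10: the weighted dilates near 0, the dilates
    beyond a cutoff, and the distance of \<open>A y\<close> from its limit.\<close>
  have step: "eventually (\<lambda>y. \<bar>e y\<bar> \<le> 95/100 * T) (at_right 0)"
    if T: "T > 0" and ev: "eventually (\<lambda>y. \<bar>e y\<bar> \<le> T) (at_right 0)" for T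
  proof -
    obtain b where b: "b > 0" "\<And>y. 0 < y \<Longrightarrow> y < b \<Longrightarrow> \<bar>e y\<bar> \<le> T"
      using ev by (auto simp: eventually_at_right_field)
    have "T / (10 * B') > 0" using T by (simp add: B'_def)
    \<comment> \<open>Beyond index \<open>D\<close> the dilated argument may leave the range where
      the bound T holds. Only the global bound \<open>B'\<close> is available there, so the tail of
      the weights has to be below T / (10 B').\<close>
    then obtain D where D: "norm (\<Sum>i. 1 / (real (i + D) + 2)\<^sup>2) < T / (10 * B')"
      using suminf_exist_split[OF _ summ, of "T / (10 * B')"] by auto
    have evA: "eventually (\<lambda>y. \<bar>A y - A0\<bar> < T / 10) (at_right 0)"
      using lim T unfolding tendsto_iff dist_real_def by (metis divide_pos_pos zero_less_numeral)
    have evy: "eventually (\<lambda>y. 0 < y \<and> y < b / (real D + 2)\<^sup>2) (at_right 0)"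
      unfolding eventually_at_right_field using b by (intro exI[of _ "b / (real D + 2)\<^sup>2"]) auto
    show ?thesis using evA evy
    proof eventually_elim
      case (elim y)
      let ?u = "\<lambda>d. T * (1 / (real d + 2)\<^sup>2) + (if d < D then 0 else B' * (1 / (real d + 2)\<^sup>2))"
      have "summable (\<lambda>d. if d < D then 0 else B' * (1 / (real d + 2)\<^sup>2))"
        using summable_mult[OF summ, of B'] by (rule summable_comparison_test'[of _ 0]) (auto simp: B'_def)
      moreover have "(\<Sum>d. if d < D then 0 else B' * (1 / (real d + 2)\<^sup>2)) = (\<Sum>i. B' * (1 / (real (i + D) + 2)\<^sup>2))"
        using suminf_split_initial_segment[OF calculation, of D] by simp
      ultimately have 1: "?u sums (T * (pi\<^sup>2/6 - 1) + (\<Sum>i. B' * (1 / (real (i + D) + 2)\<^sup>2)))"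
        using inverse_squares_tail_sums by (intro sums_add sums_mult) (auto simp: sums_iff)
      have "(\<Sum>i. B' * (1 / (real (i + D) + 2)\<^sup>2)) = B' * (\<Sum>i. 1 / (real (i + D) + 2)\<^sup>2)"
        using summ summable_iff_shift[of "\<lambda>d. 1 / (real d + 2)\<^sup>2" D] by (intro suminf_mult) simp
      also have "\<dots> \<le> B' * (T / (10 * B'))" using D by (intro mult_left_mono) (auto simp: B'_def)
      also have "\<dots> = T / 10" by (simp add: B'_def divide_simps)
      finally have 2: "(\<Sum>i. B' * (1 / (real (i + D) + 2)\<^sup>2)) \<le> T / 10" .
      have "\<bar>A y - A0 - e y\<bar> \<le> suminf ?u"
      proof -
        have le: "norm (e ((real d + 2)\<^sup>2 * y) / (real d + 2)\<^sup>2) \<le> ?u d" for d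
        proof (cases "d < D")
          case True
          have "(real d + 2)\<^sup>2 * y \<le> (real D + 2)\<^sup>2 * y"
            using elim True by (intro mult_right_mono power_mono) auto
          also have "\<dots> < b" using elim by (simp add: field_simps)
          finally have "\<bar>e ((real d + 2)\<^sup>2 * y)\<bar> \<le> T" using elim by (intro b) auto
          thus ?thesis using True by (simp add: divide_right_mono)
        next
          case False
          have "\<bar>e ((real d + 2)\<^sup>2 * y)\<bar> \<le> B'" using elim by (intro e_bound) auto
          hence "\<bar>e ((real d + 2)\<^sup>2 * y)\<bar> / (real d + 2)\<^sup>2 \<le> B' / (real d + 2)\<^sup>2" by (rule divide_right_mono) auto
          moreover have "T / (real d + 2)\<^sup>2 \<ge> 0" using T by simp
          ultimately show ?thesis using False by simp
        qed
        have "norm (\<Sum>d. e ((real d + 2)\<^sup>2 * y) / (real d + 2)\<^sup>2) \<le> suminf ?u"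
          using le 1 by (intro norm_suminf_le) (auto simp: sums_iff)
        thus ?thesis using e_sums[of y] elim by (simp add: sums_iff)
      qed
      also have "suminf ?u \<le> T * (3/4) + T / 10"
        using sums_unique[OF 1] 2 mult_left_mono[OF inverse_squares_tail_le, of T] T by linarith
      finally show ?case using elim by linarith
    qed
  qed
  have iter: "eventually (\<lambda>y. \<bar>e y\<bar> \<le> (95/100) ^ k * B') (at_right 0)" for k
  proof (induction k)
    case 0
    show ?case using e_bound by (auto simp: eventually_at_right_field intro!: exI[of _ 1])
  next
    case (Suc k)
    show ?case using step[OF _ Suc.IH] by (simp add: B'_def mult.assoc)
  qed
  have "(e \<longlongrightarrow> 0) (at_right 0)"
    unfolding tendsto_iff dist_real_def
  proof (intro allI impI)
    fix \<epsilon> :: real assume "\<epsilon> > 0"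
    moreover have "(\<lambda>k. (95/100) ^ k * B') \<longlonglongrightarrow> 0" by real_asymp
    ultimately obtain k where "(95/100) ^ k * B' < \<epsilon>"
      by (metis (mono_tags, lifting) eventually_sequentially order_refl order_tendstoD(2))
    with iter[of k] show "eventually (\<lambda>y. \<bar>e y - 0\<bar> < \<epsilon>) (at_right 0)"
      by (auto elim!: eventually_mono)
  qed
  hence "((\<lambda>y. e y + L) \<longlongrightarrow> 0 + L) (at_right 0)" by (intro tendsto_intros)
  thus ?thesis by (simp add: e_def L_def)
qed

text \<open>The integral over the modular surface is taken against Lebesgue measure of the complex
  plane; this identification opens it to Fubini. Agreement on boxes suffices.\<close>

lemma lborel_complex_eq: "(lborel :: complex measure) = distr (lborel \<Otimes>\<^sub>M lborel) borel (\<lambda>(x, y). Complex x y)"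
proof (rule lborel_eqI)
  have meas: "(\<lambda>(x, y). Complex x y) \<in> borel_measurable (lborel \<Otimes>\<^sub>M lborel)"
    unfolding lborel_prod Complex_eq split_beta
    unfolding measurable_lborel2 by (intro borel_measurable_continuous_onI continuous_intros)
  fix l u :: complex
  assume le: "\<And>b. b \<in> Basis \<Longrightarrow> l \<bullet> b \<le> u \<bullet> b"
  have le': "Re l \<le> Re u" "Im l \<le> Im u" using le[of 1] le[of \<i>] by (auto simp: Basis_complex_def)
  have "(\<lambda>(x, y). Complex x y) -` box l u \<inter> space (lborel \<Otimes>\<^sub>M lborel) = {Re l<..<Re u} \<times> {Im l<..<Im u}"
    by (auto simp: box_def Basis_complex_def space_pair_measure)
  hence "emeasure (distr (lborel \<Otimes>\<^sub>M lborel) borel (\<lambda>(x, y). Complex x y)) (box l u) =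
      emeasure (lborel \<Otimes>\<^sub>M lborel) ({Re l<..<Re u} \<times> {Im l<..<Im u})"
    using meas by (subst emeasure_distr) auto
  also have "\<dots> = ennreal (Re u - Re l) * ennreal (Im u - Im l)"
    using le' by (simp add: lborel.emeasure_pair_measure_Times)
  also have "\<dots> = (\<Prod>b\<in>Basis. (u - l) \<bullet> b)"
    using le' by (simp add: Basis_complex_def ennreal_mult' mult.commute)
  finally show "emeasure (distr (lborel \<Otimes>\<^sub>M lborel) borel (\<lambda>(x, y). Complex x y)) (box l u) =
    ennreal (\<Prod>b\<in>Basis. (u - l) \<bullet> b)" .
qed simp

text \<open>Later r is the rescaled denominator c sqrt(y) and eta = 1/r^2 the corresponding height;
  the division by 2 is the Jacobian of this change.\<close>

lemma integral_inverse_square_substitution: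
  fixes \<kappa> :: "real \<Rightarrow> real"
  assumes [measurable]: "\<kappa> \<in> borel_measurable borel" and bound: "\<And>x. \<bar>\<kappa> x\<bar> \<le> B" and ab: "0 < a" "a \<le> b"
  shows "(LINT r:{a..b}|lborel. r * \<kappa> (1 / r\<^sup>2)) = (LINT \<eta>:{1/b\<^sup>2..1/a\<^sup>2}|lborel. \<kappa> \<eta> / \<eta>\<^sup>2) / 2"
proof -
  \<comment> \<open>The substitution rule asks for an increasing map, so -1/r^2 is used and the sign
    is removed by a reflection at the end.\<close>
  let ?g = "\<lambda>r::real. - (1 / r\<^sup>2)" and ?g' = "\<lambda>r::real. 2 / r^3" and ?f = "\<lambda>x. \<kappa> (-x) / x\<^sup>2"
  have g_le: "?g a \<le> ?g b" using ab by (simp add: frac_le power_mono)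
  have "set_integrable lborel {?g a..?g b} ?f"
    unfolding set_integrable_def
  proof (rule integrableI_bounded_set_indicator[where B = "B * (b\<^sup>2)\<^sup>2"])
    have B: "B \<ge> 0" using bound[of 0] by linarith
    show "AE x in lborel. x \<in> {?g a..?g b} \<longrightarrow> norm (?f x) \<le> B * (b\<^sup>2)\<^sup>2"
    proof (intro AE_I2 impI)
      fix x assume x: "x \<in> {?g a..?g b}"
      hence "1 / b\<^sup>2 \<le> -x" by auto
      hence "(1 / b\<^sup>2)\<^sup>2 \<le> (-x)\<^sup>2" by (intro power_mono) auto
      hence "1 \<le> x\<^sup>2 * (b\<^sup>2)\<^sup>2" using ab by (simp add: power_divide divide_simps)
      moreover from this have "x\<^sup>2 > 0" by (cases "x = 0") auto
      ultimately have "1 / x\<^sup>2 \<le> (b\<^sup>2)\<^sup>2" by (simp add: field_simps)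
      hence "\<bar>\<kappa> (-x)\<bar> * (1 / x\<^sup>2) \<le> B * (b\<^sup>2)\<^sup>2" using bound B by (intro mult_mono) auto
      thus "norm (?f x) \<le> B * (b\<^sup>2)\<^sup>2" by (simp add: abs_divide)
    qed
    show "emeasure lborel {?g a..?g b} < \<infinity>" using g_le by simp
  qed auto
  note integrable = this
  have "(LBINT x. ?f x * indicator {?g a..?g b} x) = (LBINT x. ?f (?g x) * ?g' x * indicator {a..b} x)"
  proof (rule integral_substitution(2)[where g = ?g and g' = ?g' and f = ?f])
    fix x assume "x \<in> {a..b}"
    hence "x > 0" using ab by auto
    thus "(?g has_real_derivative ?g' x) (at x)"
      by (auto intro!: derivative_eq_intros simp: divide_simps power2_eq_square power3_eq_cube)
    show "?g' x \<ge> 0" using \<open>x > 0\<close> by simp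
  next
    show "set_integrable lborel {?g a..?g b} ?f" by (rule integrable)
  next
    show "continuous_on {a..b} ?g'" using ab by (intro continuous_intros) auto
  qed (use ab in auto)
  also have "(LBINT x. ?f (?g x) * ?g' x * indicator {a..b} x) = 2 * (LINT r:{a..b}|lborel. r * \<kappa> (1 / r\<^sup>2))"
    unfolding set_lebesgue_integral_def
    by (subst integral_mult_right_zero[symmetric], intro Bochner_Integration.integral_cong refl)
       (auto simp: indicator_def field_simps power2_eq_square power3_eq_cube)
  also have "(LBINT x. ?f x * indicator {?g a..?g b} x) = (LINT \<eta>:{1/b\<^sup>2..1/a\<^sup>2}|lborel. \<kappa> \<eta> / \<eta>\<^sup>2)"
    unfolding set_lebesgue_integral_def
    by (subst lborel_integral_real_affine[of "-1" _ 0])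
       (auto intro!: Bochner_Integration.integral_cong simp: indicator_def)
  finally show ?thesis by simp
qed

subsection \<open>Coprime integers in intervals and divisor bounds\<close>

text \<open>Legendre's sieve, by induction on the set of primes: the integers newly removed are
  multiples of p, and dividing them by p gives the same sifting problem on the interval from A/p to
  B/p. Each prime doubles the error. Real endpoints are what permits this rescaling.\<close>

lemma card_sifted_interval:
  fixes A B :: real
  assumes "finite P" "\<And>p. p \<in> P \<Longrightarrow> prime (p::nat)" "A \<le> B"
  shows "\<bar>real (card {j::int. A \<le> j \<and> j < B \<and> (\<forall>p\<in>P. \<not> int p dvd j)}) - (B - A) * (\<Prod>p\<in>P. 1 - 1 / real p)\<bar>
           \<le> 2 ^ card P"
  using assms
proof (induction P arbitrary: A B rule: finite_induct)
  case empty
  have "{j::int. A \<le> j \<and> j < B} = {\<lceil>A\<rceil>..<\<lceil>B\<rceil>}"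
    by (auto simp: ceiling_le_iff less_ceiling_iff)
  moreover have "\<lceil>A\<rceil> \<le> \<lceil>B\<rceil>" using empty by (simp add: ceiling_mono)
  ultimately show ?case by (simp, linarith)
next
  case (insert p P)
  let ?S = "\<lambda>(A::real) (B::real). {j::int. A \<le> j \<and> j < B \<and> (\<forall>p\<in>P. \<not> int p dvd j)}"
  let ?T = "{j::int. A \<le> j \<and> j < B \<and> (\<forall>p\<in>insert p P. \<not> int p dvd j)}"
  have p: "prime p" "p > 0" using insert.prems(1)[of p] prime_gt_0_nat by auto
  have fin: "finite (?S A B)" for A B
    by (rule finite_subset[of _ "{\<lceil>A\<rceil>..<\<lceil>B\<rceil>}"]) (auto simp: ceiling_le_iff less_ceiling_iff)
  have dvd: "int l dvd int p * j \<longleftrightarrow> int l dvd j" if "l \<in> P" for l j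
  proof -
    have "prime l" "l \<noteq> p" using insert that by auto
    hence "coprime (int l) (int p)" using p primes_coprime by auto
    thus ?thesis by (simp add: coprime_dvd_mult_right_iff)
  qed
  have "?S A B = ?T \<union> (\<lambda>j. int p * j) ` ?S (A / p) (B / p)"
  proof (rule subset_antisym; rule subsetI)
    fix j assume j: "j \<in> ?S A B"
    show "j \<in> ?T \<union> (\<lambda>j. int p * j) ` ?S (A / p) (B / p)"
    proof (cases "int p dvd j")
      case True
      then obtain k where k: "j = int p * k" by (auto simp: dvd_def)
      hence "k \<in> ?S (A / p) (B / p)" using j p dvd
        by (auto simp: field_simps)
      thus ?thesis using k by blast
    qed (use j in auto)
  next
    fix j assume "j \<in> ?T \<union> (\<lambda>j. int p * j) ` ?S (A / p) (B / p)"
    thus "j \<in> ?S A B" using p dvd by (auto simp: field_simps)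
  qed
  moreover have "?T \<inter> (\<lambda>j. int p * j) ` ?S (A / p) (B / p) = {}" by auto
  moreover have "card ((\<lambda>j. int p * j) ` ?S (A / p) (B / p)) = card (?S (A / p) (B / p))"
    using p by (intro card_image) (auto simp: inj_on_def)
  moreover have "finite ?T" by (rule finite_subset[OF _ fin[of A B]]) auto
  ultimately have card: "card (?S A B) = card ?T + card (?S (A / p) (B / p))"
    by (simp only: card_Un_disjoint finite_imageI fin)
  define Z where "Z = (\<Prod>p\<in>P. 1 - 1 / real p)"
  have 1: "\<bar>real (card (?S A B)) - (B - A) * Z\<bar> \<le> 2 ^ card P"
    unfolding Z_def using insert.IH[of A B] insert.prems by auto
  have 2: "\<bar>real (card (?S (A/p) (B/p))) - (B/p - A/p) * Z\<bar> \<le> 2 ^ card P"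
    unfolding Z_def using insert.IH[of "A/p" "B/p"] insert.prems p by (auto simp: divide_right_mono)
  have "real (card ?T) - (B - A) * ((1 - 1 / p) * Z) =
      (real (card (?S A B)) - (B - A) * Z) - (real (card (?S (A/p) (B/p))) - (B/p - A/p) * Z)"
    using card by (simp add: algebra_simps diff_divide_distrib)
  hence "\<bar>real (card ?T) - (B - A) * ((1 - 1 / p) * Z)\<bar> \<le> 2 * 2 ^ card P"
    using 1 2 by linarith
  thus ?case using insert by (simp add: Z_def)
qed

section \<open>The divisor bound and a lower bound for the totient\<close>

lemma card_divisors_le:
  fixes n :: nat
  assumes "n > 0"
  shows "card {d. d dvd n} \<le> (\<Prod>p\<in>prime_factors n. multiplicity p n + 1)"
proof -
  let ?g = "\<lambda>d. restrict (\<lambda>p. multiplicity p d) (prime_factors n)"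
  have "card {d. d dvd n} \<le> card (\<Pi>\<^sub>E p\<in>prime_factors n. {..multiplicity p n})"
  proof (rule card_inj_on_le[of ?g])
    show "inj_on ?g {d. d dvd n}"
    proof (rule inj_onI, clarsimp)
      fix a b assume ab: "a dvd n" "b dvd n" and eq: "?g a = ?g b"
      have "multiplicity p a = multiplicity p b" if "prime p" for p
      proof (cases "p \<in> prime_factors n")
        case True thus ?thesis using fun_cong[OF eq, of p] by simp
      next
        case False
        hence "\<not> p dvd n" using that assms by (auto simp: prime_factors_dvd)
        hence "\<not> p dvd a" "\<not> p dvd b" using ab by (auto dest: dvd_trans)
        thus ?thesis by (simp add: not_dvd_imp_multiplicity_0)
      qed
      moreover have "a \<noteq> 0" "b \<noteq> 0" using ab assms by (auto intro!: Nat.gr0I)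
      ultimately show "a = b" using multiplicity_eq_nat[of a b] by auto
    qed
    show "?g ` {d. d dvd n} \<subseteq> (\<Pi>\<^sub>E p\<in>prime_factors n. {..multiplicity p n})"
      using assms by (auto intro!: dvd_imp_multiplicity_le)
    show "finite (\<Pi>\<^sub>E p\<in>prime_factors n. {..multiplicity p n})"
      by (intro finite_PiE) auto
  qed
  thus ?thesis by (simp add: card_PiE)
qed

text \<open>Prime by prime, a + 1 is at most p^(e a) as soon as p >= 2^(1/e), and at most a constant
  times it for each of the boundedly many smaller primes. The product controls both the number of
  divisors and 2^omega(n).\<close>

lemma prod_multiplicity_bound:
  assumes "e > (0::real)"
  obtains C where "C \<ge> 1" "\<And>n. n > 0 \<Longrightarrow> real (\<Prod>p\<in>prime_factors n. multiplicity p n + 1) \<le> C * real n powr e"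
proof -
  \<comment> \<open>\<open>D\<close> is chosen so that a + 1 <= D (1 + e a ln 2), while the bracket
    is at most 2^(e a).\<close>
  define D where "D = 1 + 1 / (e * ln 2)"
  define P0 where "P0 = nat \<lceil>2 powr (1/e)\<rceil>"
  have D1: "D \<ge> 1" using assms by (simp add: D_def)
  define c where "c = (\<lambda>p::nat. if p < P0 then D else 1)"
  have c1: "c p \<ge> 1" for p using D1 by (simp add: c_def)
  have key: "real a + 1 \<le> c p * real p powr (e * a)" if "prime p" for a p
  proof (cases "p < P0")
    case True
    have "real p \<ge> 2" using prime_ge_2_nat[OF that] by simp
    hence "real p powr (e * a) \<ge> 2 powr (e * a)" using assms by (intro powr_mono2) auto
    moreover have "(2::real) powr (e * a) = exp (e * a * ln 2)" by (simp add: powr_def)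
    moreover have "exp (e * a * ln 2) \<ge> 1 + e * a * ln 2" using exp_ge_add_one_self by blast
    ultimately have *: "real p powr (e * a) \<ge> 1 + e * a * ln 2" by linarith
    have "real a + 1 \<le> D * (1 + e * a * ln 2)"
      using assms by (simp add: D_def field_simps)
    also have "\<dots> \<le> D * real p powr (e * a)" using * D1 by (intro mult_left_mono) auto
    finally show ?thesis using True by (simp add: c_def)
  next
    case False
    hence "2 powr (1/e) \<le> real p" unfolding P0_def by linarith
    hence "(2 powr (1/e)) powr (e * a) \<le> real p powr (e * a)" using assms by (intro powr_mono2) auto
    hence "2 powr real a \<le> real p powr (e * a)" using assms by (simp add: powr_powr)
    moreover have "real a + 1 \<le> 2 powr real a"
    proof -
      have "a + 1 \<le> 2 ^ a" by (induction a) auto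
      hence "real (a + 1) \<le> real (2 ^ a)" using of_nat_le_iff by blast
      thus ?thesis by (simp add: powr_realpow)
    qed
    ultimately show ?thesis using False by (simp add: c_def)
  qed
  show thesis
  proof
    show "D ^ P0 \<ge> 1" using D1 by simp
    fix n :: nat assume n: "n > 0"
    have "real (\<Prod>p\<in>prime_factors n. multiplicity p n + 1) = (\<Prod>p\<in>prime_factors n. real (multiplicity p n) + 1)"
      by (simp add: add.commute)
    also have "\<dots> \<le> (\<Prod>p\<in>prime_factors n. c p * real p powr (e * multiplicity p n))"
      by (intro prod_mono conjI key) auto
    also have "\<dots> = (\<Prod>p\<in>prime_factors n. c p) * (\<Prod>p\<in>prime_factors n. real p powr (e * multiplicity p n))"
      by (simp add: prod.distrib)
    also have "(\<Prod>p\<in>prime_factors n. real p powr (e * multiplicity p n)) =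
        (\<Prod>p\<in>prime_factors n. real (p ^ multiplicity p n) powr e)"
      by (intro prod.cong refl) (auto simp: powr_powr mult.commute prime_gt_0_nat in_prime_factors_iff simp flip: powr_realpow)
    also have "\<dots> = real (\<Prod>p\<in>prime_factors n. p ^ multiplicity p n) powr e"
      by (simp add: prod_powr_distrib prod_nonneg)
    also have "(\<Prod>p\<in>prime_factors n. p ^ multiplicity p n) = n"
      using n prime_factorization_nat[of n] by simp
    also have "(\<Prod>p\<in>prime_factors n. c p) \<le> D ^ P0"
    proof -
      have "(\<Prod>p\<in>prime_factors n. c p) = (\<Prod>p\<in>prime_factors n \<inter> {..<P0}. D)"
        by (rule prod.mono_neutral_cong_right) (auto simp: c_def)
      also have "\<dots> = D ^ card (prime_factors n \<inter> {..<P0})" by simp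
      also have "\<dots> \<le> D ^ P0" using D1 card_mono[of "{..<P0}" "prime_factors n \<inter> {..<P0}"]
        by (intro power_increasing) auto
      finally show ?thesis .
    qed
    finally show "real (\<Prod>p\<in>prime_factors n. multiplicity p n + 1) \<le> D ^ P0 * real n powr e"
      using mult_right_mono by (meson powr_ge_zero)
  qed
qed

lemma two_power_omega_le: "2 ^ card (prime_factors n) \<le> (\<Prod>p\<in>prime_factors n. multiplicity p n + 1)" for n :: nat
proof -
  have "(\<Prod>p\<in>prime_factors n. 2) \<le> (\<Prod>p\<in>prime_factors n. multiplicity p n + 1)"
    by (intro prod_mono) (auto simp: prime_factors_multiplicity)
  thus ?thesis by simp
qed

text \<open>Crude, as every 1 - 1/p is bounded by 1/2, but 2^omega(n) grows more slowly than any
  positive power of n, so the loss is harmless against a power saving.\<close>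

lemma totient_ge_omega:
  assumes "n > 0"
  shows "real n \<le> 2 ^ card (prime_factors n) * real (totient n)"
proof -
  have "(\<Prod>p\<in>prime_factors n. 1/2) \<le> (\<Prod>p\<in>prime_factors n. 1 - 1 / real p)"
  proof (intro prod_mono conjI)
    fix p assume "p \<in> prime_factors n"
    hence "real p \<ge> 2" using prime_ge_2_nat[of p] by auto
    thus "1/2 \<le> 1 - 1 / real p" by (simp add: field_simps)
  qed auto
  hence "(1/2) ^ card (prime_factors n) * real n \<le> real (totient n)"
    by (subst totient_formula2) (simp add: mult.commute mult_left_mono)
  thus ?thesis by (simp add: field_simps)
qed

lemma coprime_iff_no_prime_factor:
  assumes "n > 0"
  shows "coprime j (int n) \<longleftrightarrow> (\<forall>p\<in>prime_factors n. \<not> int p dvd j)"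
proof
  assume "coprime j (int n)"
  thus "\<forall>p\<in>prime_factors n. \<not> int p dvd j"
    by (metis coprime_common_divisor in_prime_factors_iff int_dvd_int_iff not_prime_unit of_nat_dvd_iff prime_nat_int_transfer)
next
  assume *: "\<forall>p\<in>prime_factors n. \<not> int p dvd j"
  show "coprime j (int n)"
  proof (rule ccontr)
    assume "\<not> coprime j (int n)"
    hence "gcd j (int n) \<noteq> 1" by (simp add: coprime_iff_gcd_eq_1)
    hence "nat (gcd j (int n)) \<noteq> 1" by (metis nat_one_as_int one_natural.rsp gcd_ge_0_int int_nat_eq nat_1 of_nat_1)
    then obtain p where p: "prime p" "p dvd nat (gcd j (int n))" using prime_factor_nat by blast
    hence "int p dvd gcd j (int n)" by (metis gcd_ge_0_int int_dvd_int_iff int_nat_eq)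
    thus False using * p assms by (auto simp: prime_factors_dvd)
  qed
qed

lemma card_coprime_interval:
  fixes A B :: real
  assumes "n > 0" "A \<le> B"
  shows "\<bar>real (card {j::int. A \<le> j \<and> j < B \<and> coprime j (int n)}) - (B - A) * (real (totient n) / real n)\<bar>
           \<le> 2 ^ card (prime_factors n)"
  using card_sifted_interval[of "prime_factors n" A B] assms
  by (simp add: coprime_iff_no_prime_factor totient_formula2 in_prime_factors_iff)

subsection \<open>Reduction to the fundamental domain\<close>

text \<open>The union of the integer translates of the standard fundamental domain. Its boundary is
  where the distance to the integers is exactly 1, so \<^term>\<open>infdist\<close> makes continuity off the
  boundary immediate.\<close>
definition cusp_region :: "complex set" where
  "cusp_region = {w. Im w > 0 \<and> infdist w \<int> \<ge> 1}"

definition cusp_part :: "(complex \<Rightarrow> real) \<Rightarrow> complex \<Rightarrow> real" where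
  "cusp_part f w = (if w \<in> cusp_region then f w else 0)"

lemma mem_cusp_region: "w \<in> cusp_region \<longleftrightarrow> Im w > 0 \<and> (\<forall>n::int. 1 \<le> cmod (w + of_int n))"
proof -
  have "infdist w \<int> \<ge> 1 \<longleftrightarrow> (\<forall>a\<in>\<int>. 1 \<le> dist w a)"
  proof
    assume "infdist w \<int> \<ge> 1"
    thus "\<forall>a\<in>\<int>. 1 \<le> dist w a" using infdist_le order_trans by blast
  next
    assume *: "\<forall>a\<in>\<int>. 1 \<le> dist w a"
    have "(\<int> :: complex set) \<noteq> {}" using Ints_0 by blast
    thus "infdist w \<int> \<ge> 1" unfolding infdist_def using * by (auto intro!: cINF_greatest)
  qed
  also have "\<dots> \<longleftrightarrow> (\<forall>n::int. 1 \<le> cmod (w + of_int n))"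
  proof safe
    fix n :: int assume "\<forall>a\<in>\<int>. 1 \<le> dist w a"
    from bspec[OF this, of "- of_int n"] show "1 \<le> cmod (w + of_int n)" by (simp add: dist_norm)
  next
    fix a :: complex assume *: "\<forall>n::int. 1 \<le> cmod (w + of_int n)" and "a \<in> \<int>"
    then obtain n where "a = of_int n" by (auto elim: Ints_cases)
    thus "1 \<le> dist w a" using *[rule_format, of "-n"] by (simp add: dist_norm)
  qed
  finally show ?thesis by (auto simp: cusp_region_def)
qed

lemma cusp_region_add_int [simp]: "w + of_int n \<in> cusp_region \<longleftrightarrow> w \<in> cusp_region"
proof -
  have "w \<in> cusp_region \<Longrightarrow> w + of_int n \<in> cusp_region" for w n
    unfolding mem_cusp_region
  proof (intro conjI allI)
    fix w n m
    assume *: "Im w > 0 \<and> (\<forall>n::int. 1 \<le> cmod (w + of_int n))"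
    thus "Im (w + of_int n) > 0" by simp
    from * have "1 \<le> cmod (w + of_int (n + m))" by blast
    thus "1 \<le> cmod (w + of_int n + of_int m)" by (simp add: add.assoc)
  qed
  from this[of w n] this[of "w + of_int n" "-n"] show ?thesis by auto
qed

text \<open>Some integer lies within horizontal distance 1/2, so distance 1 from it forces height at
  least sqrt(3)/2. The rational 4/5 below sqrt(3)/2 is the form used in estimates.\<close>

lemma Im_cusp_region:
  assumes "w \<in> cusp_region"
  shows "(Im w)\<^sup>2 \<ge> 3/4" "Im w > 4/5"
proof -
  have "1 \<le> cmod (w + of_int (- round (Re w)))" using assms by (simp only: mem_cusp_region)
  hence "1 \<le> (cmod (w + of_int (- round (Re w))))\<^sup>2" by (simp only: one_le_power)
  also have "\<dots> = (Re w - of_int (round (Re w)))\<^sup>2 + (Im w)\<^sup>2" by (simp add: cmod_power2)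
  also have "\<bar>Re w - of_int (round (Re w))\<bar> \<le> 1/2"
    using of_int_round_abs_le[of "Re w"] by (simp add: abs_minus_commute)
  hence "(Re w - of_int (round (Re w)))\<^sup>2 \<le> (1/2)\<^sup>2" by (rule power2_le_iff_abs_le[THEN iffD2, rotated]) simp
  finally show 1: "(Im w)\<^sup>2 \<ge> 3/4" by (simp add: power2_eq_square)
  have "Im w > 0" using assms by (simp add: mem_cusp_region)
  show "Im w > 4/5"
  proof (rule ccontr)
    assume "\<not> Im w > 4/5"
    hence "(Im w)\<^sup>2 \<le> (4/5)\<^sup>2" using \<open>Im w > 0\<close> by (intro power_mono) auto
    thus False using 1 by (simp add: power2_eq_square)
  qed
qed

text \<open>For |e| = 1 this is membership in the region; for |e| >= 2 the imaginary part alone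
  exceeds 8/5.\<close>

lemma cusp_region_norm_ge:
  fixes e g :: int
  assumes w: "w \<in> cusp_region" and eg: "(e, g) \<noteq> (0, 0)"
  shows "1 \<le> cmod (of_int e * w + of_int g)"
proof -
  consider "e = 0" | "e = 1" | "e = -1" | "\<bar>e\<bar> \<ge> 2" by linarith
  thus ?thesis
  proof cases
    case 1
    thus ?thesis using eg by auto
  next
    case 2 thus ?thesis using w by (simp add: mem_cusp_region)
  next
    case 3
    have "1 \<le> cmod (w + of_int (-g))" using w by (simp only: mem_cusp_region)
    also have "\<dots> = cmod (of_int e * w + of_int g)" using 3 norm_minus_cancel[of "w - of_int g"] by simp
    finally show ?thesis .
  next
    case 4
    hence "real_of_int \<bar>e\<bar> \<ge> 2" by linarith
    hence "2 * (4/5) \<le> \<bar>real_of_int e\<bar> * Im w" using Im_cusp_region(2)[OF w] by (intro mult_mono) auto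
    also have "\<dots> = \<bar>Im (of_int e * w + of_int g)\<bar>" using Im_cusp_region(2)[OF w] by (simp add: abs_mult)
    also have "\<dots> \<le> cmod (of_int e * w + of_int g)" by (rule abs_Im_le_cmod)
    finally show ?thesis by simp
  qed
qed

section \<open>The action of SL_2(Z) and reduction to the region\<close>

lemma denom_nonzero:
  fixes c d :: int
  assumes "Im z > 0" "(c, d) \<noteq> (0, 0)"
  shows "of_int c * z + of_int d \<noteq> 0"
proof
  assume "of_int c * z + of_int d = 0"
  hence "Im (of_int c * z + of_int d) = 0" "Re (of_int c * z + of_int d) = 0" by simp_all
  thus False using assms by auto
qed

lemma Im_sl2_act:
  assumes "a * d - b * c = 1" "Im z > 0"
  shows "Im (sl2_act a b c d z) = Im z / (cmod (of_int c * z + of_int d))\<^sup>2"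
proof -
  have "real_of_int (a * d - b * c) = 1" using assms by simp
  hence "real_of_int a * real_of_int d - real_of_int b * real_of_int c = 1" by simp
  moreover have "Im (sl2_act a b c d z) = (real_of_int a * real_of_int d - real_of_int b * real_of_int c) * Im z / (cmod (of_int c * z + of_int d))\<^sup>2"
    unfolding sl2_act_def by (simp add: Im_divide cmod_power2 algebra_simps)
  ultimately show ?thesis by simp
qed

lemma sl2_act_in_upper_half:
  assumes "a * d - b * c = 1" "Im z > 0"
  shows "Im (sl2_act a b c d z) > 0"
proof -
  have "(c, d) \<noteq> (0, 0)" using assms(1) by auto
  hence "of_int c * z + of_int d \<noteq> 0" by (rule denom_nonzero[OF assms(2)])
  thus ?thesis using assms by (simp add: Im_sl2_act)
qed

text \<open>Another row (c2, d2) is an integer combination of the rows of the matrix, and dividing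
  its linear form in z by c z + d turns it into e w + g with w in the region, of modulus at least 1.
  This minimality makes representatives comparable when a horocycle is unfolded.\<close>

lemma cusp_region_minimal:
  assumes det: "a * d - b * c = 1" and z: "Im z > 0" and w: "sl2_act a b c d z \<in> cusp_region"
    and c2: "(c2, d2) \<noteq> (0, 0)"
  shows "cmod (of_int c * z + of_int d) \<le> cmod (of_int c2 * z + of_int d2)"
proof -
  \<comment> \<open>Cramer's rule for the coefficients of (c2, d2) in the basis formed by the rows
    (a, b) and (c, d).\<close>
  define e where "e = c2 * d - d2 * c"
  define g where "g = d2 * a - c2 * b"
  have "e * a + g * c = c2 * (a * d - b * c)" "e * b + g * d = d2 * (a * d - b * c)"
    by (simp_all add: e_def g_def algebra_simps)
  hence c2_eq: "c2 = e * a + g * c" "d2 = e * b + g * d" by (simp_all add: det)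
  have "c \<noteq> 0 \<or> d \<noteq> 0" using det by auto
  hence nz: "of_int c * z + of_int d \<noteq> 0" using denom_nonzero[OF z] by auto
  have "of_int c2 * z + of_int d2 = of_int e * (of_int a * z + of_int b) + of_int g * (of_int c * z + of_int d)"
    unfolding c2_eq by (simp add: algebra_simps)
  also have "\<dots> = (of_int e * sl2_act a b c d z + of_int g) * (of_int c * z + of_int d)"
    using nz by (simp add: sl2_act_def distrib_right)
  finally have "cmod (of_int c2 * z + of_int d2) =
      cmod (of_int e * sl2_act a b c d z + of_int g) * cmod (of_int c * z + of_int d)" by (simp add: norm_mult)
  moreover have "1 \<le> cmod (of_int e * sl2_act a b c d z + of_int g)"
    using c2 c2_eq by (intro cusp_region_norm_ge w) auto
  ultimately show ?thesis by (simp add: mult_le_cancel_right1)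
qed

text \<open>The lattice spanned by z and 1 has finitely many points in the closed unit disc, and the
  row (0, 1) already reaches modulus 1, so a minimum over the disc is a global one.\<close>

lemma exists_minimal_denom:
  assumes z: "Im z > 0"
  obtains c d :: int where "coprime c d"
    "\<And>c' d'. coprime c' d' \<Longrightarrow> cmod (of_int c * z + of_int d) \<le> cmod (of_int c' * z + of_int d')"
proof -
  define S where "S = {(c::int, d::int). coprime c d \<and> cmod (of_int c * z + of_int d) \<le> 1}"
  define m where "m = \<lceil>1 / Im z\<rceil>"
  define m' where "m' = \<lceil>1 + real_of_int m * cmod z\<rceil>"
  have "S \<subseteq> {-m..m} \<times> {-m'..m'}"
  proof (clarsimp simp: S_def, intro conjI)
    fix c d assume *: "cmod (of_int c * z + of_int d) \<le> 1"
    have "\<bar>real_of_int c\<bar> * Im z \<le> 1"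
      using abs_Im_le_cmod[of "of_int c * z + of_int d"] * z by (simp add: abs_mult)
    hence "\<bar>real_of_int c\<bar> \<le> 1 / Im z" using z by (simp add: field_simps)
    hence c: "\<bar>real_of_int c\<bar> \<le> real_of_int m" unfolding m_def by linarith
    thus "- m \<le> c" "c \<le> m" by linarith+
    have "\<bar>real_of_int d\<bar> = cmod ((of_int c * z + of_int d) - of_int c * z)" by simp
    also have "\<dots> \<le> cmod (of_int c * z + of_int d) + cmod (of_int c * z)" by (rule norm_triangle_ineq4)
    also have "\<dots> \<le> 1 + real_of_int m * cmod z" using * c by (auto simp: norm_mult intro!: add_mono mult_right_mono)
    finally have "\<bar>real_of_int d\<bar> \<le> real_of_int m'" unfolding m'_def by linarith
    thus "- m' \<le> d" "d \<le> m'" by linarith+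
  qed
  hence fin: "finite S" by (rule finite_subset) auto
  have in_S: "(0, 1) \<in> S" by (simp add: S_def)
  define F where "F = (\<lambda>(c::int, d::int). cmod (of_int c * z + of_int d))"
  obtain x where x: "x \<in> S" "\<And>x'. x' \<in> S \<Longrightarrow> F x \<le> F x'"
  proof -
    have ne: "S \<noteq> {}" using in_S by blast
    show ?thesis
      using that[of "arg_min_on F S"] arg_min_if_finite[OF fin ne, of F] by (auto simp: not_less)
  qed
  obtain c d where cd: "x = (c, d)" by force
  show thesis
  proof (rule that)
    show "coprime c d" using x cd by (auto simp: S_def)
    fix c' d' :: int assume "coprime c' d'"
    show "cmod (of_int c * z + of_int d) \<le> cmod (of_int c' * z + of_int d')"
    proof (cases "cmod (of_int c' * z + of_int d') \<le> 1")
      case True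
      hence "(c', d') \<in> S" using \<open>coprime c' d'\<close> by (simp add: S_def)
      from x(2)[OF this] show ?thesis by (simp add: F_def cd)
    next
      case False
      thus ?thesis using x(1) by (simp add: cd S_def)
    qed
  qed
qed

text \<open>Any completion of a minimal bottom row to a matrix works: w + n is the quotient of the
  linear forms of the coprime rows (a, b) + n (c, d) and (c, d), so its modulus is at least
  1.\<close>

lemma exists_act_in_cusp_region:
  assumes z: "Im z > 0"
  obtains a b c d where "a * d - b * c = 1" "sl2_act a b c d z \<in> cusp_region"
proof -
  obtain c d :: int where cd: "coprime c d"
    and min: "\<And>c' d'. coprime c' d' \<Longrightarrow> cmod (of_int c * z + of_int d) \<le> cmod (of_int c' * z + of_int d')"
    by (rule exists_minimal_denom[OF z]) blast
  obtain u v where "u * c + v * d = 1" using cd bezout_int[of c d] by auto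
  then have det: "v * d - (-u) * c = 1" by simp
  define w where "w = sl2_act v (-u) c d z"
  have nz: "of_int c * z + of_int d \<noteq> 0" using cd by (intro denom_nonzero[OF z]) auto
  have "w \<in> cusp_region" unfolding mem_cusp_region
  proof (intro conjI allI)
    show "Im w > 0" unfolding w_def by (rule sl2_act_in_upper_half[OF det z])
    fix n :: int
    have "coprime (v + n * c) (-u + n * d)"
    proof (rule coprimeI)
      fix l assume "l dvd v + n * c" "l dvd -u + n * d"
      hence "l dvd (v + n * c) * d - (-u + n * d) * c" by simp
      also have "\<dots> = 1" using det by (simp add: algebra_simps)
      finally show "is_unit l" .
    qed
    moreover have "w * (of_int c * z + of_int d) = of_int v * z - of_int u"
      using nz by (simp add: w_def sl2_act_def)
    hence "(w + of_int n) * (of_int c * z + of_int d) = of_int (v + n * c) * z + of_int (-u + n * d)"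
      by (simp add: algebra_simps)
    ultimately have "cmod (of_int c * z + of_int d) \<le> cmod ((w + of_int n) * (of_int c * z + of_int d))"
      using min[of "v + n * c" "-u + n * d"] by (simp only:)
    thus "1 \<le> cmod (w + of_int n)" using nz by (simp add: norm_mult mult_le_cancel_right1)
  qed
  thus thesis using that[OF det] by (simp add: w_def)
qed

lemma sl2_act_diff:
  assumes det: "a * d - b * c = 1" and "of_int c * z + of_int d \<noteq> 0" "of_int c * z' + of_int d \<noteq> 0"
  shows "sl2_act a b c d z - sl2_act a b c d z' = (z - z') / ((of_int c * z + of_int d) * (of_int c * z' + of_int d))"
proof -
  have "complex_of_int (a * d - b * c) = 1" using det by simp
  hence "(of_int a * of_int d - of_int b * of_int c :: complex) = 1" by simp
  moreover have "sl2_act a b c d z - sl2_act a b c d z' = (of_int a * of_int d - of_int b * of_int c) * (z - z') / ((of_int c * z + of_int d) * (of_int c * z' + of_int d))"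
    unfolding sl2_act_def diff_frac_eq[OF assms(2,3)] by (simp add: algebra_simps)
  ultimately show ?thesis by simp
qed

section \<open>Boundedness and uniform continuity on the hyperbolic scale\<close>

lemma Cc_modular_act: "f \<in> Cc_modular \<Longrightarrow> a * d - b * c = 1 \<Longrightarrow> Im z > 0 \<Longrightarrow> f (sl2_act a b c d z) = f z"
  by (auto simp: Cc_modular_def upper_half_def)

lemma Cc_modular_add_int: "f \<in> Cc_modular \<Longrightarrow> Im z > 0 \<Longrightarrow> f (z + of_int n) = f z"
  using Cc_modular_act[of f 1 1 n 0 z] by (simp add: sl2_act_def)

lemma Cc_modular_cutoff:
  assumes "f \<in> Cc_modular"
  obtains Y where "Y \<ge> 1" "\<And>z. Im z > Y \<Longrightarrow> f z = 0"
proof -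
  obtain Y where "\<And>z. Im z > Y \<Longrightarrow> f z = 0" using assms by (auto simp: Cc_modular_def)
  thus thesis using that[of "max Y 1"] by auto
qed

lemma cusp_part_add_int:
  assumes "f \<in> Cc_modular" shows "cusp_part f (w + of_int n) = cusp_part f w"
proof (cases "w \<in> cusp_region")
  case True
  hence "Im w > 0" by (simp add: mem_cusp_region)
  thus ?thesis using Cc_modular_add_int[OF assms, of w n] by (simp add: cusp_part_def)
qed (simp add: cusp_part_def)

lemma exists_act_in_strip:
  assumes z: "Im z > 0"
  obtains a b c d where "a * d - b * c = 1" "sl2_act a b c d z \<in> cusp_region" "\<bar>Re (sl2_act a b c d z)\<bar> \<le> 1/2"
proof -
  obtain a b c d where *: "a * d - b * c = 1" "sl2_act a b c d z \<in> cusp_region"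
    by (rule exists_act_in_cusp_region[OF z])
  define n where "n = - round (Re (sl2_act a b c d z))"
  have nz: "of_int c * z + of_int d \<noteq> 0" using * by (intro denom_nonzero[OF z]) auto
  have eq: "sl2_act (a + n * c) (b + n * d) c d z = sl2_act a b c d z + of_int n"
    unfolding sl2_act_def add_frac_eq[OF nz one_neq_zero, of _ "of_int n", simplified]
    by (simp add: algebra_simps)
  show thesis
  proof (rule that[of "a + n * c" d "b + n * d" c])
    show "(a + n * c) * d - (b + n * d) * c = 1" using *(1) by (simp add: algebra_simps)
    show "sl2_act (a + n * c) (b + n * d) c d z \<in> cusp_region" using *(2) by (simp add: eq)
    show "\<bar>Re (sl2_act (a + n * c) (b + n * d) c d z)\<bar> \<le> 1/2"
      unfolding eq using of_int_round_abs_le[of "Re (sl2_act a b c d z)"] by (simp add: n_def abs_minus_commute)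
  qed
qed

lemma mem_cbox_complex: "w \<in> cbox l u \<longleftrightarrow> Re l \<le> Re w \<and> Re w \<le> Re u \<and> Im l \<le> Im w \<and> Im w \<le> Im u"
  by (auto simp: cbox_def Basis_complex_def)

text \<open>After reduction to the strip only heights between 4/5 and the cutoff can matter, and
  these fill a compact set.\<close>

lemma Cc_modular_bounded:
  assumes f: "f \<in> Cc_modular"
  obtains M where "M > 0" "\<And>z. Im z > 0 \<Longrightarrow> \<bar>f z\<bar> \<le> M"
proof -
  obtain Y where Y: "Y \<ge> 1" "\<And>z. Im z > Y \<Longrightarrow> f z = 0" by (rule Cc_modular_cutoff[OF f]) blast
  define C where "C = cbox (Complex (-1) (1/4)) (Complex 1 (2 * Y))"
  have "C \<subseteq> upper_half" by (auto simp: C_def mem_cbox_complex upper_half_def)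
  hence "continuous_on C f" using f by (auto simp: Cc_modular_def intro: continuous_on_subset)
  hence "compact (f ` C)" unfolding C_def by (intro compact_continuous_image compact_cbox)
  hence "bounded (f ` C)" by (rule compact_imp_bounded)
  then obtain M where M: "\<And>w. w \<in> C \<Longrightarrow> \<bar>f w\<bar> \<le> M" by (auto simp: bounded_iff)
  show thesis
  proof (rule that[of "\<bar>M\<bar> + 1"])
    fix z assume z: "Im z > 0"
    obtain a b c d where g: "a * d - b * c = 1" "sl2_act a b c d z \<in> cusp_region" "\<bar>Re (sl2_act a b c d z)\<bar> \<le> 1/2"
      by (rule exists_act_in_strip[OF z])
    have eq: "f z = f (sl2_act a b c d z)" using Cc_modular_act[OF f g(1) z] by simp
    show "\<bar>f z\<bar> \<le> \<bar>M\<bar> + 1"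
    proof (cases "Im (sl2_act a b c d z) > Y")
      case True thus ?thesis using Y eq by simp
    next
      case False
      hence "sl2_act a b c d z \<in> C" using Im_cusp_region(2)[OF g(2)] g(3) Y by (auto simp: C_def mem_cbox_complex)
      from M[OF this] show ?thesis unfolding eq by linarith
    qed
  qed auto
qed

text \<open>A horizontal step of size delta y at height y has small hyperbolic length, and the
  matrix that reduces one endpoint moves the other along with it. Either both images lie above the
  cutoff, where f vanishes, or both lie in one compact box.\<close>

lemma Cc_modular_uniform:
  assumes f: "f \<in> Cc_modular" and eps: "\<epsilon> > 0"
  obtains \<delta> where "\<delta> > 0" "\<And>t t' y. y > 0 \<Longrightarrow> \<bar>t - t'\<bar> \<le> \<delta> * y \<Longrightarrow> \<bar>f (Complex t y) - f (Complex t' y)\<bar> \<le> \<epsilon>"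
proof -
  obtain Y where Y: "Y \<ge> 1" "\<And>z. Im z > Y \<Longrightarrow> f z = 0" by (rule Cc_modular_cutoff[OF f]) blast
  define C where "C = cbox (Complex (-1) (1/4)) (Complex 1 (2 * Y + 1))"
  have "C \<subseteq> upper_half" by (auto simp: C_def mem_cbox_complex upper_half_def)
  hence "continuous_on C f" using f by (auto simp: Cc_modular_def intro: continuous_on_subset)
  hence "uniformly_continuous_on C f" unfolding C_def by (intro compact_uniformly_continuous compact_cbox)
  then obtain \<delta>0 where \<delta>0: "\<delta>0 > 0" "\<And>w w'. w \<in> C \<Longrightarrow> w' \<in> C \<Longrightarrow> dist w' w < \<delta>0 \<Longrightarrow> dist (f w') (f w) < \<epsilon>"
    unfolding uniformly_continuous_on_def using eps by metis
  \<comment> \<open>The images will be at distance at most 2 delta Im w. For Im w <= 2 Y these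
    choices bound it by 1/4, which keeps the second image in the box, and by half of
    \<open>\<delta>0\<close>. The consequence delta <= 1/16 controls the denominators and the points
    high in the cusp.\<close>
  define \<delta> where "\<delta> = min (1 / (16 * Y)) (\<delta>0 / (8 * Y))"
  have \<delta>: "\<delta> > 0" "\<delta> \<le> 1 / (16 * Y)" "\<delta> \<le> \<delta>0 / (8 * Y)" using Y \<delta>0 by (auto simp: \<delta>_def)
  have "1 / (16 * Y) \<le> 1/16" using Y by (simp add: field_simps)
  hence \<delta>_small: "\<delta> \<le> 1/16" using \<delta> by linarith
  show thesis
  proof (rule that[OF \<delta>(1)])
    fix t t' y :: real assume y: "y > 0" and tt: "\<bar>t - t'\<bar> \<le> \<delta> * y"
    define z z' where "z = Complex t y" and "z' = Complex t' y"
    have z: "Im z > 0" "Im z' > 0" using y by (auto simp: z_def z'_def)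
    have "z - z' = of_real (t - t')" by (simp add: z_def z'_def complex_eq_iff)
    hence zz: "cmod (z - z') \<le> \<delta> * y" using tt by (simp del: of_real_diff)
    obtain a b c d where g: "a * d - b * c = 1" "sl2_act a b c d z \<in> cusp_region" "\<bar>Re (sl2_act a b c d z)\<bar> \<le> 1/2"
      by (rule exists_act_in_strip[OF z(1)])
    define w w' where "w = sl2_act a b c d z" and "w' = sl2_act a b c d z'"
    have cd: "(c, d) \<noteq> (0, 0)" using g(1) by auto
    define D D' where "D = of_int c * z + of_int d" and "D' = of_int c * z' + of_int d"
    have nz: "D \<noteq> 0" "D' \<noteq> 0" unfolding D_def D'_def by (rule denom_nonzero[OF _ cd], rule z)+
    have fz: "f z = f w" "f z' = f w'" unfolding w_def w'_def using Cc_modular_act[OF f g(1)] z by auto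
    have "\<bar>real_of_int c\<bar> * y \<le> cmod D" using abs_Im_le_cmod[of D] y by (simp add: D_def z_def abs_mult)
    moreover have "D - D' = of_int c * (z - z')" by (simp add: D_def D'_def algebra_simps)
    hence "cmod (D - D') = \<bar>real_of_int c\<bar> * cmod (z - z')" by (simp add: norm_mult)
    moreover have "\<bar>real_of_int c\<bar> * cmod (z - z') \<le> \<bar>real_of_int c\<bar> * (\<delta> * y)" using zz by (intro mult_left_mono) auto
    moreover have "\<delta> * (\<bar>real_of_int c\<bar> * y) \<le> 1/16 * (\<bar>real_of_int c\<bar> * y)" using \<delta>_small y by (intro mult_right_mono) auto
    moreover have "\<bar>real_of_int c\<bar> * (\<delta> * y) = \<delta> * (\<bar>real_of_int c\<bar> * y)" by (rule mult.left_commute)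
    moreover have "cmod D \<ge> 0" by simp
    \<comment> \<open>The denominators differ by |c| |z - z'| <= delta |c| y, and |c| y is the
      absolute value of the imaginary part of \<open>D\<close>.\<close>
    ultimately have "cmod (D - D') \<le> cmod D / 2" by linarith
    hence D': "cmod D' \<ge> cmod D / 2" using norm_triangle_ineq2[of D "D - D'"] by simp
    have ImwD: "Im w = y / (cmod D)\<^sup>2"
      unfolding w_def Im_sl2_act[OF g(1) z(1)] D_def by (simp add: z_def)
    have "w - w' = (z - z') / (D * D')"
      unfolding w_def w'_def D_def D'_def by (rule sl2_act_diff[OF g(1) nz[unfolded D_def D'_def]])
    hence "cmod (w - w') = cmod (z - z') / (cmod D * cmod D')" by (simp add: norm_divide norm_mult)
    also have "\<dots> \<le> (\<delta> * y) / (cmod D * (cmod D / 2))"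
    proof (rule frac_le)
      show "0 < cmod D * (cmod D / 2)" using nz by simp
      show "cmod D * (cmod D / 2) \<le> cmod D * cmod D'" using D' by (rule mult_left_mono) simp
      show "0 \<le> \<delta> * y" using \<delta>(1) y by simp
    qed (rule zz)
    also have "\<dots> = 2 * \<delta> * Im w" unfolding ImwD by (simp add: power2_eq_square)
    finally have ww: "cmod (w - w') \<le> 2 * \<delta> * Im w" .
    have Imw: "Im w > 4/5" using Im_cusp_region(2)[OF g(2)] by (simp add: w_def)
    have Imw': "\<bar>Im w - Im w'\<bar> \<le> cmod (w - w')" using abs_Im_le_cmod[of "w - w'"] by simp
    have Rew': "\<bar>Re w - Re w'\<bar> \<le> cmod (w - w')" using abs_Re_le_cmod[of "w - w'"] by simp
    show "\<bar>f (Complex t y) - f (Complex t' y)\<bar> \<le> \<epsilon>"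
    proof (cases "Im w > 2 * Y")
      case True
      have "2 * \<delta> * Im w \<le> 2 * (1/16) * Im w" using Imw \<delta>_small by (intro mult_right_mono mult_left_mono) auto
      hence "Im w' > Y" using ww Imw' True Y by linarith
      thus ?thesis using Y True fz eps by (simp add: z_def[symmetric] z'_def[symmetric])
    next
      case False
      hence *: "2 * \<delta> * Im w \<le> 2 * \<delta> * (2 * Y)" using \<delta> by (intro mult_left_mono) auto
      have "\<delta> * (4 * Y) \<le> 1 / (16 * Y) * (4 * Y)" "\<delta> * (4 * Y) \<le> \<delta>0 / (8 * Y) * (4 * Y)"
        using \<delta> Y by (intro mult_right_mono; simp)+
      hence "2 * \<delta> * (2 * Y) \<le> 1/4" "2 * \<delta> * (2 * Y) \<le> \<delta>0 / 2" using Y by (simp_all add: field_simps)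
      hence ww': "cmod (w - w') \<le> 1/4" "cmod (w - w') < \<delta>0" using ww * \<delta>0 by linarith+
      have "\<bar>Re w\<bar> \<le> 1/2" using g(3) by (simp add: w_def)
      hence "w \<in> C" "w' \<in> C" using Imw Imw' Rew' ww' False Y by (auto simp: C_def mem_cbox_complex)
      hence "dist (f w) (f w') < \<epsilon>" using ww' by (intro \<delta>0) (auto simp: dist_norm)
      thus ?thesis using fz by (simp add: dist_real_def z_def[symmetric] z'_def[symmetric])
    qed
  qed
qed

subsection \<open>Unfolding a horocycle\<close>

text \<open>The unfolding indexes matrices by the residue d of the lower right entry, while their
  images involve the inverse of d; the permutation lets one sum be exchanged for the other.\<close>

lemma exists_inverse_totatives:
  assumes "c > 0"
  shows "\<exists>g. bij_betw g (totatives c) (totatives c) \<and> (\<forall>d\<in>totatives c. [g d * d = 1] (mod c))"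
proof -
  have ex: "\<exists>x. x \<in> totatives c \<and> [x * d = 1] (mod c)" if d: "d \<in> totatives c" for d
  proof -
    have "coprime d c" using d by (simp add: in_totatives_iff)
    then obtain x where x: "[d * x = 1] (mod c)" using cong_solve_coprime_nat by auto
    \<comment> \<open>\<open>totatives\<close> takes its representatives in {1..c}, so the residue
      0, which occurs only for c = 1, is represented by c.\<close>
    define r where "r = (if x mod c = 0 then c else x mod c)"
    have "[r = x] (mod c)" by (auto simp: r_def cong_def)
    hence "[r * d = x * d] (mod c)" by (rule cong_scalar_right)
    also have "[x * d = 1] (mod c)" using x by (simp add: mult.commute)
    finally have rd: "[r * d = 1] (mod c)" .
    hence "coprime (r * d) c" using cong_imp_coprime[OF cong_sym[OF rd]] by simp
    hence "coprime r c" by simp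
    moreover have "r > 0" "r \<le> c" using assms by (auto simp: r_def mod_le_divisor)
    ultimately show ?thesis using rd by (auto simp: in_totatives_iff)
  qed
  then obtain g where g: "\<And>d. d \<in> totatives c \<Longrightarrow> g d \<in> totatives c \<and> [g d * d = 1] (mod c)" by metis
  have "inj_on g (totatives c)"
  proof (rule inj_onI)
    fix d d' assume dd: "d \<in> totatives c" "d' \<in> totatives c" and eq: "g d = g d'"
    have "[d * (g d' * d') = d * 1] (mod c)" using g[OF dd(2)] by (intro cong_scalar_left) auto
    hence "[d = d * (g d' * d')] (mod c)" by (simp add: cong_sym)
    also have "d * (g d' * d') = (g d * d) * d'" using eq by simp
    also have "[(g d * d) * d' = 1 * d'] (mod c)" using g[OF dd(1)] by (intro cong_scalar_right) auto
    finally have *: "[d = d'] (mod c)" by simp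
    have "0 < d" "d \<le> c" "0 < d'" "d' \<le> c" using dd by (auto simp: in_totatives_iff)
    thus "d = d'" using * by (cases "d = c"; cases "d' = c") (auto simp: cong_def)
  qed
  moreover have "g ` totatives c \<subseteq> totatives c" using g by auto
  ultimately have "bij_betw g (totatives c) (totatives c)"
    by (simp add: bij_betw_def endo_inj_surj)
  thus ?thesis using g by blast
qed

text \<open>The points of a horocycle that have two inequivalent representatives of maximal height.\<close>
definition horocycle_ties :: "real \<Rightarrow> real set" where
  "horocycle_ties y = {t. \<exists>c D c' D'::int. 0 < c \<and> 0 < c' \<and> (c, D) \<noteq> (c', D') \<and>
     cmod (of_int c * Complex t y + of_int D) = cmod (of_int c' * Complex t y + of_int D')}"

text \<open>Equality of two squared moduli is a polynomial equation in t of degree at most 2. The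
  polynomial is not zero, because vanishing coefficients and positivity of c and c' would force the
  two rows to agree.\<close>

lemma countable_horocycle_ties: "countable (horocycle_ties y)"
proof -
  let ?T = "\<lambda>(c, D, c', D'). {t. cmod (of_int c * Complex t y + of_int D) = cmod (of_int c' * Complex t y + of_int D')}"
  have "horocycle_ties y \<subseteq> (\<Union>p\<in>{(c, D, c', D'). 0 < c \<and> 0 < c' \<and> (c, D) \<noteq> (c', D')}. ?T p)"
  proof (rule subsetI)
    fix t assume "t \<in> horocycle_ties y"
    then obtain c D c' D' :: int where "0 < c" "0 < c'" "(c, D) \<noteq> (c', D')"
      "cmod (of_int c * Complex t y + of_int D) = cmod (of_int c' * Complex t y + of_int D')"
      unfolding horocycle_ties_def mem_Collect_eq by (elim exE conjE)
    thus "t \<in> (\<Union>p\<in>{(c, D, c', D'). 0 < c \<and> 0 < c' \<and> (c, D) \<noteq> (c', D')}. ?T p)"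
      by (intro UN_I[of "(c, D, c', D')"]) simp_all
  qed
  moreover have "finite (?T (c, D, c', D'))" if "0 < c" "0 < c'" "(c, D) \<noteq> (c', D')" for c D c' D' :: int
  proof -
    define p :: "real poly" where "p = [: (of_int D)\<^sup>2 - (of_int D')\<^sup>2 + ((of_int c)\<^sup>2 - (of_int c')\<^sup>2) * y\<^sup>2,
      2 * (of_int c * of_int D - of_int c' * of_int D'), (of_int c)\<^sup>2 - (of_int c')\<^sup>2 :]"
    have "p \<noteq> 0"
    proof
      assume "p = 0"
      hence 1: "(real_of_int c)\<^sup>2 = (real_of_int c')\<^sup>2" "real_of_int c * real_of_int D = real_of_int c' * real_of_int D'"
        by (auto simp: p_def)
      hence "c = c'" using that by (auto simp: power2_eq_iff)
      with 1 that show False by auto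
    qed
    hence "finite {t. poly p t = 0}" by (rule poly_roots_finite)
    moreover have "?T (c, D, c', D') \<subseteq> {t. poly p t = 0}"
    proof clarsimp
      fix t assume "cmod (of_int c * Complex t y + of_int D) = cmod (of_int c' * Complex t y + of_int D')"
      hence "(cmod (of_int c * Complex t y + of_int D))\<^sup>2 = (cmod (of_int c' * Complex t y + of_int D'))\<^sup>2" by simp
      hence "(of_int c * t + of_int D)\<^sup>2 + (of_int c * y)\<^sup>2 = (of_int c' * t + of_int D')\<^sup>2 + (of_int c' * y)\<^sup>2"
        unfolding cmod_power2 by simp
      thus "poly p t = 0" by (simp add: p_def power2_eq_square algebra_simps)
    qed
    ultimately show ?thesis by (rule finite_subset[rotated])
  qed
  hence "countable (\<Union>p\<in>{(c, D, c', D'). 0 < c \<and> 0 < c' \<and> (c, D) \<noteq> (c', D')}. ?T p)"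
    by (intro countable_UN) (auto intro: countable_finite)
  ultimately show ?thesis by (rule countable_subset)
qed

text \<open>In this form b is gone, a enters only through a translation by a / c, and D only through
  a translation of z.\<close>

lemma sl2_act_eq_shift:
  fixes a b D c :: int
  assumes "c \<noteq> 0" "Im z > 0" "a * D - b * c = 1"
  shows "sl2_act a b c D z = of_real (of_int a / of_int c) - 1 / (of_real ((of_int c)\<^sup>2) * (z + of_real (of_int D / of_int c)))"
proof -
  have nz: "of_int c * z + of_int D \<noteq> 0" using assms by (intro denom_nonzero) auto
  have "a * D = b * c + 1" using assms(3) by simp
  hence "complex_of_int (a * D) = of_int (b * c + 1)" by (simp only:)
  hence det: "(of_int a * of_int D :: complex) = of_int b * of_int c + 1" by simp
  have "complex_of_real ((of_int c)\<^sup>2) * (z + of_real (of_int D / of_int c)) = of_int c * (of_int c * z + of_int D)"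
    using assms(1) by (simp add: power2_eq_square field_simps)
  moreover have "sl2_act a b c D z = of_int a / of_int c - 1 / (of_int c * (of_int c * z + of_int D))"
  proof -
    have "of_int a / of_int c - 1 / (of_int c * (of_int c * z + of_int D)) =
      (of_int a * (of_int c * z + of_int D) - 1) / (of_int c * (of_int c * z + of_int D))"
      using assms(1) nz by (simp add: diff_divide_distrib)
    also have "of_int a * (of_int c * z + of_int D) - 1 = of_int c * (of_int a * z + of_int b)"
      using det by (simp add: algebra_simps)
    finally show ?thesis using assms(1) by (simp add: sl2_act_def)
  qed
  ultimately show ?thesis by simp
qed

text \<open>For t outside the ties exactly one index lands in the region: the one whose bottom row
  minimises the denominator. A row (c, D) is coded by D = d - k c with d in {1..c}. The top left
  entry \<open>g c d\<close> is prescribed only modulo c, which translates the image by an integer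
  and leaves \<open>cusp_part\<close> unchanged.\<close>

lemma horocycle_unfolding:
  fixes t y :: real and g :: "nat \<Rightarrow> nat \<Rightarrow> nat"
  defines "I \<equiv> (SIGMA c:{c::nat. 0 < c \<and> real c ^ 2 * y \<le> 4}. totatives c \<times> {..<3::nat})"
  assumes f: "f \<in> Cc_modular" and y: "0 < y" "y < 1/5" and t: "0 \<le> t" "t \<le> 1" "t \<notin> horocycle_ties y"
    and g: "\<And>c d. c > 0 \<Longrightarrow> d \<in> totatives c \<Longrightarrow> [g c d * d = 1] (mod c)"
  shows "f (Complex t y) = (\<Sum>(c, d, k)\<in>I.
     cusp_part f (of_real (real (g c d) / real c) - 1 / (of_real ((real c)\<^sup>2) * Complex (t + real d / real c - real k) y)))"
proof -
  define z where "z = Complex t y"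
  have z: "Im z > 0" using y by (simp add: z_def)
  define w where "w = (\<lambda>(c, d, k). of_real (real (g c d) / real c) -
    1 / (of_real ((real c)\<^sup>2) * Complex (t + real d / real c - real k) y))"
  have rep: "\<exists>b. int (g c d) * (int d - int k * int c) - b * int c = 1 \<and>
      w (c, d, k) = sl2_act (int (g c d)) b (int c) (int d - int k * int c) z" if i: "(c, d, k) \<in> I" for c d k
  proof -
    have c: "c > 0" and d: "d \<in> totatives c" using i by (auto simp: I_def)
    have "[int (g c d * d) = int 1] (mod int c)" using g[OF c d] by (simp only: cong_int_iff)
    hence "int c dvd int (g c d) * int d - 1" by (simp add: cong_iff_dvd_diff)
    hence "int c dvd (int (g c d) * int d - 1) - int (g c d) * int k * int c" by simp
    then obtain b where b: "(int (g c d) * int d - 1) - int (g c d) * int k * int c = int c * b" by (auto simp: dvd_def)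
    hence det: "int (g c d) * (int d - int k * int c) - b * int c = 1" by (simp add: algebra_simps)
    have "z + of_real (of_int (int d - int k * int c) / of_int (int c)) = Complex (t + real d / real c - real k) y"
      using c by (simp add: z_def complex_eq_iff field_simps)
    with sl2_act_eq_shift[OF _ z det] c have "w (c, d, k) = sl2_act (int (g c d)) b (int c) (int d - int k * int c) z"
      by (simp add: w_def)
    thus ?thesis using det by blast
  qed
  have uniq: "i = j" if i: "i \<in> I" "w i \<in> cusp_region" and j: "j \<in> I" "w j \<in> cusp_region" for i j
  proof -
    obtain c d k c' d' k' where ij: "i = (c, d, k)" "j = (c', d', k')" by (metis prod_cases3)
    have c: "c > 0" "d \<in> totatives c" "c' > 0" "d' \<in> totatives c'" using i j ij by (auto simp: I_def)
    define D D' where "D = int d - int k * int c" and "D' = int d' - int k' * int c'"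
    obtain b where b: "int (g c d) * D - b * int c = 1" "sl2_act (int (g c d)) b (int c) D z \<in> cusp_region"
      using rep[of c d k] i ij unfolding D_def by auto
    obtain b' where b': "int (g c' d') * D' - b' * int c' = 1" "sl2_act (int (g c' d')) b' (int c') D' z \<in> cusp_region"
      using rep[of c' d' k'] j ij unfolding D'_def by auto
    have "cmod (of_int (int c) * z + of_int D) \<le> cmod (of_int (int c') * z + of_int D')"
      by (rule cusp_region_minimal[OF b(1) z b(2)]) (use c in auto)
    moreover have "cmod (of_int (int c') * z + of_int D') \<le> cmod (of_int (int c) * z + of_int D)"
      by (rule cusp_region_minimal[OF b'(1) z b'(2)]) (use c in auto)
    ultimately have eq: "cmod (of_int (int c) * z + of_int D) = cmod (of_int (int c') * z + of_int D')" by (rule antisym)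
    have "(int c, D) = (int c', D')"
    proof (rule ccontr)
      assume "(int c, D) \<noteq> (int c', D')"
      moreover have "int c > 0" "int c' > 0" using c by auto
      ultimately have "t \<in> horocycle_ties y" using eq unfolding horocycle_ties_def z_def mem_Collect_eq
        by (intro exI conjI)
      thus False using t by simp
    qed
    hence cc: "c = c'" and DD: "D = D'" by auto
    have d: "0 < d" "d \<le> c" "0 < d'" "d' \<le> c" using c cc by (auto simp: in_totatives_iff)
    \<comment> \<open>Two values of d in {1..c} differ by less than c, so D determines both d and
      k.\<close>
    have e: "int d - int d' = (int k - int k') * int c" using DD cc unfolding D_def D'_def by (simp add: algebra_simps)
    have "int k - int k' = 0"
    proof (rule ccontr)
      assume "int k - int k' \<noteq> 0"
      hence "\<bar>int k - int k'\<bar> \<ge> 1" by linarith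
      hence "1 * int c \<le> \<bar>int k - int k'\<bar> * int c" by (intro mult_right_mono) auto
      hence "int c \<le> \<bar>int d - int d'\<bar>" unfolding e by (simp add: abs_mult)
      thus False using d by linarith
    qed
    hence "k = k'" "d = d'" using e by auto
    thus ?thesis using ij cc by simp
  qed
  obtain a b c D where gm: "a * D - b * c = 1" "sl2_act a b c D z \<in> cusp_region"
    by (rule exists_act_in_cusp_region[OF z])
  have "\<exists>i\<in>I. w i \<in> cusp_region \<and> f (w i) = f z"
  proof -
    have "\<exists>a b c D. a * D - b * c = 1 \<and> sl2_act a b c D z \<in> cusp_region \<and> c \<ge> 0"
    proof (cases "c \<ge> 0")
      case True
      thus ?thesis using gm by (intro exI conjI)
    next
      case False
      have "sl2_act (-a) (-b) (-c) (-D) z = sl2_act a b c D z"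
      proof -
        have "sl2_act (-a) (-b) (-c) (-D) z = (- (of_int a * z + of_int b)) / (- (of_int c * z + of_int D))"
          by (simp add: sl2_act_def)
        thus ?thesis by (simp only: minus_divide_divide sl2_act_def)
      qed
      moreover have "(-a) * (-D) - (-b) * (-c) = 1" using gm(1) by simp
      ultimately show ?thesis using gm(2) False
        by (intro exI[of _ "-a"] exI[of _ "-b"] exI[of _ "-c"] exI[of _ "-D"]) simp
    qed
    then obtain a b C D where det: "a * D - b * C = 1" and reg: "sl2_act a b C D z \<in> cusp_region" and C0: "C \<ge> 0" by blast
    \<comment> \<open>For c = 0 the height stays y < 1/5, too low for the region.\<close>
    have C: "C > 0"
    proof (rule ccontr)
      assume "\<not> C > 0"
      hence C0': "C = 0" using C0 by simp
      hence "a * D = 1" using det by simp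
      hence "D = 1 \<or> D = -1" by (auto simp: zmult_eq_1_iff)
      hence "Im (sl2_act a b C D z) = y" using Im_sl2_act[OF det z] C0' by (auto simp: z_def)
      thus False using Im_cusp_region(2)[OF reg] y by simp
    qed
    define c where "c = nat C"
    have cC: "C = int c" "c > 0" using C by (auto simp: c_def)
    have den: "(cmod (of_int C * z + of_int D))\<^sup>2 = (real c * t + of_int D)\<^sup>2 + (real c * y)\<^sup>2"
      by (simp add: cmod_power2 z_def cC)
    have pos: "(real c * t + of_int D)\<^sup>2 + (real c * y)\<^sup>2 > 0" using cC y by (intro add_nonneg_pos) auto
    have "4/5 < y / ((real c * t + of_int D)\<^sup>2 + (real c * y)\<^sup>2)"
      using Im_cusp_region(2)[OF reg] unfolding Im_sl2_act[OF det z] den by (simp add: z_def)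
    hence le: "(real c * t + of_int D)\<^sup>2 + (real c * y)\<^sup>2 < 5/4 * y" using pos by (simp add: field_simps)
    have "(real c * y)\<^sup>2 < 5/4 * y" using le zero_le_power2[of "real c * t + of_int D"] by linarith
    hence "(real c ^ 2 * y) * y < 5/4 * y" by (simp add: power2_eq_square algebra_simps)
    \<comment> \<open>The estimate gives c^2 y < 5/4. The index set uses the square 4, so that its
      range becomes c <= 2 / sqrt y.\<close>
    hence cy: "real c ^ 2 * y \<le> 4" using y by simp
    have "\<bar>real c * t + of_int D\<bar>\<^sup>2 < 1/4"
      using le y zero_le_power2[of "real c * y"] unfolding power2_abs by linarith
    hence "\<bar>real c * t + of_int D\<bar>\<^sup>2 < (1/2)\<^sup>2" by (simp add: power_divide)
    hence "\<bar>real c * t + of_int D\<bar> < 1/2" by (rule power2_less_imp_less) simp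
    hence "real_of_int D < 1/2 - real c * t" "real_of_int D > -1/2 - real c * t" by linarith+
    moreover have "real c * t \<ge> 0" "real c * t \<le> real c" using t by (auto simp: mult_left_le)
    ultimately have "real_of_int D < 1" "real_of_int D > -1 - real c" by linarith+
    hence D: "D \<le> 0" "D \<ge> - int c" by linarith+
    \<comment> \<open>For -c < D <= 0 one shift by c lands in {1..c}; D = -c takes two, since 0 is
      outside that range.\<close>
    define k :: nat where "k = (if D = - int c then 2 else 1)"
    define d where "d = nat (D + int k * int c)"
    have d: "int d = D + int k * int c" "0 < d" "d \<le> c" using D cC by (auto simp: d_def k_def)
    have "coprime D C"
    proof (rule coprimeI)
      fix l assume "l dvd D" "l dvd C"
      hence "l dvd a * D - b * C" by simp
      thus "is_unit l" using det by simp
    qed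
    have "coprime (int d) (int c)"
    proof (rule coprimeI)
      fix l assume l: "l dvd int d" "l dvd int c"
      hence "l dvd int d - int k * int c" by simp
      hence "l dvd D" using d(1) by simp
      thus "is_unit l" using l(2) \<open>coprime D C\<close> unfolding cC(1) by (metis coprime_common_divisor)
    qed
    hence dt: "d \<in> totatives c" using d(2,3) by (simp add: in_totatives_iff)
    have i: "(c, d, k) \<in> I" using cC cy dt by (auto simp: I_def k_def)
    have dk: "int d - int k * int c = D" using d(1) by simp
    obtain b' where b': "int (g c d) * D - b' * int c = 1" "w (c, d, k) = sl2_act (int (g c d)) b' (int c) D z"
      using rep[OF i] unfolding dk by blast
    \<comment> \<open>Both a and \<open>g c d\<close> are inverses of D modulo c, and D is prime to
      c, so they differ by a multiple of c.\<close>
    have "int c dvd (int (g c d) - a) * D"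
    proof -
      have "(int (g c d) - a) * D = (b' - b) * int c"
        using b'(1) det unfolding cC left_diff_distrib by linarith
      thus ?thesis by simp
    qed
    moreover have "coprime (int c) D" using \<open>coprime D C\<close> unfolding cC by (simp add: coprime_commute)
    ultimately have "int c dvd int (g c d) - a" by (simp only: coprime_dvd_mult_left_iff)
    then obtain n where "int (g c d) - a = int c * n" by (rule dvdE)
    hence n: "int (g c d) = a + int c * n" by simp
    have "w (c, d, k) = sl2_act a b C D z + of_int n"
    proof -
      have "of_real (of_int (int (g c d)) / of_int (int c)) = (of_real (of_int a / of_int (int c)) + of_int n :: complex)"
        unfolding n using cC by (simp add: field_simps)
      thus ?thesis unfolding b'(2) cC(1) using sl2_act_eq_shift[OF _ z b'(1)] sl2_act_eq_shift[OF _ z det[unfolded cC(1)]] cC(2)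
        by simp
    qed
    note w_eq = this
    have "w (c, d, k) \<in> cusp_region" unfolding w_eq cusp_region_add_int by (rule reg)
    moreover have "f (w (c, d, k)) = f z"
      unfolding w_eq Cc_modular_add_int[OF f sl2_act_in_upper_half[OF det z]] by (rule Cc_modular_act[OF f det z])
    ultimately show ?thesis using i by (intro bexI[of _ "(c, d, k)"] conjI)
  qed
  then obtain i where i: "i \<in> I" "w i \<in> cusp_region" "f (w i) = f z" by blast
  have fin: "finite I"
  proof -
    have "{c::nat. 0 < c \<and> real c ^ 2 * y \<le> 4} \<subseteq> {..nat \<lceil>4 / y\<rceil>}"
    proof (rule subsetI)
      fix c assume "c \<in> {c::nat. 0 < c \<and> real c ^ 2 * y \<le> 4}"
      hence c: "0 < c" "(real c)\<^sup>2 * y \<le> 4" by auto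
      have "real c \<le> (real c)\<^sup>2" using c(1) by (simp add: power2_eq_square)
      also have "\<dots> \<le> 4 / y" using c(2) y(1) by (simp add: pos_le_divide_eq)
      finally have "c \<le> nat \<lceil>4 / y\<rceil>" by linarith
      thus "c \<in> {..nat \<lceil>4 / y\<rceil>}" by simp
    qed
    thus ?thesis unfolding I_def by (intro finite_SigmaI) (auto intro: finite_subset)
  qed
  have "(\<Sum>j\<in>I. cusp_part f (w j)) = (\<Sum>j\<in>{i}. cusp_part f (w j))"
  proof (rule sum.mono_neutral_right[OF fin])
    show "\<forall>j\<in>I - {i}. cusp_part f (w j) = 0"
    proof
      fix j assume "j \<in> I - {i}"
      hence "w j \<notin> cusp_region" using uniq[OF _ _ i(1,2), of j] by blast
      thus "cusp_part f (w j) = 0" by (simp add: cusp_part_def)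
    qed
  qed (use i in simp)
  also have "\<dots> = f z" using i by (simp add: cusp_part_def)
  finally show ?thesis by (simp add: w_def z_def case_prod_unfold)
qed

subsection \<open>Sums over lattice points\<close>

text \<open>By periodicity only the fractional part of the shift counts; the shifted interval is cut
  at 1 and its right piece moved back by one period.\<close>

lemma integral_periodic_shift:
  fixes h :: "real \<Rightarrow> real"
  assumes [measurable]: "h \<in> borel_measurable borel" and bound: "\<And>x. \<bar>h x\<bar> \<le> B"
    and per: "\<And>x (n::int). h (x + of_int n) = h x"
  shows "(LINT x:{0<..<1}|lborel. h (x + s)) = (LINT x:{0<..<1}|lborel. h x)"
proof -
  have int: "integrable lborel (\<lambda>x. indicator {a<..b} x * h x)" "integrable lborel (\<lambda>x. indicator {a<..<b} x * h x)"
    if "a \<le> b" for a b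
  proof -
    have "integrable lborel (\<lambda>x. indicator {a<..b} x *\<^sub>R h x)" "integrable lborel (\<lambda>x. indicator {a<..<b} x *\<^sub>R h x)"
      by (rule integrableI_bounded_set_indicator[where B = B]; use that bound in simp)+
    thus "integrable lborel (\<lambda>x. indicator {a<..b} x * h x)" "integrable lborel (\<lambda>x. indicator {a<..<b} x * h x)"
      by simp_all
  qed
  define \<sigma> where "\<sigma> = frac s"
  have \<sigma>: "0 \<le> \<sigma>" "\<sigma> < 1" by (auto simp: \<sigma>_def frac_lt_1)
  have "h (x + s) = h (x + \<sigma>)" for x
    using per[of "x + \<sigma>" "\<lfloor>s\<rfloor>"] by (simp add: \<sigma>_def frac_def)
  hence "(LINT x:{0<..<1}|lborel. h (x + s)) = (LBINT x. indicator {0<..<1} x * h (x + \<sigma>))"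
    by (simp add: set_lebesgue_integral_def)
  also have "\<dots> = (LBINT x. indicator {\<sigma><..<1 + \<sigma>} x * h x)"
    by (subst (2) lborel_integral_real_affine[of 1 _ \<sigma>])
       (auto intro!: Bochner_Integration.integral_cong simp: indicator_def add.commute)
  also have "\<dots> = (LBINT x. indicator {\<sigma><..1} x * h x + indicator {1<..<1 + \<sigma>} x * h x)"
  proof (rule integral_cong_AE)
    show "AE x in lborel. indicator {\<sigma><..<1 + \<sigma>} x * h x = indicator {\<sigma><..1} x * h x + indicator {1<..<1 + \<sigma>} x * h x"
      using AE_lborel_singleton[of 1] by eventually_elim (use \<sigma> in \<open>auto simp: indicator_def\<close>)
  qed measurable
  also have "\<dots> = (LBINT x. indicator {\<sigma><..1} x * h x) + (LBINT x. indicator {1<..<1 + \<sigma>} x * h x)"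
    using \<sigma> by (intro Bochner_Integration.integral_add int) auto
  also have "(LBINT x. indicator {1<..<1 + \<sigma>} x * h x) = (LBINT x. indicator {0<..<\<sigma>} x * h x)"
    using per[of _ 1]
    by (subst lborel_integral_real_affine[of 1 _ 1])
       (auto intro!: Bochner_Integration.integral_cong simp: indicator_def add.commute)
  also have "(LBINT x. indicator {\<sigma><..1} x * h x) + (LBINT x. indicator {0<..<\<sigma>} x * h x) =
      (LBINT x. indicator {\<sigma><..1} x * h x + indicator {0<..<\<sigma>} x * h x)"
    using \<sigma> by (intro Bochner_Integration.integral_add[symmetric] int) auto
  also have "\<dots> = (LBINT x. indicator {0<..<1} x * h x)"
  proof (rule integral_cong_AE)
    show "AE x in lborel. indicator {\<sigma><..1} x * h x + indicator {0<..<\<sigma>} x * h x = indicator {0<..<1} x * h x"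
      using AE_lborel_singleton[of \<sigma>] AE_lborel_singleton[of 1]
      by eventually_elim (use \<sigma> in \<open>auto simp: indicator_def\<close>)
  qed measurable
  finally show ?thesis by (simp add: set_lebesgue_integral_def)
qed

lemma cusp_part_eq_0_low: "Im w \<le> 4/5 \<Longrightarrow> cusp_part f w = 0"
  using Im_cusp_region(2)[of w] by (auto simp: cusp_part_def)

lemma open_upper_half: "open upper_half"
  unfolding upper_half_def by (intro open_Collect_less continuous_intros)

lemma cusp_region_borel [measurable]: "cusp_region \<in> sets borel"
proof -
  have "cusp_region = upper_half \<inter> {w. infdist w \<int> \<ge> 1}" by (auto simp: cusp_region_def upper_half_def)
  moreover have "closed {w::complex. infdist w \<int> \<ge> 1}"
    by (intro closed_Collect_le continuous_intros)
  ultimately show ?thesis using open_upper_half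
    by (metis (no_types, lifting) sets.Int borel_open borel_closed)
qed

lemma cusp_part_measurable:
  assumes "f \<in> Cc_modular" shows "cusp_part f \<in> borel_measurable borel"
proof -
  have "continuous_on upper_half f" using assms by (simp add: Cc_modular_def)
  hence [measurable]: "(\<lambda>w. indicator upper_half w *\<^sub>R f w) \<in> borel_measurable borel"
    using open_upper_half by (intro borel_measurable_continuous_on_indicator) auto
  have "cusp_part f = (\<lambda>w. indicator cusp_region w * (indicator upper_half w *\<^sub>R f w))"
    by (auto simp: cusp_part_def cusp_region_def upper_half_def indicator_def fun_eq_iff)
  also have "\<dots> \<in> borel_measurable borel" by measurable
  finally show ?thesis .
qed

lemma cusp_part_isCont:
  assumes f: "f \<in> Cc_modular" and w: "Im w > 0" "infdist w \<int> \<noteq> 1"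
  shows "isCont (cusp_part f) w"
proof (cases "infdist w \<int> > 1")
  case True
  define U where "U = upper_half \<inter> {w. infdist w \<int> > 1}"
  have U: "open U" unfolding U_def by (intro open_Int open_upper_half open_Collect_less continuous_intros)
  have wU: "w \<in> U" using w True by (simp add: U_def upper_half_def)
  have "continuous_on U f" using f by (auto simp: U_def Cc_modular_def intro: continuous_on_subset)
  hence "isCont f w" using U wU by (simp add: continuous_on_eq_continuous_at)
  moreover have "eventually (\<lambda>w. cusp_part f w = f w) (nhds w)"
    unfolding eventually_nhds using U wU
    by (intro exI[of _ U]) (auto simp: U_def cusp_part_def cusp_region_def upper_half_def)
  ultimately show ?thesis using isCont_cong[of "cusp_part f" f w] by simp
next
  case False
  define U where "U = {w::complex. infdist w \<int> < 1}"
  have U: "open U" unfolding U_def by (intro open_Collect_less continuous_intros)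
  have wU: "w \<in> U" using w False by (simp add: U_def)
  have "eventually (\<lambda>w. cusp_part f w = 0) (nhds w)"
    unfolding eventually_nhds using U wU
    by (intro exI[of _ U]) (auto simp: U_def cusp_part_def cusp_region_def)
  thus ?thesis using isCont_cong[of "cusp_part f" "\<lambda>_. 0" w] by simp
qed

text \<open>Points at distance 1 from the integers lie on unit circles centred at integers, and each
  such circle meets a horizontal line at most twice.\<close>

lemma AE_infdist_Ints_ne:
  "AE \<xi> in lborel. infdist (Complex (\<xi> - s) \<eta>) \<int> \<noteq> 1"
proof -
  define T where "T = (\<lambda>n::int. {\<xi>::real. (\<xi> - s - of_int n)\<^sup>2 = 1 - \<eta>\<^sup>2})"
  have "countable (T n)" for n
  proof -
    have "T n \<subseteq> {s + of_int n + sqrt (1 - \<eta>\<^sup>2), s + of_int n - sqrt (1 - \<eta>\<^sup>2)}"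
    proof
      fix x assume "x \<in> T n"
      hence "(x - s - of_int n)\<^sup>2 = 1 - \<eta>\<^sup>2" by (simp add: T_def)
      hence "\<bar>x - s - of_int n\<bar> = sqrt (1 - \<eta>\<^sup>2)" by (metis real_sqrt_abs)
      thus "x \<in> {s + of_int n + sqrt (1 - \<eta>\<^sup>2), s + of_int n - sqrt (1 - \<eta>\<^sup>2)}" by auto
    qed
    thus ?thesis by (rule countable_subset) auto
  qed
  hence "countable (\<Union>n. T n)" by auto
  hence "(\<Union>n. T n) \<in> null_sets lborel" by (rule countable_imp_null_set_lborel)
  hence "AE \<xi> in lborel. \<xi> \<notin> (\<Union>n. T n)" by (rule AE_not_in)
  thus ?thesis
  proof eventually_elim
    case (elim \<xi>)
    show ?case
    proof
      assume *: "infdist (Complex (\<xi> - s) \<eta>) \<int> = 1"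
      have "(\<int> :: complex set) \<noteq> {}" using Ints_0 by blast
      then obtain a :: complex where a: "a \<in> \<int>" "infdist (Complex (\<xi> - s) \<eta>) \<int> = dist (Complex (\<xi> - s) \<eta>) a"
        by (rule infdist_attains_inf[OF closed_Ints])
      then obtain n where n: "a = of_int n" by (auto elim: Ints_cases)
      have "(cmod (Complex (\<xi> - s) \<eta> - of_int n))\<^sup>2 = 1" using a * n by (simp add: dist_norm)
      hence "\<xi> \<in> T n" by (simp add: cmod_power2 T_def algebra_simps)
      thus False using elim by blast
    qed
  qed
qed

text \<open>The constant Fourier coefficient at height eta of f restricted to the region.\<close>

definition cusp_mean :: "(complex \<Rightarrow> real) \<Rightarrow> real \<Rightarrow> real" where
  "cusp_mean f \<eta> = (LINT \<xi>:{0<..<1}|lborel. cusp_part f (Complex \<xi> \<eta>))"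

lemma borel_measurable_Complex [measurable (raw)]:
  assumes "g \<in> borel_measurable M" "h \<in> borel_measurable M"
  shows "(\<lambda>x. Complex (g x) (h x)) \<in> borel_measurable M"
  unfolding Complex_eq using assms by measurable

lemma cusp_part_bounded:
  assumes "f \<in> Cc_modular"
  obtains M where "M > 0" "\<And>w. \<bar>cusp_part f w\<bar> \<le> M" "\<And>z. Im z > 0 \<Longrightarrow> \<bar>f z\<bar> \<le> M"
proof (rule Cc_modular_bounded[OF assms])
  fix M assume M: "M > 0" "\<And>z. Im z > 0 \<Longrightarrow> \<bar>f z\<bar> \<le> M"
  have "\<bar>cusp_part f w\<bar> \<le> M" for w
    using M by (auto simp: cusp_part_def cusp_region_def)
  thus thesis by (rule that[OF M(1) _ M(2)])
qed

text \<open>For \<open>R = totatives\<close> and after rescaling \<open>y\<close> by \<open>1 + v\<^sup>2\<close>, this is the integrand at parameter \<open>v\<close>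
  of the unfolded horocycle average. The constraint \<open>c\<^sup>2 y \<le> 4\<close> only discards vanishing terms.\<close>
definition lattice_sum :: "(complex \<Rightarrow> real) \<Rightarrow> (nat \<Rightarrow> nat set) \<Rightarrow> real \<Rightarrow> real \<Rightarrow> real" where
  "lattice_sum f R v y = y * (\<Sum>c | 0 < c \<and> real c ^ 2 * y \<le> 4. \<Sum>a\<in>R c.
     cusp_part f (Complex (real a / real c - v / (real c ^ 2 * y)) (1 / (real c ^ 2 * y))))"

lemma index_set_eq:
  assumes "y > 0"
  shows "{c::nat. 0 < c \<and> real c ^ 2 * y \<le> 4} = {1..nat \<lfloor>2 / sqrt y\<rfloor>}"
proof -
  have "real c ^ 2 * y \<le> 4 \<longleftrightarrow> c \<le> nat \<lfloor>2 / sqrt y\<rfloor>" for c :: nat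
  proof -
    have "real c ^ 2 * y \<le> 4 \<longleftrightarrow> (real c * sqrt y)\<^sup>2 \<le> 2\<^sup>2" using assms by (simp add: power_mult_distrib)
    also have "\<dots> \<longleftrightarrow> real c * sqrt y \<le> 2" using assms by (simp only: power2_le_iff_abs_le) (simp add: abs_mult)
    also have "\<dots> \<longleftrightarrow> real c \<le> 2 / sqrt y" using assms by (simp add: pos_le_divide_eq)
    also have "\<dots> \<longleftrightarrow> int c \<le> \<lfloor>2 / sqrt y\<rfloor>" by (simp add: le_floor_iff)
    also have "\<dots> \<longleftrightarrow> c \<le> nat \<lfloor>2 / sqrt y\<rfloor>"
      using assms by (intro le_nat_iff[symmetric]) simp
    finally show ?thesis .
  qed
  moreover have "{c::nat. 0 < c \<and> c \<le> N} = {1..N}" for N by auto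
  ultimately show ?thesis by (simp only:)
qed

context
  fixes f :: "complex \<Rightarrow> real"
  assumes f: "f \<in> Cc_modular"
begin

lemma cusp_part_meas [measurable]: "cusp_part f \<in> borel_measurable borel"
  using f by (rule cusp_part_measurable)

lemma cusp_mean_shift: "(LINT \<xi>:{0<..<1}|lborel. cusp_part f (Complex (\<xi> - s) \<eta>)) = cusp_mean f \<eta>"
proof -
  obtain M where M: "\<And>w. \<bar>cusp_part f w\<bar> \<le> M" by (rule cusp_part_bounded[OF f]) blast
  have per: "cusp_part f (Complex (x + of_int n) \<eta>) = cusp_part f (Complex x \<eta>)" for x n
  proof -
    have "Complex (x + of_int n) \<eta> = Complex x \<eta> + of_int n" by (simp add: complex_eq_iff)
    thus ?thesis by (simp only: cusp_part_add_int[OF f])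
  qed
  show ?thesis
    using integral_periodic_shift[of "\<lambda>\<xi>. cusp_part f (Complex \<xi> \<eta>)" M "-s"] M per
    by (simp add: cusp_mean_def)
qed

lemma cusp_mean_bounded:
  assumes "\<And>w. \<bar>cusp_part f w\<bar> \<le> M"
  shows "\<bar>cusp_mean f \<eta>\<bar> \<le> M"
proof -
  have "norm (LINT \<xi>|lborel. indicator {0<..<1} \<xi> * cusp_part f (Complex \<xi> \<eta>)) \<le> (LINT \<xi>|lborel. indicator {0<..<1::real} \<xi> * M)"
  proof (rule Bochner_Integration.integral_norm_bound_integral)
    have "integrable lborel (\<lambda>\<xi>. indicator {0<..<1} \<xi> *\<^sub>R cusp_part f (Complex \<xi> \<eta>))"
      using assms by (intro integrableI_bounded_set_indicator[where B = M]) auto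
    thus "integrable lborel (\<lambda>\<xi>. indicator {0<..<1} \<xi> * cusp_part f (Complex \<xi> \<eta>))" by simp
    show "integrable lborel (\<lambda>\<xi>. indicator {0<..<1::real} \<xi> * M)" by (intro integrable_mult_left) auto
    show "norm (indicator {0<..<1} \<xi> * cusp_part f (Complex \<xi> \<eta>)) \<le> indicator {0<..<1} \<xi> * M" for \<xi>
      using assms by (simp add: indicator_def)
  qed
  thus ?thesis by (simp add: cusp_mean_def set_lebesgue_integral_def)
qed

lemma cusp_mean_measurable [measurable]: "cusp_mean f \<in> borel_measurable borel"
  unfolding cusp_mean_def[abs_def] set_lebesgue_integral_def
  by (intro lborel.borel_measurable_lebesgue_integral) measurable

lemma cusp_mean_eq_0:
  assumes "\<eta> \<le> 4/5 \<or> (\<forall>z. Im z = \<eta> \<longrightarrow> f z = 0)"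
  shows "cusp_mean f \<eta> = 0"
proof -
  have "cusp_part f (Complex \<xi> \<eta>) = 0" for \<xi>
    using assms cusp_part_eq_0_low[of "Complex \<xi> \<eta>" f] by (auto simp: cusp_part_def)
  thus ?thesis by (simp add: cusp_mean_def)
qed

text \<open>A Riemann sum in a / c inside a Riemann sum in r = c sqrt(Y). The inner one converges to
  a mean over a full period, where the translation involving v disappears; hence the limit is free
  of v.\<close>

lemma lattice_sum_full_tendsto:
  fixes Y :: "nat \<Rightarrow> real"
  assumes Y: "\<And>n. Y n > 0" "Y \<longlonglongrightarrow> 0"
  shows "(\<lambda>n. lattice_sum f (\<lambda>c. {1..c}) v (Y n)) \<longlonglongrightarrow> (LINT r:{0<..<2}|lborel. r * cusp_mean f (1 / r\<^sup>2))"
proof -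
  obtain M where M: "\<And>w. \<bar>cusp_part f w\<bar> \<le> M" by (rule cusp_part_bounded[OF f]) blast
  have M0: "M \<ge> 0" using M[of 0] by linarith
  define h where "h = (\<lambda>n. sqrt (Y n))"
  have h: "\<And>n. h n > 0" "h \<longlonglongrightarrow> 0"
    using Y tendsto_real_sqrt[OF Y(2)] by (auto simp: h_def)
  \<comment> \<open>The inner average carries 1 / c, which turns the weight Y of a pair into sqrt(Y)
    times c sqrt(Y): a mesh width and the factor r.\<close>
  define b where "b = (\<lambda>(c::nat) r. (\<Sum>a\<in>{1..c}. (1 / real c) * cusp_part f (Complex (real a * (1 / real c) - v / r\<^sup>2) (1 / r\<^sup>2))))"
  have b_bound: "\<bar>b c r\<bar> \<le> M" for c r
  proof -
    have "\<bar>b c r\<bar> \<le> (\<Sum>a\<in>{1..c}. (1 / real c) * M)"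
      unfolding b_def using M by (intro order_trans[OF sum_abs] sum_mono) (simp add: abs_mult divide_right_mono)
    also have "\<dots> \<le> M" using M0 by simp
    finally show ?thesis .
  qed
  have b_lim: "(\<lambda>n. b (c n) (r n)) \<longlonglongrightarrow> cusp_mean f (1 / \<rho>\<^sup>2)"
    if c: "filterlim c at_top sequentially" and r: "r \<longlonglongrightarrow> \<rho>" "\<rho> > 0" for c r \<rho>
  proof -
    \<comment> \<open>The maximum keeps the mesh positive for the finitely many n with
      \<open>c n\<close> = 0.\<close>
    define h' where "h' = (\<lambda>n. 1 / real (max 1 (c n)))"
    define \<phi> where "\<phi> = (\<lambda>n \<xi>. cusp_part f (Complex (\<xi> - v / (r n)\<^sup>2) (1 / (r n)\<^sup>2)))"
    have "(\<lambda>n. \<Sum>k\<in>{1..nat \<lfloor>1 / h' n\<rfloor>}. h' n * \<phi> n (real k * h' n)) \<longlonglongrightarrow>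
        (LINT \<xi>:{0<..<1}|lborel. cusp_part f (Complex (\<xi> - v / \<rho>\<^sup>2) (1 / \<rho>\<^sup>2)))"
    proof (rule riemann_sum_tendsto[where B = M])
      show "h' n > 0" for n by (simp add: h'_def)
      have "filterlim (\<lambda>n. max 1 (c n)) at_top sequentially"
        using c by (rule filterlim_at_top_mono) auto
      hence "filterlim (\<lambda>n. real (max 1 (c n))) at_top sequentially"
        by (rule filterlim_compose[OF filterlim_real_sequentially])
      thus "h' \<longlonglongrightarrow> 0" unfolding h'_def by (intro tendsto_divide_0[OF tendsto_const] filterlim_at_top_imp_at_infinity)
      show "\<bar>\<phi> n r\<bar> \<le> M" for n r using M by (simp add: \<phi>_def)
      show "AE \<xi> in lborel. 0 < \<xi> \<longrightarrow> \<xi> < 1 \<longrightarrow> (\<forall>X. X \<longlonglongrightarrow> \<xi> \<longrightarrow>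
          (\<lambda>n. \<phi> n (X n)) \<longlonglongrightarrow> cusp_part f (Complex (\<xi> - v / \<rho>\<^sup>2) (1 / \<rho>\<^sup>2)))"
        using AE_infdist_Ints_ne[of "v / \<rho>\<^sup>2" "1 / \<rho>\<^sup>2"]
      proof eventually_elim
        case (elim \<xi>)
        show ?case
        proof (intro impI allI)
          fix X assume X: "X \<longlonglongrightarrow> \<xi>"
          have "isCont (cusp_part f) (Complex (\<xi> - v / \<rho>\<^sup>2) (1 / \<rho>\<^sup>2))"
            using elim r by (intro cusp_part_isCont f) auto
          moreover have "(\<lambda>n. Complex (X n - v / (r n)\<^sup>2) (1 / (r n)\<^sup>2)) \<longlonglongrightarrow> Complex (\<xi> - v / \<rho>\<^sup>2) (1 / \<rho>\<^sup>2)"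
            using r X by (intro tendsto_Complex tendsto_intros) auto
          ultimately show "(\<lambda>n. \<phi> n (X n)) \<longlonglongrightarrow> cusp_part f (Complex (\<xi> - v / \<rho>\<^sup>2) (1 / \<rho>\<^sup>2))"
            unfolding \<phi>_def by (rule isCont_tendsto_compose)
        qed
      qed
    qed measurable
    moreover have "eventually (\<lambda>n. (\<Sum>k\<in>{1..nat \<lfloor>1 / h' n\<rfloor>}. h' n * \<phi> n (real k * h' n)) = b (c n) (r n)) sequentially"
    proof -
      have "eventually (\<lambda>n. c n \<ge> 1) sequentially" using c by (simp add: filterlim_at_top)
      thus ?thesis
      proof eventually_elim
        case (elim n)
        hence "h' n = 1 / real (c n)" "max 1 (c n) = c n" by (auto simp: h'_def)
        thus ?case using elim by (simp add: b_def \<phi>_def)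
      qed
    qed
    ultimately have "(\<lambda>n. b (c n) (r n)) \<longlonglongrightarrow> (LINT \<xi>:{0<..<1}|lborel. cusp_part f (Complex (\<xi> - v / \<rho>\<^sup>2) (1 / \<rho>\<^sup>2)))"
      by (rule Lim_transform_eventually)
    thus ?thesis by (simp only: cusp_mean_shift)
  qed
  \<comment> \<open>The outer integrand must be a function of a real r. Rounding r / h recovers c
    exactly at the sample points r = c h, and it tends to infinity along every sequence with a
    positive limit.\<close>
  define \<phi> where "\<phi> = (\<lambda>n r. r * b (nat (round (r / h n))) r)"
  have "(\<lambda>n. \<Sum>k\<in>{1..nat \<lfloor>2 / h n\<rfloor>}. h n * \<phi> n (real k * h n)) \<longlonglongrightarrow> (LINT r:{0<..<2}|lborel. r * cusp_mean f (1 / r\<^sup>2))"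
  proof (rule riemann_sum_tendsto[where B = "2 * M"])
    show "\<bar>\<phi> n r\<bar> \<le> 2 * M" if "0 < r" "r \<le> 2" for n r
      unfolding \<phi>_def abs_mult using that b_bound by (intro mult_mono) auto
    show "AE r in lborel. 0 < r \<longrightarrow> r < 2 \<longrightarrow> (\<forall>X. X \<longlonglongrightarrow> r \<longrightarrow> (\<lambda>n. \<phi> n (X n)) \<longlonglongrightarrow> r * cusp_mean f (1 / r\<^sup>2))"
    proof (intro AE_I2 impI allI)
      fix r :: real and X assume r: "0 < r" and X: "X \<longlonglongrightarrow> r"
      have "filterlim (\<lambda>n. X n / h n) at_top sequentially"
        using h by (intro LIM_at_top_divide[OF X r]) auto
      hence "filterlim (\<lambda>n. nat (round (X n / h n))) at_top sequentially"
        unfolding filterlim_at_top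
      proof (intro allI)
        fix Z :: nat
        assume "\<forall>Z. \<forall>\<^sub>F n in sequentially. Z \<le> X n / h n"
        hence "\<forall>\<^sub>F n in sequentially. real Z + 1 \<le> X n / h n" by blast
        thus "\<forall>\<^sub>F n in sequentially. Z \<le> nat (round (X n / h n))"
        proof eventually_elim
          case (elim n)
          hence "real Z \<le> of_int (round (X n / h n))" using of_int_round_gt[of "X n / h n"] by linarith
          hence "int Z \<le> round (X n / h n)" by linarith
          thus ?case by simp
        qed
      qed
      from b_lim[OF this X r] show "(\<lambda>n. \<phi> n (X n)) \<longlonglongrightarrow> r * cusp_mean f (1 / r\<^sup>2)"
        unfolding \<phi>_def using X by (intro tendsto_mult)
    qed
  qed (use h in measurable)
  moreover have "(\<Sum>k\<in>{1..nat \<lfloor>2 / h n\<rfloor>}. h n * \<phi> n (real k * h n)) = lattice_sum f (\<lambda>c. {1..c}) v (Y n)" for n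
  proof -
    have "h n * \<phi> n (real k * h n) = Y n * (\<Sum>a\<in>{1..k}.
       cusp_part f (Complex (real a / real k - v / (real k ^ 2 * Y n)) (1 / (real k ^ 2 * Y n))))" if "k \<in> {1..nat \<lfloor>2 / h n\<rfloor>}" for k
    proof -
      have hn: "h n > 0" "(h n)\<^sup>2 = Y n" using h Y less_imp_le[OF Y(1)] by (auto simp: h_def)
      have k: "real k > 0" using that by simp
      have "nat (round (real k * h n / h n)) = k" using hn by simp
      hence "h n * \<phi> n (real k * h n) = h n * (real k * h n) * b k (real k * h n)" by (simp add: \<phi>_def)
      also have "b k (real k * h n) = (1 / real k) * (\<Sum>a\<in>{1..k}.
         cusp_part f (Complex (real a / real k - v / (real k ^ 2 * Y n)) (1 / (real k ^ 2 * Y n))))"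
        unfolding b_def sum_distrib_left[symmetric] by (simp add: power_mult_distrib hn(2))
      also have "h n * (real k * h n) * ((1 / real k) * S) = (h n)\<^sup>2 * S" for S
        using k by (simp add: power2_eq_square)
      finally show ?thesis by (simp only: hn(2))
    qed
    hence "(\<Sum>k\<in>{1..nat \<lfloor>2 / h n\<rfloor>}. h n * \<phi> n (real k * h n)) = (\<Sum>k\<in>{1..nat \<lfloor>2 / h n\<rfloor>}. Y n * (\<Sum>a\<in>{1..k}.
       cusp_part f (Complex (real a / real k - v / (real k ^ 2 * Y n)) (1 / (real k ^ 2 * Y n)))))"
      by (intro sum.cong refl)
    also have "\<dots> = lattice_sum f (\<lambda>c. {1..c}) v (Y n)"
      unfolding lattice_sum_def index_set_eq[OF Y(1)] h_def by (rule sum_distrib_left[symmetric])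
    finally show ?thesis .
  qed
  ultimately show ?thesis by simp
qed

end

lemma finite_index_set: "y > 0 \<Longrightarrow> finite {c::nat. 0 < c \<and> real c ^ 2 * y \<le> 4}"
  by (simp only: index_set_eq) simp

text \<open>Every pair (c, a) is D times a coprime pair, with D the gcd; closure of C under divisors
  puts this D into C.\<close>

lemma sum_gcd_decomposition:
  fixes G :: "nat \<Rightarrow> nat \<Rightarrow> real"
  assumes fin: "finite C" and pos: "\<And>c. c \<in> C \<Longrightarrow> c > 0"
    and dvd_closed: "\<And>c D. c \<in> C \<Longrightarrow> D dvd c \<Longrightarrow> D \<in> C"
  shows "(\<Sum>D\<in>C. \<Sum>c | 0 < c \<and> D * c \<in> C. \<Sum>a\<in>totatives c. G (D * c) (D * a)) = (\<Sum>c\<in>C. \<Sum>a\<in>{1..c}. G c a)"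
proof -
  have fin': "finite {c. 0 < c \<and> D * c \<in> C}" if "D \<in> C" for D
  proof (rule finite_subset)
    show "{c. 0 < c \<and> D * c \<in> C} \<subseteq> C" using dvd_closed by auto
  qed (rule fin)
  let ?S = "SIGMA D:C. SIGMA c:{c. 0 < c \<and> D * c \<in> C}. totatives c"
  have "(\<Sum>D\<in>C. \<Sum>c | 0 < c \<and> D * c \<in> C. \<Sum>a\<in>totatives c. G (D * c) (D * a)) =
      (\<Sum>D\<in>C. \<Sum>(c, a)\<in>(SIGMA c:{c. 0 < c \<and> D * c \<in> C}. totatives c). G (D * c) (D * a))"
    using fin' by (intro sum.cong refl sum.Sigma) auto
  also have "\<dots> = (\<Sum>(D, c, a)\<in>?S. G (D * c) (D * a))"
    using fin fin' by (subst sum.Sigma) (auto intro!: finite_SigmaI simp: case_prod_unfold)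
  also have "\<dots> = (\<Sum>(c, a)\<in>(SIGMA c:C. {1..c}). G c a)"
  proof (rule sum.reindex_bij_witness[where i = "\<lambda>(c, a). (gcd a c, c div gcd a c, a div gcd a c)" and j = "\<lambda>(D, c, a). (D * c, D * a)"], goal_cases)
    case (1 x)
    then obtain D c a where x: "x = (D, c, a)" "D \<in> C" "0 < c" "D * c \<in> C" "a \<in> totatives c" by auto
    have "gcd (D * a) (D * c) = D" using x by (simp add: gcd_mult_distrib_nat[symmetric] in_totatives_iff)
    thus ?case using x pos[of D] by simp
  next
    case (2 x)
    then obtain D c a where x: "x = (D, c, a)" "D \<in> C" "0 < c" "D * c \<in> C" "a \<in> totatives c" by auto
    thus ?case using pos[of D] by (auto simp: in_totatives_iff)
  next
    case (3 x)
    then obtain c a where x: "x = (c, a)" by auto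
    thus ?case by simp
  next
    case (4 x)
    then obtain c a where x: "x = (c, a)" "c \<in> C" "1 \<le> a" "a \<le> c" by auto
    have g: "gcd a c > 0" using x by simp
    have "coprime (a div gcd a c) (c div gcd a c)" using g by (intro div_gcd_coprime) auto
    moreover have "0 < a div gcd a c" "0 < c div gcd a c" using x by (auto simp: div_greater_zero_iff)
    moreover have "a div gcd a c \<le> c div gcd a c" using x by (intro div_le_mono)
    moreover have "gcd a c \<in> C" using x dvd_closed[of c "gcd a c"] by simp
    ultimately show ?case using x by (auto simp: in_totatives_iff)
  next
    case (5 x)
    thus ?case by auto
  qed
  also have "\<dots> = (\<Sum>c\<in>C. \<Sum>a\<in>{1..c}. G c a)"
    using fin by (subst sum.Sigma) auto
  finally show ?thesis .
qed

text \<open>With c at most N there are at most N^2 pairs, and N^2 y <= 4 by the index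
  condition.\<close>

lemma lattice_sum_bounded:
  assumes M: "\<And>w. \<bar>cusp_part f w\<bar> \<le> M" and y: "y > 0" and R: "\<And>c. R c \<subseteq> {1..c}"
  shows "\<bar>lattice_sum f R v y\<bar> \<le> 4 * M"
proof -
  define C where "C = {c::nat. 0 < c \<and> real c ^ 2 * y \<le> 4}"
  define N where "N = nat \<lfloor>2 / sqrt y\<rfloor>"
  have C: "C = {1..N}" unfolding C_def N_def by (rule index_set_eq[OF y])
  have M0: "M \<ge> 0" using M[of 0] by linarith
  have "\<bar>\<Sum>c\<in>C. \<Sum>a\<in>R c. cusp_part f (Complex (real a / real c - v / (real c ^ 2 * y)) (1 / (real c ^ 2 * y)))\<bar>
      \<le> (\<Sum>c\<in>C. \<Sum>a\<in>R c. M)"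
    by (intro order_trans[OF sum_abs] sum_mono M)
  also have "\<dots> \<le> (\<Sum>c\<in>C. real N * M)"
  proof (intro sum_mono)
    fix c assume "c \<in> C"
    have "card (R c) \<le> c" using card_mono[OF _ R[of c]] by simp
    hence "real (card (R c)) \<le> real N" using \<open>c \<in> C\<close> by (simp add: C)
    thus "(\<Sum>a\<in>R c. M) \<le> real N * M" using M0 by (simp add: mult_right_mono)
  qed
  also have "\<dots> = real N ^ 2 * M" by (simp add: C power2_eq_square)
  finally have *: "\<bar>\<Sum>c\<in>C. \<Sum>a\<in>R c. cusp_part f (Complex (real a / real c - v / (real c ^ 2 * y)) (1 / (real c ^ 2 * y)))\<bar> \<le> real N ^ 2 * M" .
  have "real N ^ 2 * y \<le> 4"
  proof (cases "N = 0")
    case False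
    hence "N \<in> C" by (simp add: C)
    thus ?thesis by (simp add: C_def)
  qed simp
  hence "(real N ^ 2 * y) * M \<le> 4 * M" using M0 by (rule mult_right_mono)
  moreover have "\<bar>lattice_sum f R v y\<bar> \<le> y * (real N ^ 2 * M)"
    unfolding lattice_sum_def abs_mult C_def[symmetric] using * y by (simp add: mult_left_mono)
  ultimately show ?thesis by (simp add: algebra_simps)
qed

text \<open>A point depends on (c, a) only through a / c and c^2 y, so multiplying the pair by D
  amounts to replacing y by D^2 y. Sorting all pairs by their gcd gives the dilated sum, of which
  only finitely many terms are nonzero.\<close>

lemma lattice_sum_dilates:
  assumes y: "y > 0"
  shows "(\<lambda>d. lattice_sum f totatives v ((real d + 1)\<^sup>2 * y) / (real d + 1)\<^sup>2) sums lattice_sum f (\<lambda>c. {1..c}) v y"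
proof -
  define C where "C = {c::nat. 0 < c \<and> real c ^ 2 * y \<le> 4}"
  have fin: "finite C" unfolding C_def by (rule finite_index_set[OF y])
  define G where "G = (\<lambda>c a. cusp_part f (Complex (real a / real c - v / (real c ^ 2 * y)) (1 / (real c ^ 2 * y))))"
  define T where "T = (\<lambda>D. \<Sum>c | 0 < c \<and> D * c \<in> C. \<Sum>a\<in>totatives c. G (D * c) (D * a))"
  have dvd_closed: "D \<in> C" if "c \<in> C" "D dvd c" for c D
  proof -
    have c: "0 < c" "real c ^ 2 * y \<le> 4" using that by (auto simp: C_def)
    have "0 < D" "D \<le> c" using that(2) c by (auto simp: dvd_imp_le intro!: Nat.gr0I)
    hence "real D ^ 2 * y \<le> real c ^ 2 * y" using y by (intro mult_right_mono power_mono) auto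
    thus ?thesis using c \<open>0 < D\<close> by (simp add: C_def)
  qed
  have eq: "lattice_sum f totatives v ((real D)\<^sup>2 * y) / (real D)\<^sup>2 = y * T D" if "D > 0" for D
  proof -
    have set: "{c. 0 < c \<and> (real c)\<^sup>2 * ((real D)\<^sup>2 * y) \<le> 4} = {c. 0 < c \<and> D * c \<in> C}"
      using that by (auto simp: C_def power_mult_distrib mult_ac)
    have "cusp_part f (Complex (real a / real c - v / (real c ^ 2 * ((real D)\<^sup>2 * y))) (1 / (real c ^ 2 * ((real D)\<^sup>2 * y))))
        = G (D * c) (D * a)" if "c > 0" for c a
      using that \<open>D > 0\<close> by (simp add: G_def power_mult_distrib mult_ac)
    hence "(\<Sum>c | 0 < c \<and> (real c)\<^sup>2 * ((real D)\<^sup>2 * y) \<le> 4. \<Sum>a\<in>totatives c.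
       cusp_part f (Complex (real a / real c - v / (real c ^ 2 * ((real D)\<^sup>2 * y))) (1 / (real c ^ 2 * ((real D)\<^sup>2 * y))))) = T D"
      unfolding set T_def by (intro sum.cong refl) auto
    thus ?thesis unfolding lattice_sum_def using that by simp
  qed
  have zero: "T D = 0" if "D > 0" "D \<notin> C" for D
  proof -
    have "D * c \<notin> C" for c using that dvd_closed[of "D * c" D] by auto
    hence "{c. 0 < c \<and> D * c \<in> C} = {}" by simp
    thus ?thesis by (simp only: T_def sum.empty)
  qed
  define C' where "C' = {d. Suc d \<in> C}"
  have C': "C = Suc ` C'"
  proof (rule subset_antisym; rule subsetI)
    fix c assume c: "c \<in> C"
    hence "c > 0" by (simp add: C_def)
    thus "c \<in> Suc ` C'" using c by (cases c) (auto simp: C'_def)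
  qed (auto simp: C'_def)
  have finC': "finite C'" using fin unfolding C' by (simp add: finite_image_iff)
  have "(\<lambda>d. y * T (Suc d)) sums (\<Sum>d\<in>C'. y * T (Suc d))"
    by (rule sums_finite[OF finC']) (auto simp: C'_def zero)
  also have "(\<Sum>d\<in>C'. y * T (Suc d)) = y * (\<Sum>D\<in>C. T D)"
    unfolding C' by (simp add: sum.reindex sum_distrib_left)
  also have "(\<Sum>D\<in>C. T D) = (\<Sum>c\<in>C. \<Sum>a\<in>{1..c}. G c a)"
    unfolding T_def by (rule sum_gcd_decomposition[OF fin _ dvd_closed]) (simp add: C_def)
  also have "y * \<dots> = lattice_sum f (\<lambda>c. {1..c}) v y" by (simp only: lattice_sum_def C_def G_def)
  finally have "(\<lambda>d. y * T (Suc d)) sums lattice_sum f (\<lambda>c. {1..c}) v y" .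
  moreover have "lattice_sum f totatives v ((real d + 1)\<^sup>2 * y) / (real d + 1)\<^sup>2 = y * T (Suc d)" for d
    using eq[of "Suc d"] by (simp add: add.commute)
  ultimately show ?thesis by simp
qed

lemma lattice_sum_primitive_tendsto:
  assumes f: "f \<in> Cc_modular"
  shows "(lattice_sum f totatives v \<longlongrightarrow> 6 / pi\<^sup>2 * (LINT r:{0<..<2}|lborel. r * cusp_mean f (1 / r\<^sup>2))) (at_right 0)"
proof -
  obtain M where M: "\<And>w. \<bar>cusp_part f w\<bar> \<le> M" by (rule cusp_part_bounded[OF f]) blast
  show ?thesis
  proof (rule tendsto_of_dilated_sum)
    show "\<bar>lattice_sum f totatives v y\<bar> \<le> 4 * M" if "y > 0" for y
    proof (rule lattice_sum_bounded[OF M that])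
      show "totatives c \<subseteq> {1..c}" for c by (auto simp: in_totatives_iff)
    qed
    show "(\<lambda>d. lattice_sum f totatives v ((real d + 1)\<^sup>2 * y) / (real d + 1)\<^sup>2) sums lattice_sum f (\<lambda>c. {1..c}) v y" if "y > 0" for y
      by (rule lattice_sum_dilates[OF that])
    show "(lattice_sum f (\<lambda>c. {1..c}) v \<longlongrightarrow> (LINT r:{0<..<2}|lborel. r * cusp_mean f (1 / r\<^sup>2))) (at_right 0)"
      unfolding tendsto_at_iff_sequentially
    proof (intro allI impI)
      fix X :: "nat \<Rightarrow> real" assume X: "\<forall>i. X i \<in> {0<..} - {0}" "X \<longlonglongrightarrow> 0"
      show "(lattice_sum f (\<lambda>c. {1..c}) v \<circ> X) \<longlonglongrightarrow> (LINT r:{0<..<2}|lborel. r * cusp_mean f (1 / r\<^sup>2))"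
        unfolding comp_def by (rule lattice_sum_full_tendsto[OF f]) (use X in auto)
    qed
  qed
qed

section \<open>From the constant coefficient to the hyperbolic area\<close>

lemma fund_dom_iff_cusp_region:
  assumes "\<bar>x\<bar> \<le> 1/2"
  shows "Complex x \<eta> \<in> fund_dom \<longleftrightarrow> Complex x \<eta> \<in> cusp_region"
proof
  assume "Complex x \<eta> \<in> cusp_region"
  hence "Im (Complex x \<eta>) > 0" "1 \<le> cmod (Complex x \<eta> + of_int 0)" by (simp_all only: mem_cusp_region)
  thus "Complex x \<eta> \<in> fund_dom" using assms by (simp add: fund_dom_def)
next
  assume F: "Complex x \<eta> \<in> fund_dom"
  show "Complex x \<eta> \<in> cusp_region" unfolding mem_cusp_region
  proof (intro conjI allI)
    show "Im (Complex x \<eta>) > 0" using F by (simp add: fund_dom_def)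
    fix n :: int
    have "\<bar>x\<bar> \<le> \<bar>x + of_int n\<bar>"
    proof (cases "n = 0")
      case False
      hence "\<bar>real_of_int n\<bar> \<ge> 1" by linarith
      thus ?thesis using assms by linarith
    qed simp
    hence "x\<^sup>2 \<le> (x + of_int n)\<^sup>2" by (simp only: abs_le_square_iff)
    moreover have "1 \<le> cmod (Complex x \<eta>)" using F by (simp add: fund_dom_def)
    hence "1 \<le> (cmod (Complex x \<eta>))\<^sup>2" by (simp only: one_le_power)
    ultimately have "1\<^sup>2 \<le> (cmod (Complex x \<eta> + of_int n))\<^sup>2" by (simp add: cmod_power2)
    thus "1 \<le> cmod (Complex x \<eta> + of_int n)" by (rule power2_le_imp_le) simp
  qed
qed

text \<open>Fubini, with the unit strip around 0 moved by half a period onto (0, 1). The window from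
  1/4 to Y + 1 contains the support and keeps 1/eta^2 bounded; 1/4 is the height that belongs to r =
  2.\<close>

lemma integral_fund_dom:
  assumes f: "f \<in> Cc_modular" and Y: "Y \<ge> 1" "\<And>z. Im z > Y \<Longrightarrow> f z = 0"
  shows "(LINT z:fund_dom|lborel. f z / (Im z)\<^sup>2) = (LINT \<eta>:{1/4..Y + 1}|lborel. cusp_mean f \<eta> / \<eta>\<^sup>2)"
proof -
  note [measurable] = cusp_part_measurable[OF f]
  obtain M where M: "M > 0" "\<And>w. \<bar>cusp_part f w\<bar> \<le> M" by (rule cusp_part_bounded[OF f]) blast
  define H where "H = (\<lambda>x \<eta>. indicator {-1/2..1/2} x * (cusp_part f (Complex x \<eta>) / \<eta>\<^sup>2) :: real)"
  have K0: "cusp_part f (Complex x \<eta>) = 0" if "\<eta> \<notin> {1/4..Y + 1}" for x \<eta>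
    using that cusp_part_eq_0_low[of "Complex x \<eta>" f] Y(2)[of "Complex x \<eta>"] by (auto simp: cusp_part_def)
  have H: "indicator fund_dom (Complex x \<eta>) *\<^sub>R (f (Complex x \<eta>) / (Im (Complex x \<eta>))\<^sup>2) = H x \<eta>" for x \<eta>
  proof (cases "\<bar>x\<bar> \<le> 1/2")
    case True
    thus ?thesis using fund_dom_iff_cusp_region[OF True, of \<eta>] by (auto simp: H_def cusp_part_def indicator_def)
  next
    case False
    hence "Complex x \<eta> \<notin> fund_dom" "x \<notin> {-1/2..1/2}" by (auto simp: fund_dom_def)
    thus ?thesis by (simp add: H_def)
  qed
  have Hmeas [measurable]: "(\<lambda>(x, \<eta>). H x \<eta>) \<in> borel_measurable (lborel \<Otimes>\<^sub>M lborel)"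
    unfolding H_def by measurable
  have Cm: "(\<lambda>(x, y). Complex x y) \<in> (lborel \<Otimes>\<^sub>M lborel) \<rightarrow>\<^sub>M borel" by measurable
  define g where "g = (\<lambda>z. indicator ({-1/2..1/2} :: real set) (Re z) * (cusp_part f z / (Im z)\<^sup>2))"
  have gH: "g (Complex x \<eta>) = H x \<eta>" for x \<eta> by (simp add: g_def H_def)
  have g_eq: "indicator fund_dom z *\<^sub>R (f z / (Im z)\<^sup>2) = g z" for z
    using H[of "Re z" "Im z"] gH[of "Re z" "Im z"] by simp
  have [measurable]: "Re \<in> borel_measurable borel" "Im \<in> borel_measurable borel"
    by (intro borel_measurable_continuous_onI continuous_intros)+
  have gm: "g \<in> borel_measurable borel" unfolding g_def by measurable
  have "(LINT z:fund_dom|lborel. f z / (Im z)\<^sup>2) = (LINT z|lborel. g z)"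
    unfolding set_lebesgue_integral_def g_eq ..
  also have "\<dots> = (LINT p|(lborel \<Otimes>\<^sub>M lborel). g (case p of (x, \<eta>) \<Rightarrow> Complex x \<eta>))"
    by (subst lborel_complex_eq) (rule integral_distr[OF Cm gm])
  also have "\<dots> = (LINT p|(lborel \<Otimes>\<^sub>M lborel). (case p of (x, \<eta>) \<Rightarrow> H x \<eta>))"
    by (intro Bochner_Integration.integral_cong refl) (auto simp: gH)
  also have "\<dots> = (LINT \<eta>|lborel. LINT x|lborel. H x \<eta>)"
  proof (rule lborel_pair.integral_snd[symmetric])
    have "integrable (lborel \<Otimes>\<^sub>M lborel) (\<lambda>p. indicator ({-1/2..1/2} \<times> {1/4..Y + 1}) p *\<^sub>R (case p of (x, \<eta>) \<Rightarrow> H x \<eta>))"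
    proof (rule integrableI_bounded_set_indicator[where B = "M * 16"])
      have "emeasure (lborel \<Otimes>\<^sub>M lborel) ({-1/2..1/2::real} \<times> {1/4..Y + 1}) =
          emeasure lborel {-1/2..1/2::real} * emeasure lborel {1/4..Y + 1}"
        by (intro lborel.emeasure_pair_measure_Times) auto
      also have "\<dots> < \<infinity>" using Y by (simp add: ennreal_mult_less_top)
      finally show "emeasure (lborel \<Otimes>\<^sub>M lborel) ({-1/2..1/2::real} \<times> {1/4..Y + 1}) < \<infinity>" .
      show "AE p in lborel \<Otimes>\<^sub>M lborel. p \<in> {-1/2..1/2} \<times> {1/4..Y + 1} \<longrightarrow> norm (case p of (x, \<eta>) \<Rightarrow> H x \<eta>) \<le> M * 16"
      proof (intro AE_I2 impI)
        fix p :: "real \<times> real" assume "p \<in> {-1/2..1/2} \<times> {1/4..Y + 1}"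
        then obtain x \<eta> :: real where p: "p = (x, \<eta>)" "x \<in> {-1/2..1/2}" "1/4 \<le> \<eta>" by auto
        have "(1/4)\<^sup>2 \<le> \<eta>\<^sup>2" using p by (intro power_mono) auto
        hence "1 / \<eta>\<^sup>2 \<le> 1 / (1/4)\<^sup>2" using p(3) by (intro divide_left_mono mult_pos_pos) auto
        hence "1 / \<eta>\<^sup>2 \<le> 16" by (simp add: power2_eq_square)
        hence "\<bar>cusp_part f (Complex x \<eta>)\<bar> * (1 / \<eta>\<^sup>2) \<le> M * 16" using M by (intro mult_mono) auto
        thus "norm (case p of (x, \<eta>) \<Rightarrow> H x \<eta>) \<le> M * 16" using p by (simp add: H_def abs_divide)
      qed
    qed auto
    moreover have "indicator ({-1/2..1/2} \<times> {1/4..Y + 1}) p *\<^sub>R (case p of (x, \<eta>) \<Rightarrow> H x \<eta>) = (case p of (x, \<eta>) \<Rightarrow> H x \<eta>)" for p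
    proof -
      obtain x \<eta> where p: "p = (x, \<eta>)" by force
      show ?thesis
        using K0[of \<eta> x] unfolding p by (cases "x \<in> {-1/2..1/2}"; cases "\<eta> \<in> {1/4..Y+1}") (simp_all add: H_def indicator_def del: atLeastAtMost_iff)
    qed
    ultimately show "integrable (lborel \<Otimes>\<^sub>M lborel) (\<lambda>(x, \<eta>). H x \<eta>)" by (simp only:)
  qed
  also have "\<dots> = (LINT \<eta>|lborel. indicator {1/4..Y + 1} \<eta> * (cusp_mean f \<eta> / \<eta>\<^sup>2))"
  proof (intro Bochner_Integration.integral_cong refl)
    fix \<eta> :: real
    have "(LINT x|lborel. H x \<eta>) = (LINT x|lborel. indicator {-1/2..1/2} x * cusp_part f (Complex x \<eta>)) / \<eta>\<^sup>2"
      unfolding H_def by (subst integral_divide_zero[symmetric]) (simp add: mult.assoc)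
    also have "(LINT x|lborel. indicator {-1/2..1/2} x * cusp_part f (Complex x \<eta>)) =
        (LINT x|lborel. indicator {0..1} x * cusp_part f (Complex (x - 1/2) \<eta>))"
      by (subst lborel_integral_real_affine[of 1 _ "-1/2"])
         (auto intro!: Bochner_Integration.integral_cong simp: indicator_def)
    also have "\<dots> = (LINT x|lborel. indicator {0<..<1} x * cusp_part f (Complex (x - 1/2) \<eta>))"
    proof (rule integral_cong_AE)
      show "AE x in lborel. indicator {0..1} x * cusp_part f (Complex (x - 1/2) \<eta>) = indicator {0<..<1} x * cusp_part f (Complex (x - 1/2) \<eta>)"
        using AE_lborel_singleton[of 0] AE_lborel_singleton[of 1]
        by eventually_elim (auto simp: indicator_def)
    qed measurable
    also have "\<dots> = cusp_mean f \<eta>" using cusp_mean_shift[OF f, of "1/2" \<eta>] by (simp add: set_lebesgue_integral_def)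
    finally have 1: "(LINT x|lborel. H x \<eta>) = cusp_mean f \<eta> / \<eta>\<^sup>2" .
    show "(LINT x|lborel. H x \<eta>) = indicator {1/4..Y + 1} \<eta> * (cusp_mean f \<eta> / \<eta>\<^sup>2)"
    proof (cases "\<eta> \<in> {1/4..Y + 1}")
      case False
      hence "cusp_mean f \<eta> = 0" using K0[OF False] by (simp add: cusp_mean_def)
      thus ?thesis using 1 by simp
    qed (simp add: 1)
  qed
  finally show ?thesis by (simp add: set_lebesgue_integral_def)
qed

lemma integral_cusp_mean:
  assumes f: "f \<in> Cc_modular"
  shows "(LINT r:{0<..<2}|lborel. r * cusp_mean f (1 / r\<^sup>2)) = (LINT z:fund_dom|lborel. f z / (Im z)\<^sup>2) / 2"
proof -
  note [measurable] = cusp_mean_measurable[OF f]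
  obtain Y where Y: "Y \<ge> 1" "\<And>z. Im z > Y \<Longrightarrow> f z = 0" by (rule Cc_modular_cutoff[OF f]) blast
  obtain M where M: "\<And>w. \<bar>cusp_part f w\<bar> \<le> M" by (rule cusp_part_bounded[OF f]) blast
  \<comment> \<open>At r = a the height 1/r^2 equals Y + 1; for smaller r it exceeds the cutoff and
    the integrand vanishes.\<close>
  define a where "a = 1 / sqrt (Y + 1)"
  have a: "a > 0" "1 / a\<^sup>2 = Y + 1" using Y by (auto simp: a_def power_divide)
  have "sqrt (Y + 1) \<ge> 1" using Y by simp
  hence a1: "a \<le> 1" by (simp add: a_def)
  have "(LINT r:{0<..<2}|lborel. r * cusp_mean f (1 / r\<^sup>2)) = (LINT r:{a..2}|lborel. r * cusp_mean f (1 / r\<^sup>2))"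
    unfolding set_lebesgue_integral_def
  proof (rule integral_cong_AE)
    show "AE r in lborel. indicator {0<..<2} r *\<^sub>R (r * cusp_mean f (1 / r\<^sup>2)) = indicator {a..2} r *\<^sub>R (r * cusp_mean f (1 / r\<^sup>2))"
      using AE_lborel_singleton[of 2]
    proof eventually_elim
      case (elim r)
      show ?case
      proof (cases "0 < r \<and> r < a")
        case True
        hence "r\<^sup>2 \<le> a\<^sup>2" by (intro power_mono) auto
        hence "1 / a\<^sup>2 \<le> 1 / r\<^sup>2" using True by (intro divide_left_mono) auto
        hence "1 / r\<^sup>2 > Y" using a by simp
        hence "cusp_mean f (1 / r\<^sup>2) = 0" using Y by (intro cusp_mean_eq_0[OF f]) auto
        thus ?thesis by simp
      next
        case False
        thus ?thesis using elim a a1 by (auto simp: indicator_def)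
      qed
    qed
  qed measurable
  also have "\<dots> = (LINT \<eta>:{1/2\<^sup>2..1/a\<^sup>2}|lborel. cusp_mean f \<eta> / \<eta>\<^sup>2) / 2"
    using a a1 cusp_mean_bounded[OF f M] by (intro integral_inverse_square_substitution[where B = M]) auto
  also have "\<dots> = (LINT z:fund_dom|lborel. f z / (Im z)\<^sup>2) / 2"
    using integral_fund_dom[OF f Y] a(2) by simp
  finally show ?thesis .
qed

subsection \<open>Equidistribution of long closed horocycles\<close>

text \<open>For theta in (0, 1] the three unit intervals cover (-1/2, 1/2) up to two points. This is
  how the finite range of k turns an integral over one period into one over the line.\<close>

lemma integral_three_shifts:
  fixes G :: "real \<Rightarrow> real"
  assumes G: "integrable lborel G" and supp: "\<And>s. \<bar>s\<bar> \<ge> 1/2 \<Longrightarrow> G s = 0" and \<theta>: "0 < \<theta>" "\<theta> \<le> 1"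
  shows "(\<Sum>k<3. LINT t:{0<..<1}|lborel. G (t + \<theta> - real k)) = integral\<^sup>L lborel G"
proof -
  have [measurable]: "G \<in> borel_measurable borel" using G by auto
  define I where "I = (\<lambda>k::nat. {\<theta> - real k<..<\<theta> - real k + 1})"
  have "(LINT t:{0<..<1}|lborel. G (t + \<theta> - real k)) = (LINT s|lborel. indicator (I k) s * G s)" for k
    unfolding set_lebesgue_integral_def
    by (subst (2) lborel_integral_real_affine[of 1 _ "\<theta> - real k"])
       (auto intro!: Bochner_Integration.integral_cong simp: I_def indicator_def algebra_simps)
  hence "(\<Sum>k<3. LINT t:{0<..<1}|lborel. G (t + \<theta> - real k)) = (\<Sum>k<3. LINT s|lborel. indicator (I k) s * G s)"
    by simp
  also have "\<dots> = (LINT s|lborel. (\<Sum>k<3. indicator (I k) s * G s))"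
  proof (rule Bochner_Integration.integral_sum[symmetric])
    show "integrable lborel (\<lambda>s. indicator (I k) s * G s)" for k
      using integrable_mult_indicator[OF _ G, of "I k"] by (simp add: I_def)
  qed
  also have "\<dots> = integral\<^sup>L lborel G"
  proof (rule integral_cong_AE)
    show "AE s in lborel. (\<Sum>k<3. indicator (I k) s * G s) = G s"
      using AE_lborel_singleton[of \<theta>] AE_lborel_singleton[of "\<theta> - 1"]
    proof eventually_elim
      case (elim s)
      have "(\<Sum>k<3. indicator (I k) s * G s) = (indicator (I 0) s + indicator (I 1) s + indicator (I 2) s) * G s"
        by (simp add: eval_nat_numeral algebra_simps)
      also have "\<dots> = G s"
      proof (cases "\<bar>s\<bar> \<ge> 1/2")
        case False
        hence "indicator (I 0) s + indicator (I 1) s + indicator (I 2) s = (1::real)"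
          using elim \<theta> by (auto simp: I_def indicator_def)
        thus ?thesis by simp
      qed (simp add: supp)
      finally show ?case .
    qed
    show "(\<lambda>s. \<Sum>k<3. indicator (I k) s * G s) \<in> borel_measurable lborel" unfolding I_def by measurable
  qed measurable
  finally show ?thesis .
qed

lemma horocycle_point_eq:
  assumes "q > 0" "y > 0"
  shows "of_real r - 1 / (of_real q * Complex s y) = Complex (r - s / (q * (s\<^sup>2 + y\<^sup>2))) (y / (q * (s\<^sup>2 + y\<^sup>2)))"
proof -
  have "s\<^sup>2 + y\<^sup>2 > 0" using assms by (simp add: add_nonneg_pos)
  moreover have e: "(q * s)\<^sup>2 + (q * y)\<^sup>2 = q * (q * (s\<^sup>2 + y\<^sup>2))" by (simp add: power2_eq_square algebra_simps)
  ultimately have "1 / (of_real q * Complex s y) = Complex (s / (q * (s\<^sup>2 + y\<^sup>2))) (- (y / (q * (s\<^sup>2 + y\<^sup>2))))"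
    using assms by (simp add: complex_eq_iff Re_divide Im_divide e)
  thus ?thesis by (simp add: complex_eq_iff)
qed

text \<open>Writing the horocycle parameter as s = y u gives s^2 + y^2 = y^2 (1 + u^2), so y is
  effectively replaced by y (1 + u^2). The two index ranges differ only in terms of height below
  1/4, where \<open>cusp_part\<close> vanishes.\<close>

lemma lattice_sum_eq_sum:
  assumes y: "y > 0"
  shows "lattice_sum f totatives u (y * (1 + u\<^sup>2)) / (1 + u\<^sup>2) =
    (\<Sum>c | 0 < c \<and> real c ^ 2 * y \<le> 4. \<Sum>a\<in>totatives c.
       y * cusp_part f (of_real (real a / real c) - 1 / (of_real ((real c)\<^sup>2) * Complex (y * u) y)))"
proof -
  have u: "1 + u\<^sup>2 > 0" by (simp add: add_pos_nonneg)
  let ?K = "\<lambda>c a. cusp_part f (Complex (real a / real c - u / (real c ^ 2 * (y * (1 + u\<^sup>2)))) (1 / (real c ^ 2 * (y * (1 + u\<^sup>2)))))"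
  have "lattice_sum f totatives u (y * (1 + u\<^sup>2)) / (1 + u\<^sup>2) =
      y * (\<Sum>c | 0 < c \<and> real c ^ 2 * (y * (1 + u\<^sup>2)) \<le> 4. \<Sum>a\<in>totatives c. ?K c a)"
    using u by (simp add: lattice_sum_def)
  also have "(\<Sum>c | 0 < c \<and> real c ^ 2 * (y * (1 + u\<^sup>2)) \<le> 4. \<Sum>a\<in>totatives c. ?K c a) =
      (\<Sum>c | 0 < c \<and> real c ^ 2 * y \<le> 4. \<Sum>a\<in>totatives c. ?K c a)"
  proof (rule sum.mono_neutral_left)
    show "finite {c::nat. 0 < c \<and> real c ^ 2 * y \<le> 4}" by (rule finite_index_set[OF y])
    show "{c::nat. 0 < c \<and> real c ^ 2 * (y * (1 + u\<^sup>2)) \<le> 4} \<subseteq> {c. 0 < c \<and> real c ^ 2 * y \<le> 4}"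
    proof (intro subsetI CollectI conjI; elim CollectE conjE)
      fix c :: nat assume c: "real c ^ 2 * (y * (1 + u\<^sup>2)) \<le> 4"
      have "y * 1 \<le> y * (1 + u\<^sup>2)" using y by (intro mult_left_mono) auto
      hence "real c ^ 2 * y \<le> real c ^ 2 * (y * (1 + u\<^sup>2))" by (intro mult_left_mono) auto
      thus "real c ^ 2 * y \<le> 4" using c by linarith
    qed
    show "\<forall>c\<in>{c. 0 < c \<and> real c ^ 2 * y \<le> 4} - {c. 0 < c \<and> real c ^ 2 * (y * (1 + u\<^sup>2)) \<le> 4}. (\<Sum>a\<in>totatives c. ?K c a) = 0"
    proof
      fix c assume "c \<in> {c. 0 < c \<and> real c ^ 2 * y \<le> 4} - {c. 0 < c \<and> real c ^ 2 * (y * (1 + u\<^sup>2)) \<le> 4}"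
      hence "real c ^ 2 * (y * (1 + u\<^sup>2)) > 4" by auto
      hence "1 / (real c ^ 2 * (y * (1 + u\<^sup>2))) \<le> 1 / 4" by (intro divide_left_mono) auto
      hence "?K c a = 0" for a by (intro cusp_part_eq_0_low) simp
      thus "(\<Sum>a\<in>totatives c. ?K c a) = 0" by simp
    qed
  qed
  also have "y * \<dots> = (\<Sum>c | 0 < c \<and> real c ^ 2 * y \<le> 4. \<Sum>a\<in>totatives c. y * ?K c a)"
    by (simp add: sum_distrib_left)
  also have "\<dots> = (\<Sum>c | 0 < c \<and> real c ^ 2 * y \<le> 4. \<Sum>a\<in>totatives c.
       y * cusp_part f (of_real (real a / real c) - 1 / (of_real ((real c)\<^sup>2) * Complex (y * u) y)))"
  proof (intro sum.cong refl)
    fix c a assume "c \<in> {c::nat. 0 < c \<and> real c ^ 2 * y \<le> 4}"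
    hence c: "(real c)\<^sup>2 > 0" by simp
    have "(y * u)\<^sup>2 + y\<^sup>2 = y * (y * (1 + u\<^sup>2))" by (simp add: power2_eq_square algebra_simps)
    hence "y * u / ((real c)\<^sup>2 * ((y * u)\<^sup>2 + y\<^sup>2)) = u / ((real c)\<^sup>2 * (y * (1 + u\<^sup>2)))"
      "y / ((real c)\<^sup>2 * ((y * u)\<^sup>2 + y\<^sup>2)) = 1 / ((real c)\<^sup>2 * (y * (1 + u\<^sup>2)))" using y by simp_all
    thus "y * ?K c a = y * cusp_part f (of_real (real a / real c) - 1 / (of_real ((real c)\<^sup>2) * Complex (y * u) y))"
      unfolding horocycle_point_eq[OF c y] by simp
  qed
  finally show ?thesis .
qed

lemma Cc_modular_horocycle_measurable:
  assumes f: "f \<in> Cc_modular" and y: "y > 0"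
  shows "(\<lambda>t. f (Complex (\<xi> + t) y)) \<in> borel_measurable borel"
proof (intro borel_measurable_continuous_onI continuous_on_compose2[of upper_half f UNIV "\<lambda>t. Complex (\<xi> + t) y"])
  show "continuous_on upper_half f" using f by (simp add: Cc_modular_def)
  show "continuous_on UNIV (\<lambda>t. Complex (\<xi> + t) y)" unfolding Complex_eq by (intro continuous_intros)
qed (use y in \<open>auto simp: upper_half_def\<close>)

text \<open>When the unfolding is integrated over t, the shifts k assemble a whole line for each (c,
  d); the translation by d / c then disappears and d enters only through \<open>g c d\<close>. Since
  \<open>g c\<close> permutes the totatives, the sum becomes one over all a prime to c.\<close>

lemma horocycle_integral_eq:
  assumes f: "f \<in> Cc_modular" and y: "0 < y" "y < 1/5"
  shows "(LINT t:{0<..<1}|lborel. f (Complex t y)) = (LINT u|lborel. lattice_sum f totatives u (y * (1 + u\<^sup>2)) / (1 + u\<^sup>2))"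
proof -
  note [measurable] = cusp_part_measurable[OF f]
  obtain M where M: "\<And>w. \<bar>cusp_part f w\<bar> \<le> M" by (rule cusp_part_bounded[OF f]) blast
  define C where "C = {c::nat. 0 < c \<and> real c ^ 2 * y \<le> 4}"
  have finC: "finite C" unfolding C_def by (rule finite_index_set[OF y(1)])
  have Cpos: "c > 0" if "c \<in> C" for c using that by (simp add: C_def)
  define G where "G = (\<lambda>(c::nat) (a::nat) s. cusp_part f (of_real (real a / real c) - 1 / (of_real ((real c)\<^sup>2) * Complex s y)))"
  have Gmeas [measurable]: "G c a \<in> borel_measurable borel" for c a unfolding G_def by measurable
  \<comment> \<open>For |s| >= 1/2 the image has height at most 4 y, below 4/5 because y <
    1/5.\<close>
  have supp: "G c a s = 0" if "c > 0" "\<bar>s\<bar> \<ge> 1/2" for c a s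
  proof -
    have c: "(real c)\<^sup>2 \<ge> 1" using that by (intro one_le_power) auto
    have "(1/2)\<^sup>2 \<le> \<bar>s\<bar>\<^sup>2" using that by (intro power_mono) auto
    hence "1/4 \<le> s\<^sup>2 + y\<^sup>2" using y by (simp add: power2_eq_square add_increasing2)
    hence "1 * (1/4) \<le> (real c)\<^sup>2 * (s\<^sup>2 + y\<^sup>2)" using c by (intro mult_mono) auto
    hence "y / ((real c)\<^sup>2 * (s\<^sup>2 + y\<^sup>2)) \<le> y / (1/4)" using y by (intro divide_left_mono) auto
    also have "y / (1/4) = 4 * y" by simp
    finally have "y / ((real c)\<^sup>2 * (s\<^sup>2 + y\<^sup>2)) \<le> 4/5" using y by linarith
    moreover have "(real c)\<^sup>2 > 0" using that by simp
    ultimately show ?thesis unfolding G_def using horocycle_point_eq[of "(real c)\<^sup>2" y "real a / real c" s] y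
      by (intro cusp_part_eq_0_low) simp
  qed
  have Gint: "integrable lborel (G c a)" if "c > 0" for c a
  proof -
    have "integrable lborel (\<lambda>s. indicator {-1/2..1/2} s *\<^sub>R G c a s)"
      by (rule integrableI_bounded_set_indicator[where B = M]; use M in \<open>simp add: G_def\<close>)
    moreover have "indicator {-1/2..1/2} s *\<^sub>R G c a s = G c a s" for s
      using supp[OF that, of s a] by (cases "1/2 \<le> \<bar>s\<bar>") (auto simp: indicator_def)
    ultimately show ?thesis by (simp only:)
  qed
  have "\<exists>g. \<forall>c. c > 0 \<longrightarrow> bij_betw (g c) (totatives c) (totatives c) \<and> (\<forall>d\<in>totatives c. [g c d * d = 1] (mod c))"
    using exists_inverse_totatives by (intro choice allI) (simp del: bij_betw_cong)
  then obtain g where g_bij: "\<And>c. c > 0 \<Longrightarrow> bij_betw (g c) (totatives c) (totatives c)"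
    and g: "\<And>c d. c > 0 \<Longrightarrow> d \<in> totatives c \<Longrightarrow> [g c d * d = 1] (mod c)" by blast
  define I where "I = (SIGMA c:C. totatives c \<times> {..<3::nat})"
  have finI: "finite I" unfolding I_def using finC by (intro finite_SigmaI) auto
  have Gint': "integrable lborel (\<lambda>t. indicator {0<..<1} t * G c a (t + \<theta>))" if "c > 0" for c a \<theta>
  proof -
    have "integrable lborel (\<lambda>t. G c a (\<theta> + 1 * t))" using Gint[OF that] by (rule lborel_integrable_real_affine) simp
    hence "integrable lborel (\<lambda>t. indicator {0<..<1} t *\<^sub>R G c a (\<theta> + 1 * t))" by (rule integrable_mult_indicator[rotated]) simp
    thus ?thesis by (simp add: add.commute)
  qed
  have fm: "(\<lambda>t. f (Complex t y)) \<in> borel_measurable borel"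
    using Cc_modular_horocycle_measurable[OF f y(1), of 0] by simp
  have "(LINT t:{0<..<1}|lborel. f (Complex t y)) =
      (LINT t|lborel. (\<Sum>(c, d, k)\<in>I. indicator {0<..<1} t * G c (g c d) (t + (real d / real c - real k))))"
    unfolding set_lebesgue_integral_def
  proof (rule integral_cong_AE)
    have "horocycle_ties y \<in> null_sets lborel" by (rule countable_imp_null_set_lborel[OF countable_horocycle_ties])
    hence "AE t in lborel. t \<notin> horocycle_ties y" by (rule AE_not_in)
    thus "AE t in lborel. indicator {0<..<1} t *\<^sub>R f (Complex t y) =
      (\<Sum>(c, d, k)\<in>I. indicator {0<..<1} t * G c (g c d) (t + (real d / real c - real k)))"
    proof eventually_elim
      case (elim t)
      show ?case
      proof (cases "t \<in> {0<..<1}")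
        case True
        have "f (Complex t y) = (\<Sum>(c, d, k)\<in>I. G c (g c d) (t + real d / real c - real k))"
          unfolding I_def C_def G_def using True elim by (intro horocycle_unfolding f y g) auto
        thus ?thesis using True by (simp add: add_diff_eq)
      qed simp
    qed
    show "(\<lambda>t. indicator {0<..<1} t *\<^sub>R f (Complex t y)) \<in> borel_measurable lborel" using fm by measurable
    show "(\<lambda>t. \<Sum>(c, d, k)\<in>I. indicator {0<..<1} t * G c (g c d) (t + (real d / real c - real k))) \<in> borel_measurable lborel"
      unfolding case_prod_unfold by measurable
  qed
  also have "\<dots> = (\<Sum>(c, d, k)\<in>I. (LINT t|lborel. indicator {0<..<1} t * G c (g c d) (t + (real d / real c - real k))))"
    unfolding case_prod_unfold using Cpos
    by (intro Bochner_Integration.integral_sum Gint') (auto simp: I_def)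
  also have "\<dots> = (\<Sum>c\<in>C. \<Sum>d\<in>totatives c. \<Sum>k<3. LINT t:{0<..<1}|lborel. G c (g c d) (t + real d / real c - real k))"
    unfolding I_def using finC
    by (simp add: sum.Sigma[symmetric] sum.cartesian_product[symmetric] set_lebesgue_integral_def add_diff_eq)
  also have "\<dots> = (\<Sum>c\<in>C. \<Sum>d\<in>totatives c. integral\<^sup>L lborel (G c (g c d)))"
  proof (intro sum.cong refl)
    fix c d assume c: "c \<in> C" and d: "d \<in> totatives c"
    have "0 < real d / real c" "real d / real c \<le> 1" using Cpos[OF c] d by (auto simp: in_totatives_iff)
    thus "(\<Sum>k<3. LINT t:{0<..<1}|lborel. G c (g c d) (t + real d / real c - real k)) = integral\<^sup>L lborel (G c (g c d))"
      using Gint supp Cpos[OF c] by (intro integral_three_shifts) auto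
  qed
  also have "\<dots> = (\<Sum>c\<in>C. \<Sum>a\<in>totatives c. integral\<^sup>L lborel (G c a))"
    using Cpos by (intro sum.cong refl sum.reindex_bij_betw g_bij) auto
  also have "\<dots> = (\<Sum>c\<in>C. \<Sum>a\<in>totatives c. LINT u|lborel. y * G c a (y * u))"
  proof (intro sum.cong refl)
    fix c a
    show "integral\<^sup>L lborel (G c a) = (LINT u|lborel. y * G c a (y * u))"
      using y by (subst lborel_integral_real_affine[of y _ 0]) auto
  qed
  also have "\<dots> = (LINT u|lborel. (\<Sum>c\<in>C. \<Sum>a\<in>totatives c. y * G c a (y * u)))"
  proof -
    have int: "integrable lborel (\<lambda>u. y * G c a (y * u))" if "c \<in> C" for c a
      using lborel_integrable_real_affine[OF Gint[OF Cpos[OF that], of a], of y 0] y by (intro integrable_mult_right) simp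
    have "(LINT u|lborel. (\<Sum>c\<in>C. \<Sum>a\<in>totatives c. y * G c a (y * u))) = (\<Sum>c\<in>C. (LINT u|lborel. (\<Sum>a\<in>totatives c. y * G c a (y * u))))"
      using int by (intro Bochner_Integration.integral_sum Bochner_Integration.integrable_sum) auto
    also have "\<dots> = (\<Sum>c\<in>C. \<Sum>a\<in>totatives c. LINT u|lborel. y * G c a (y * u))"
      using int by (intro sum.cong refl Bochner_Integration.integral_sum) auto
    finally show ?thesis by simp
  qed
  also have "\<dots> = (LINT u|lborel. lattice_sum f totatives u (y * (1 + u\<^sup>2)) / (1 + u\<^sup>2))"
    unfolding lattice_sum_eq_sum[OF y(1)] G_def C_def ..
  finally show ?thesis .
qed

lemma integral_inverse_1_plus_square_real:
  "integrable lborel (\<lambda>u::real. 1 / (1 + u\<^sup>2))" "(LINT u|lborel. 1 / (1 + u\<^sup>2)) = pi"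
proof -
  have "einterval (-\<infinity>) \<infinity> = UNIV" by (auto simp: einterval_iff)
  thus "integrable lborel (\<lambda>u::real. 1 / (1 + u\<^sup>2))" "(LINT u|lborel. 1 / (1 + u\<^sup>2)) = pi"
    using integrable_inverse_1_plus_square LBINT_inverse_1_plus_square
    by (simp_all add: set_integrable_def interval_lebesgue_integral_def set_lebesgue_integral_def inverse_eq_divide)
qed

text \<open>Dominated convergence in u with majorant 4 M / (1 + u^2): the pointwise limit
  \<open>L\<close> is the same for every u, so the integral tends to \<open>L * pi\<close>.\<close>

lemma long_horocycles_equidistribute:
  assumes f: "f \<in> Cc_modular"
  shows "((\<lambda>y. LINT t:{0<..<1}|lborel. f (Complex t y)) \<longlongrightarrow> mu_M_integral f) (at_right 0)"
  unfolding tendsto_at_iff_sequentially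
proof (intro allI impI)
  fix X :: "nat \<Rightarrow> real" assume X: "\<forall>i. X i \<in> {0<..} - {0}" "X \<longlonglongrightarrow> 0"
  have Xpos: "X n > 0" for n using X by simp
  note [measurable] = cusp_part_measurable[OF f]
  obtain M where M: "\<And>w. \<bar>cusp_part f w\<bar> \<le> M" by (rule cusp_part_bounded[OF f]) blast
  define L where "L = 6 / pi\<^sup>2 * (LINT r:{0<..<2}|lborel. r * cusp_mean f (1 / r\<^sup>2))"
  have "(\<lambda>n. LINT u|lborel. lattice_sum f totatives u (X n * (1 + u\<^sup>2)) / (1 + u\<^sup>2)) \<longlonglongrightarrow> (LINT u|lborel. L * (1 / (1 + u\<^sup>2)))"
  proof (rule integral_dominated_convergence[where w = "\<lambda>u. 4 * M * (1 / (1 + u\<^sup>2))"])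
    show "(\<lambda>u. lattice_sum f totatives u (X n * (1 + u\<^sup>2)) / (1 + u\<^sup>2)) \<in> borel_measurable lborel" for n
      unfolding lattice_sum_eq_sum[OF Xpos] by measurable
    show "integrable lborel (\<lambda>u. 4 * M * (1 / (1 + u\<^sup>2)))"
      by (intro integrable_mult_right integral_inverse_1_plus_square_real)
    show "AE u in lborel. norm (lattice_sum f totatives u (X n * (1 + u\<^sup>2)) / (1 + u\<^sup>2)) \<le> 4 * M * (1 / (1 + u\<^sup>2))" for n
    proof (rule AE_I2)
      fix u :: real
      have u: "1 + u\<^sup>2 > 0" by (simp add: add_pos_nonneg)
      have "\<bar>lattice_sum f totatives u (X n * (1 + u\<^sup>2))\<bar> \<le> 4 * M"
        using u Xpos by (intro lattice_sum_bounded[OF M]) (auto simp: in_totatives_iff)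
      thus "norm (lattice_sum f totatives u (X n * (1 + u\<^sup>2)) / (1 + u\<^sup>2)) \<le> 4 * M * (1 / (1 + u\<^sup>2))"
        using u by (simp add: abs_divide divide_right_mono)
    qed
    show "AE u in lborel. (\<lambda>n. lattice_sum f totatives u (X n * (1 + u\<^sup>2)) / (1 + u\<^sup>2)) \<longlonglongrightarrow> L * (1 / (1 + u\<^sup>2))"
    proof (rule AE_I2)
      fix u :: real
      have u: "1 + u\<^sup>2 > 0" by (simp add: add_pos_nonneg)
      have "(\<lambda>n. X n * (1 + u\<^sup>2)) \<longlonglongrightarrow> 0 * (1 + u\<^sup>2)" using X by (intro tendsto_mult tendsto_const)
      moreover have "X n * (1 + u\<^sup>2) > 0" for n using Xpos u by simp
      ultimately have "filterlim (\<lambda>n. X n * (1 + u\<^sup>2)) (at_right 0) sequentially"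
        by (intro tendsto_imp_filterlim_at_right always_eventually) auto
      from filterlim_compose[OF lattice_sum_primitive_tendsto[OF f, of u] this]
      have "(\<lambda>n. lattice_sum f totatives u (X n * (1 + u\<^sup>2))) \<longlonglongrightarrow> L" by (simp only: L_def)
      from tendsto_divide[OF this tendsto_const[of "1 + u\<^sup>2"]] u
      show "(\<lambda>n. lattice_sum f totatives u (X n * (1 + u\<^sup>2)) / (1 + u\<^sup>2)) \<longlonglongrightarrow> L * (1 / (1 + u\<^sup>2))" by simp
    qed
  qed measurable
  also have "(LINT u|lborel. L * (1 / (1 + u\<^sup>2))) = L * pi"
    by (subst integral_mult_right_zero) (simp only: integral_inverse_1_plus_square_real)
  also have "L * pi = mu_M_integral f"
    unfolding L_def integral_cusp_mean[OF f] mu_M_integral_def by (simp add: power2_eq_square)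
  finally have lim: "(\<lambda>n. LINT u|lborel. lattice_sum f totatives u (X n * (1 + u\<^sup>2)) / (1 + u\<^sup>2)) \<longlonglongrightarrow> mu_M_integral f" .
  have "eventually (\<lambda>n. X n < 1/5) sequentially" using X(2) by (rule order_tendstoD) simp
  hence "eventually (\<lambda>n. (LINT u|lborel. lattice_sum f totatives u (X n * (1 + u\<^sup>2)) / (1 + u\<^sup>2)) =
      ((\<lambda>y. LINT t:{0<..<1}|lborel. f (Complex t y)) \<circ> X) n) sequentially"
    by eventually_elim (simp add: horocycle_integral_eq[OF f Xpos])
  with lim show "((\<lambda>y. LINT t:{0<..<1}|lborel. f (Complex t y)) \<circ> X) \<longlonglongrightarrow> mu_M_integral f"
    by (rule Lim_transform_eventually)
qed

subsection \<open>Dense primitive points\<close>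

lemma powr_neg_small:
  fixes K a \<eta> :: real
  assumes "a > 0" "\<eta> > 0"
  obtains n0 where "\<And>n. n \<ge> n0 \<Longrightarrow> K * real n powr (-a) \<le> \<eta>"
proof -
  have "(\<lambda>n. real n powr (-a)) \<longlonglongrightarrow> 0"
    using assms by (intro tendsto_neg_powr filterlim_real_sequentially) auto
  hence "(\<lambda>n. K * real n powr (-a)) \<longlonglongrightarrow> K * 0" by (intro tendsto_mult tendsto_const)
  hence "eventually (\<lambda>n. K * real n powr (-a) < \<eta>) sequentially" using assms by (intro order_tendstoD) auto
  thus thesis using that by (auto simp: eventually_sequentially intro: less_imp_le)
qed

lemma riemann_sum_close:
  fixes F :: "real \<Rightarrow> real"
  assumes [measurable]: "F \<in> borel_measurable borel" and bound: "\<And>t. \<bar>F t\<bar> \<le> M" and N: "N > 0"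
    and osc: "\<And>t t'. \<bar>t - t'\<bar> \<le> 1 / real N \<Longrightarrow> \<bar>F t - F t'\<bar> \<le> e"
  shows "\<bar>(LINT t:{0<..<1}|lborel. F t) - (\<Sum>i<N. F (real i / real N)) / real N\<bar> \<le> e"
proof -
  define I where "I = (\<lambda>i::nat. {real i / real N..<real (Suc i) / real N})"
  have int: "set_integrable lborel {a..<b} F" if "a \<le> b" for a b
    unfolding set_integrable_def
    by (rule integrableI_bounded_set_indicator[where B = M]; use that bound in simp)
  have I_le: "real i / real N \<le> real (Suc i) / real N" for i by (simp add: divide_right_mono)
  have split: "(LINT t:{0..<real k / real N}|lborel. F t) = (\<Sum>i<k. LINT t:I i|lborel. F t)" for k
  proof (induction k)
    case 0 show ?case by (simp add: set_lebesgue_integral_def)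
  next
    case (Suc k)
    have "{0..<real (Suc k) / real N} = {0..<real k / real N} \<union> I k"
      unfolding I_def using N by (subst ivl_disj_un_two(3)) (auto simp: divide_right_mono)
    moreover have "(LINT t:({0..<real k / real N} \<union> I k)|lborel. F t) =
        (LINT t:{0..<real k / real N}|lborel. F t) + (LINT t:I k|lborel. F t)"
      unfolding I_def by (rule set_integral_Un) (auto intro!: int simp: divide_right_mono)
    ultimately show ?case using Suc.IH by simp
  qed
  have len: "measure lborel (I i) = 1 / real N" for i
    using I_le[of i] by (simp add: I_def add_divide_distrib)
  have close: "\<bar>(LINT t:I i|lborel. F t) - F (real i / real N) / real N\<bar> \<le> e / real N" for i
  proof -
    have c: "(LINT t:I i|lborel. c) = c / real N" for c :: real
      by (simp add: set_lebesgue_integral_def len[unfolded measure_def[symmetric]] I_def[symmetric])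
    have intI: "set_integrable lborel (I i) F" unfolding I_def by (rule int[OF I_le])
    have ci: "set_integrable lborel (I i) (\<lambda>_. c)" for c :: real
      using I_le[of i] by (auto simp: set_integrable_def I_def)
    have "(LINT t:I i|lborel. F t) - F (real i / real N) / real N = (LINT t:I i|lborel. F t - F (real i / real N))"
      using intI ci c by (subst set_integral_diff) auto
    also have "\<bar>\<dots>\<bar> \<le> (LINT t:I i|lborel. e)"
    proof -
      have "norm (LINT t:I i|lborel. F t - F (real i / real N)) \<le> (LINT t|lborel. indicator (I i) t *\<^sub>R e)"
        unfolding set_lebesgue_integral_def
      proof (rule Bochner_Integration.integral_norm_bound_integral)
        show "integrable lborel (\<lambda>t. indicator (I i) t *\<^sub>R (F t - F (real i / real N)))"
          using set_integral_diff(1)[OF intI ci] by (simp add: set_integrable_def)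
        show "integrable lborel (\<lambda>t. indicator (I i) t *\<^sub>R e)" using ci by (simp add: set_integrable_def)
        fix t
        show "norm (indicator (I i) t *\<^sub>R (F t - F (real i / real N))) \<le> indicator (I i) t *\<^sub>R e"
        proof (cases "t \<in> I i")
          case True
          hence "\<bar>t - real i / real N\<bar> \<le> 1 / real N" by (auto simp: I_def add_divide_distrib)
          thus ?thesis using osc True by simp
        qed simp
      qed
      thus ?thesis by (simp add: set_lebesgue_integral_def)
    qed
    finally show ?thesis unfolding c .
  qed
  have "(LINT t:{0<..<1}|lborel. F t) = (LINT t:{0..<1}|lborel. F t)"
    unfolding set_lebesgue_integral_def
  proof (rule integral_cong_AE)
    show "AE t in lborel. indicator {0<..<1} t *\<^sub>R F t = indicator {0..<1} t *\<^sub>R F t"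
      using AE_lborel_singleton[of 0] by eventually_elim (auto simp: indicator_def)
  qed measurable
  also have "\<dots> = (\<Sum>i<N. LINT t:I i|lborel. F t)" using split[of N] N by simp
  finally have "(LINT t:{0<..<1}|lborel. F t) - (\<Sum>i<N. F (real i / real N)) / real N =
      (\<Sum>i<N. (LINT t:I i|lborel. F t) - F (real i / real N) / real N)"
    by (simp add: sum_subtractf sum_divide_distrib)
  also have "\<bar>\<dots>\<bar> \<le> (\<Sum>i<N. e / real N)" by (intro order_trans[OF sum_abs] sum_mono close)
  also have "\<dots> = e" using N by simp
  finally show ?thesis .
qed

text \<open>The condition on j says that j / m lies in the i-th of N equal parts of [0, 1), so j
  runs through an interval of length m / N and the sieve count applies.\<close>

lemma card_coprime_block:
  assumes m: "m > 0" and i: "i < N"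
  shows "\<bar>real (card {j. j < m \<and> coprime j m \<and> j * N div m = i}) - real (totient m) / real N\<bar> \<le> 2 ^ card (prime_factors m)"
proof -
  have N: "N > 0" using i by simp
  let ?A = "real i * real m / real N" and ?B = "real (Suc i) * real m / real N"
  have le: "?A \<le> ?B" by (intro divide_right_mono mult_right_mono) auto
  have iff: "j * N div m = i \<longleftrightarrow> ?A \<le> real j \<and> real j < ?B" for j
  proof -
    have "j * N div m = i \<longleftrightarrow> i * m \<le> j * N \<and> j * N < Suc i * m"
    proof -
      have "j * N div m = i \<longleftrightarrow> i \<le> j * N div m \<and> j * N div m < Suc i" by auto
      thus ?thesis using m by (simp only: less_eq_div_iff_mult_less_eq div_less_iff_less_mult)
    qed
    also have "\<dots> \<longleftrightarrow> real (i * m) \<le> real (j * N) \<and> real (j * N) < real (Suc i * m)"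
      by (simp only: of_nat_le_iff of_nat_less_iff)
    also have "\<dots> \<longleftrightarrow> ?A \<le> real j \<and> real j < ?B"
      using N by (simp add: pos_divide_le_eq pos_less_divide_eq distrib_right)
    finally show ?thesis .
  qed
  have B_le: "?B \<le> real m"
  proof -
    have "real (Suc i) * real m \<le> real N * real m" using i by (intro mult_right_mono) auto
    thus ?thesis using N by (simp add: pos_divide_le_eq mult.commute)
  qed
  have "{j::int. ?A \<le> j \<and> j < ?B \<and> coprime j (int m)} = int ` {j. j < m \<and> coprime j m \<and> j * N div m = i}"
  proof (rule subset_antisym; rule subsetI)
    fix j :: int assume j: "j \<in> {j. ?A \<le> real_of_int j \<and> real_of_int j < ?B \<and> coprime j (int m)}"
    have "0 \<le> ?A" by simp
    moreover have "?A \<le> real_of_int j" using j unfolding mem_Collect_eq by (elim conjE)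
    ultimately have "0 \<le> real_of_int j" by (rule order_trans)
    then obtain k where k: "j = int k" by (metis of_int_0_le_iff nonneg_int_cases)
    have "real_of_int (int k) < ?B" using j unfolding k mem_Collect_eq by (elim conjE)
    hence "real k < real m" using B_le by (simp only: of_int_of_nat_eq)
    thus "j \<in> int ` {j. j < m \<and> coprime j m \<and> j * N div m = i}" using j unfolding k by (intro imageI) (simp add: iff)
  next
    fix j :: int assume "j \<in> int ` {j. j < m \<and> coprime j m \<and> j * N div m = i}"
    then obtain k where "j = int k" "coprime k m" "k * N div m = i" by auto
    thus "j \<in> {j. ?A \<le> real_of_int j \<and> real_of_int j < ?B \<and> coprime j (int m)}" by (simp add: iff)
  qed
  hence card: "card {j::int. ?A \<le> j \<and> j < ?B \<and> coprime j (int m)} = card {j. j < m \<and> coprime j m \<and> j * N div m = i}"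
    by (simp add: card_image)
  have "?B - ?A = real m / real N" by (simp add: diff_divide_distrib[symmetric] algebra_simps)
  hence "(?B - ?A) * (real (totient m) / real m) = real (totient m) / real N" using m by simp
  thus ?thesis using card_coprime_interval[OF m le] unfolding card by simp
qed

text \<open>Residues below m and totatives in {1..m} differ only for m = 1, where 0 stands in for
  1.\<close>

lemma card_coprime_below: "m > 0 \<Longrightarrow> card {j. j < m \<and> coprime j m} = totient m"
proof -
  assume m: "m > 0"
  show ?thesis
  proof (cases "m = 1")
    case True
    hence "{j. j < m \<and> coprime j m} = {0}" by auto
    thus ?thesis using True by simp
  next
    case False
    have "{j. j < m \<and> coprime j m} = totatives m"
    proof (rule subset_antisym; rule subsetI)
      fix j assume "j \<in> {j. j < m \<and> coprime j m}"
      hence j: "j < m" "coprime j m" by auto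
      have "j \<noteq> 0"
      proof
        assume "j = 0"
        hence "coprime 0 m" using j by simp
        thus False using False by simp
      qed
      thus "j \<in> totatives m" using j by (simp add: in_totatives_iff)
    next
      fix j assume "j \<in> totatives m"
      hence j: "0 < j" "j \<le> m" "coprime j m" by (auto simp: in_totatives_iff)
      have "j \<noteq> m" using j False by auto
      thus "j \<in> {j. j < m \<and> coprime j m}" using j by simp
    qed
    thus ?thesis by (simp add: totient_def)
  qed
qed

text \<open>Cut the circle into N cells no longer than delta y. On a cell f is constant up to
  epsilon/4, and the number of primitive points in it is totient m / N up to 2^omega(m). Moving the
  points to the cell endpoints leads to a Riemann sum for the horocycle integral. The threshold
  m^(-1/2) keeps N small enough for the N sieve errors to be negligible.\<close>

lemma primitive_equidistribution:
  assumes f: "f \<in> Cc_modular" and eps: "\<epsilon> > 0"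
  obtains m0 :: nat and y0 :: real where "y0 > 0"
    "\<And>m \<xi> y. m \<ge> m0 \<Longrightarrow> real m powr (-1/2) \<le> y \<Longrightarrow> y \<le> y0 \<Longrightarrow> \<bar>delta_pr_integral m \<xi> y f - mu_M_integral f\<bar> \<le> \<epsilon>"
proof -
  obtain M where M: "M > 0" "\<And>z. Im z > 0 \<Longrightarrow> \<bar>f z\<bar> \<le> M" by (rule Cc_modular_bounded[OF f]) blast
  obtain \<delta> where \<delta>: "\<delta> > 0" "\<And>t t' y. y > 0 \<Longrightarrow> \<bar>t - t'\<bar> \<le> \<delta> * y \<Longrightarrow> \<bar>f (Complex t y) - f (Complex t' y)\<bar> \<le> \<epsilon>/4"
    using eps by (rule_tac Cc_modular_uniform[OF f, of "\<epsilon>/4"]) auto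
  obtain y0 where y0: "y0 > 0" "\<And>y. 0 < y \<Longrightarrow> y < y0 \<Longrightarrow> \<bar>(LINT t:{0<..<1}|lborel. f (Complex t y)) - mu_M_integral f\<bar> < \<epsilon>/4"
  proof -
    have "eventually (\<lambda>y. dist (LINT t:{0<..<1}|lborel. f (Complex t y)) (mu_M_integral f) < \<epsilon>/4) (at_right 0)"
      using long_horocycles_equidistribute[OF f] eps by (intro tendstoD) auto
    thus thesis using that by (auto simp: eventually_at_right_field dist_real_def)
  qed
  obtain C where C: "C \<ge> 1" "\<And>n. n > 0 \<Longrightarrow> real (\<Prod>p\<in>prime_factors n. multiplicity p n + 1) \<le> C * real n powr (1/16)"
    by (rule prod_multiplicity_bound[of "1/16"]) auto
  \<comment> \<open>In the bound with this constant the exponent -3/8 is 1/2 + 1/16 + 1/16 - 1: the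
    number of cells, two factors 2^omega(m), and the division by m.\<close>
  define K where "K = (1 / \<delta> + 1) * C\<^sup>2 * M"
  obtain m1 where m1: "\<And>m. m \<ge> m1 \<Longrightarrow> K * real m powr (-(3/8)) \<le> \<epsilon>/4"
    using eps by (rule_tac powr_neg_small[of "3/8" "\<epsilon>/4" K]) auto
  show thesis
  proof (rule that[of "y0/2" "max 1 m1"])
    show "y0/2 > 0" using y0 by simp
    fix m :: nat and \<xi> y :: real
    assume m_ge: "m \<ge> max 1 m1" and y_ge: "real m powr (-1/2) \<le> y" and y_le: "y \<le> y0/2"
    have m: "m > 0" "m \<ge> m1" using m_ge by auto
    have mpow: "real m powr (-1/2) > 0" using m by simp
    have y: "y > 0" using mpow y_ge by linarith
    define F where "F = (\<lambda>t. f (Complex (\<xi> + t) y))"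
    have F_M: "\<bar>F t\<bar> \<le> M" for t unfolding F_def using y by (intro M) simp
    define N where "N = nat \<lceil>1 / (\<delta> * y)\<rceil>"
    have "1 / (\<delta> * y) > 0" using \<delta> y by simp
    hence N: "N > 0" "1 / (\<delta> * y) \<le> real N" "real N \<le> 1 / (\<delta> * y) + 1" unfolding N_def by linarith+
    have N_inv: "1 / real N \<le> \<delta> * y"
    proof -
      have "1 \<le> real N * (\<delta> * y)" using N(2) \<delta>(1) y by (simp add: pos_divide_le_eq)
      thus ?thesis using N(1) by (simp add: pos_divide_le_eq mult.commute)
    qed
    have osc: "\<bar>F t - F t'\<bar> \<le> \<epsilon>/4" if "\<bar>t - t'\<bar> \<le> 1 / real N" for t t'
      unfolding F_def using that N_inv by (intro \<delta>(2)[OF y]) simp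
    have Fm: "F \<in> borel_measurable borel" unfolding F_def by (rule Cc_modular_horocycle_measurable[OF f y])
    have hm: "(\<lambda>t. f (Complex t y)) \<in> borel_measurable borel"
      using Cc_modular_horocycle_measurable[OF f y, of 0] by simp
    have shift: "(LINT t:{0<..<1}|lborel. F t) = (LINT t:{0<..<1}|lborel. f (Complex t y))"
    proof -
      have "f (Complex (x + of_int n) y) = f (Complex x y)" for x and n :: int
      proof -
        have "Complex (x + of_int n) y = Complex x y + of_int n" by (simp add: complex_eq_iff)
        thus ?thesis using Cc_modular_add_int[OF f, of "Complex x y" n] y by simp
      qed
      hence "(LINT t:{0<..<1}|lborel. f (Complex (t + \<xi>) y)) = (LINT t:{0<..<1}|lborel. f (Complex t y))"
        using M(2) y by (intro integral_periodic_shift[OF hm, of M]) auto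
      thus ?thesis by (simp add: F_def add.commute)
    qed
    define U where "U = {j. j < m \<and> coprime j m}"
    define w where "w = real (totient m)"
    have cardU: "real (card U) = w" unfolding U_def w_def using card_coprime_below[OF m(1)] by simp
    have finU: "finite U" unfolding U_def by simp
    define \<omega> where "\<omega> = (2::real) ^ card (prime_factors m)"
    have w_pos: "w > 0" using m by (simp add: w_def)
    have block: "\<bar>real (card {j\<in>U. j * N div m = i}) - w / real N\<bar> \<le> \<omega>" if "i < N" for i
    proof -
      have "{j\<in>U. j * N div m = i} = {j. j < m \<and> coprime j m \<and> j * N div m = i}" by (auto simp: U_def)
      thus ?thesis using card_coprime_block[OF m(1) that] by (simp only: w_def \<omega>_def)
    qed
    have idx: "j * N div m < N" if "j \<in> U" for j
      using that N(1) m by (simp add: U_def div_less_iff_less_mult mult.commute)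
    have group: "(\<Sum>i<N. \<Sum>j\<in>{j\<in>U. j * N div m = i}. G j) = (\<Sum>j\<in>U. G j)" for G :: "nat \<Rightarrow> real"
      using idx by (intro sum.group finU) auto
    have near: "\<bar>F (real j / real m) - F (real (j * N div m) / real N)\<bar> \<le> \<epsilon>/4" for j
    proof (rule osc)
      define i where "i = j * N div m"
      have "i * m \<le> j * N" "j * N < (i + 1) * m" using m unfolding i_def
        by (simp_all add: div_times_less_eq_dividend dividend_less_div_times)
      hence "real (i * m) \<le> real (j * N)" "real (j * N) < real ((i + 1) * m)" by (simp_all only: of_nat_le_iff of_nat_less_iff)
      hence "real i / real N \<le> real j / real m" "real j / real m < (real i + 1) / real N"
        using m N(1) by (simp_all add: divide_simps algebra_simps)
      thus "\<bar>real j / real m - real (j * N div m) / real N\<bar> \<le> 1 / real N"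
        unfolding i_def[symmetric] by (simp add: add_divide_distrib)
    qed
    define S where "S = (\<Sum>j\<in>U. F (real j / real m))"
    define S1 where "S1 = (\<Sum>i<N. F (real i / real N))"
    define I where "I = (LINT t:{0<..<1}|lborel. F t)"
    have e1: "\<bar>S - (\<Sum>j\<in>U. F (real (j * N div m) / real N))\<bar> \<le> \<epsilon>/4 * w"
    proof -
      have "\<bar>S - (\<Sum>j\<in>U. F (real (j * N div m) / real N))\<bar> \<le> (\<Sum>j\<in>U. \<epsilon>/4)"
        unfolding S_def sum_subtractf[symmetric] by (intro order_trans[OF sum_abs] sum_mono near)
      thus ?thesis using cardU by (simp add: mult.commute)
    qed
    have "(\<Sum>j\<in>U. F (real (j * N div m) / real N)) = (\<Sum>i<N. \<Sum>j\<in>{j\<in>U. j * N div m = i}. F (real (j * N div m) / real N))"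
      by (rule group[symmetric])
    also have "\<dots> = (\<Sum>i<N. real (card {j\<in>U. j * N div m = i}) * F (real i / real N))"
      by (intro sum.cong refl) simp
    finally have e2: "(\<Sum>j\<in>U. F (real (j * N div m) / real N)) - w * (S1 / real N) =
        (\<Sum>i<N. (real (card {j\<in>U. j * N div m = i}) - w / real N) * F (real i / real N))"
      by (simp add: S1_def left_diff_distrib sum_subtractf sum_distrib_left sum_divide_distrib)
    have e3: "\<bar>(\<Sum>j\<in>U. F (real (j * N div m) / real N)) - w * (S1 / real N)\<bar> \<le> real N * (\<omega> * M)"
    proof -
      have "\<bar>(\<Sum>j\<in>U. F (real (j * N div m) / real N)) - w * (S1 / real N)\<bar> \<le> (\<Sum>i<N. \<omega> * M)"
        unfolding e2
      proof (intro order_trans[OF sum_abs] sum_mono)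
        fix i assume "i \<in> {..<N}"
        thus "\<bar>(real (card {j\<in>U. j * N div m = i}) - w / real N) * F (real i / real N)\<bar> \<le> \<omega> * M"
          unfolding abs_mult using M block F_M by (intro mult_mono) (auto simp: \<omega>_def)
      qed
      thus ?thesis by simp
    qed
    have e4: "\<bar>I - S1 / real N\<bar> \<le> \<epsilon>/4"
      unfolding I_def S1_def by (rule riemann_sum_close[OF Fm F_M N(1) osc])
    have e5: "\<bar>I - mu_M_integral f\<bar> \<le> \<epsilon>/4"
      unfolding I_def shift using y0 y y_le by (intro less_imp_le[OF y0(2)]) auto
    \<comment> \<open>One factor 2^omega(m) is the error per cell, the other comes from comparing
      the totient with m. Multiplying the claim by \<open>\<omega>\<close> reduces it to a bound by
      epsilon/4 times m.\<close>
    have e6: "real N * (\<omega> * M) \<le> \<epsilon>/4 * w"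
    proof -
      have mr: "real m \<ge> 1" using m by simp
      have "1 / y \<le> 1 / (real m powr (-1/2))" using mpow y_ge y by (intro divide_left_mono) auto
      also have "\<dots> = real m powr (1/2)" by (simp add: powr_minus_divide)
      finally have y_inv: "1 / y \<le> real m powr (1/2)" .
      have "1 / (\<delta> * y) = (1/\<delta>) * (1/y)" by simp
      also have "\<dots> \<le> (1/\<delta>) * real m powr (1/2)" using y_inv \<delta>(1) by (intro mult_left_mono) auto
      finally have "1 / (\<delta> * y) \<le> (1/\<delta>) * real m powr (1/2)" .
      moreover have "1 \<le> real m powr (1/2)" using mr by (intro ge_one_powr_ge_zero) auto
      ultimately have N_le: "real N \<le> (1/\<delta> + 1) * real m powr (1/2)" using N(3) by (simp add: distrib_right)
      have \<omega>_le: "\<omega> \<le> C * real m powr (1/16)"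
      proof -
        have "\<omega> = real (2 ^ card (prime_factors m))" by (simp add: \<omega>_def)
        also have "\<dots> \<le> real (\<Prod>p\<in>prime_factors m. multiplicity p m + 1)" using two_power_omega_le[of m] by (simp only: of_nat_le_iff)
        also have "\<dots> \<le> C * real m powr (1/16)" by (rule C(2)[OF m(1)])
        finally show ?thesis .
      qed
      have \<omega>_pos: "\<omega> > 0" by (simp add: \<omega>_def)
      have "real N * (\<omega> * M) * \<omega> = real N * (\<omega> * \<omega>) * M" by simp
      also have "\<dots> \<le> ((1/\<delta> + 1) * real m powr (1/2)) * ((C * real m powr (1/16)) * (C * real m powr (1/16))) * M"
        using N_le \<omega>_le \<omega>_pos M(1) \<delta>(1) C(1) by (intro mult_mono) auto
      also have "\<dots> = K * (real m powr (1/2) * real m powr (1/16) * real m powr (1/16))"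
        by (simp add: K_def power2_eq_square)
      also have "real m powr (1/2) * real m powr (1/16) * real m powr (1/16) = real m powr (-(3/8)) * real m"
      proof -
        have "real m powr (-(3/8)) * real m = real m powr (-(3/8)) * real m powr 1" using mr by simp
        thus ?thesis by (simp only: powr_add[symmetric]) simp
      qed
      also have "K * (real m powr (-(3/8)) * real m) = (K * real m powr (-(3/8))) * real m" by simp
      also have "\<dots> \<le> \<epsilon>/4 * real m" using m1[OF m(2)] by (intro mult_right_mono) auto
      also have "\<dots> \<le> \<epsilon>/4 * (\<omega> * w)"
        using totient_ge_omega[OF m(1)] eps by (intro mult_left_mono) (auto simp: \<omega>_def w_def)
      finally have "real N * (\<omega> * M) * \<omega> \<le> (\<epsilon>/4 * w) * \<omega>" by (simp add: mult_ac)
      thus ?thesis using \<omega>_pos by (simp only: mult_le_cancel_right_pos)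
    qed
    have "\<bar>w * I - w * (S1 / real N)\<bar> \<le> w * (\<epsilon>/4)"
      unfolding right_diff_distrib[symmetric] abs_mult using e4 w_pos by (simp add: mult_left_mono)
    hence e7: "\<bar>S - w * I\<bar> \<le> 3 * (\<epsilon>/4 * w)" using e1 e3 e6 unfolding mult.commute[of w "\<epsilon>/4"] by linarith
    have "S = w * (S / w)" using w_pos by simp
    hence "w * \<bar>S / w - I\<bar> \<le> w * (3 * (\<epsilon>/4))"
      using e7 w_pos by (metis abs_mult abs_of_pos mult.commute mult.left_commute right_diff_distrib)
    hence "\<bar>S / w - I\<bar> \<le> 3 * (\<epsilon>/4)" using w_pos by (simp only: mult_le_cancel_left_pos)
    moreover have "delta_pr_integral m \<xi> y f = S / w"
      by (simp add: delta_pr_integral_def S_def w_def F_def U_def)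
    ultimately show "\<bar>delta_pr_integral m \<xi> y f - mu_M_integral f\<bar> \<le> \<epsilon>" using e5 by linarith
  qed
qed

subsection \<open>The duality of heights\<close>

text \<open>In lowest terms p/q + j/m is N / (q m) with N = p m + j q, and a matrix with bottom row
  (q m, -N) carries the point above it to real part A / (q m), where A N = -1 modulo q m. Modulo q
  the residue of N, hence of A, does not depend on j. Writing A = A0 + q t, the residues t run
  through the units modulo m.\<close>

lemma modular_duality:
  fixes p :: int and q m :: nat
  assumes f: "f \<in> Cc_modular" and q: "q > 0" and m: "m > 0" and qm: "coprime q m" and pq: "coprime p (int q)"
  obtains \<xi> where "\<And>y. y > 0 \<Longrightarrow> delta_pr_integral m (of_int p / real q) y f =
      delta_pr_integral m \<xi> (1 / ((real q)\<^sup>2 * (real m)\<^sup>2 * y)) f"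
proof -
  define r where "r = q * m"
  have r: "r > 0" using q m by (simp add: r_def)
  have qm': "coprime (int q) (int m)" "coprime (int m) (int q)" using qm by (simp_all add: coprime_commute)
  have "coprime (int m * int m * p) (int q)" using qm' pq by simp
  then obtain s where s: "[(int m * int m * p) * s = 1] (mod int q)" using cong_solve_coprime_int by blast
  \<comment> \<open>The choice of s gives \<open>A0\<close> the required residue modulo q, and the
    factor m makes \<open>A0\<close> vanish modulo m. There A becomes q t, which shows that t is a
    unit.\<close>
  define A0 where "A0 = - (int m * s)"
  define U where "U = {j. j < m \<and> coprime j m}"
  have "\<exists>t::int. [(int q)\<^sup>2 * t * int j = -1] (mod int m) \<and> (\<forall>y>0. f (Complex (of_int p / real q + real j / real m) y) =
      f (Complex (of_int A0 / real r + of_int t / real m) (1 / ((real q)\<^sup>2 * (real m)\<^sup>2 * y))))" if j: "j \<in> U" for j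
  proof -
    define N where "N = p * int m + int j * int q"
    have Nq: "[p * int m = N] (mod int q)" and Nm: "[int j * int q = N] (mod int m)"
      by (simp_all add: N_def cong_iff_dvd_diff)
    have "coprime (p * int m) (int q)" using pq qm' by simp
    hence "coprime N (int q)" by (rule cong_imp_coprime[OF Nq])
    moreover have "coprime (int j) (int m)" using j by (simp add: U_def)
    hence "coprime (int j * int q) (int m)" using qm' by simp
    hence "coprime N (int m)" by (rule cong_imp_coprime[OF Nm])
    ultimately have "coprime N (int r)" by (simp add: r_def)
    then obtain a where a: "[N * a = 1] (mod int r)" using cong_solve_coprime_int by blast
    define A where "A = - a"
    from a obtain B where B: "N * a - 1 = int r * B" by (auto simp: cong_iff_dvd_diff dvd_def)
    have det: "A * (-N) - B * int r = 1" using B by (simp add: A_def mult.commute)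
    have aq: "[N * a = 1] (mod int q)" and am: "[N * a = 1] (mod int m)"
      using a by (auto simp: r_def cong_iff_dvd_diff intro: dvd_trans[rotated])
    have "int q dvd A - A0"
    proof -
      have "[p * int m * a = N * a] (mod int q)" using Nq by (rule cong_scalar_right)
      also have "[N * a = 1] (mod int q)" by (rule aq)
      also have "[1 = (int m * int m * p) * s] (mod int q)" using s by (rule cong_sym)
      finally have "int q dvd p * int m * a - (int m * int m * p) * s" by (simp only: cong_iff_dvd_diff)
      also have "p * int m * a - (int m * int m * p) * s = (p * int m) * (A0 - A)" by (simp add: A0_def A_def algebra_simps)
      finally have "int q dvd A0 - A" using \<open>coprime (p * int m) (int q)\<close>
        by (simp only: coprime_dvd_mult_right_iff coprime_commute)
      thus ?thesis by (simp only: dvd_diff_commute)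
    qed
    then obtain t where "A - A0 = int q * t" by (rule dvdE)
    hence t: "A = A0 + int q * t" by simp
    have "[(int q)\<^sup>2 * t * int j = -1] (mod int m)"
    proof -
      have "[int j * int q * a = N * a] (mod int m)" using Nm by (rule cong_scalar_right)
      also have "[N * a = 1] (mod int m)" by (rule am)
      finally have "int m dvd int j * int q * a - 1" by (simp only: cong_iff_dvd_diff)
      moreover have "a = int m * s - int q * t" using t by (simp add: A_def A0_def)
      ultimately have "int m dvd int j * int q * (int m * s - int q * t) - 1" by simp
      hence "int m dvd (int j * int q * (int m * s - int q * t) - 1) - int m * (int j * int q * s)" by (rule dvd_diff) simp
      also have "(int j * int q * (int m * s - int q * t) - 1) - int m * (int j * int q * s) = - ((int q)\<^sup>2 * t * int j - (-1))"
        by (simp add: algebra_simps power2_eq_square)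
      finally show ?thesis by (simp only: cong_iff_dvd_diff dvd_minus_iff)
    qed
    moreover have "f (Complex (of_int p / real q + real j / real m) y) =
      f (Complex (of_int A0 / real r + of_int t / real m) (1 / ((real q)\<^sup>2 * (real m)\<^sup>2 * y)))" if y: "y > 0" for y
    proof -
      define z where "z = Complex (of_int p / real q + real j / real m) y"
      have z: "Im z > 0" using y by (simp add: z_def)
      have Nr: "of_int p / real q + real j / real m = of_int N / real r"
        using q m by (simp add: N_def r_def add_frac_eq)
      have zN: "z + of_real (of_int (-N) / of_int (int r)) = Complex 0 y"
        unfolding z_def Nr by (simp add: complex_eq_iff)
      have "sl2_act A B (int r) (-N) z = of_real (of_int A / of_int (int r)) - 1 / (of_real ((of_int (int r))\<^sup>2) * Complex 0 y)"
        unfolding zN[symmetric] using r by (intro sl2_act_eq_shift[OF _ z det]) simp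
      also have "\<dots> = Complex (of_int A / real r) (y / ((real r)\<^sup>2 * y\<^sup>2))"
        using horocycle_point_eq[of "(real r)\<^sup>2" y "of_int A / real r" 0] r y by simp
      also have "y / ((real r)\<^sup>2 * y\<^sup>2) = 1 / ((real q)\<^sup>2 * (real m)\<^sup>2 * y)"
        using y by (simp add: r_def power2_eq_square power_mult_distrib)
      also have "of_int A / real r = of_int A0 / real r + of_int t / real m"
        unfolding t using q m by (simp add: r_def add_divide_distrib)
      finally show ?thesis using Cc_modular_act[OF f det z] by (simp add: z_def)
    qed
    ultimately show ?thesis by blast
  qed
  then obtain t where t: "\<And>j. j \<in> U \<Longrightarrow> [(int q)\<^sup>2 * t j * int j = -1] (mod int m)" and
    ft: "\<And>j y. j \<in> U \<Longrightarrow> y > 0 \<Longrightarrow> f (Complex (of_int p / real q + real j / real m) y) =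
      f (Complex (of_int A0 / real r + of_int (t j) / real m) (1 / ((real q)\<^sup>2 * (real m)\<^sup>2 * y)))"
    by metis
  \<comment> \<open>Reduced modulo m, the t belonging to j is determined by q^2 t j = -1, an
    injective rule on the units.\<close>
  define T where "T = (\<lambda>j. nat (t j mod int m))"
  have T: "int (T j) = t j mod int m" for j using m by (simp add: T_def)
  have Tt: "[int (T j) = t j] (mod int m)" for j by (simp add: T cong_def)
  have cop: "coprime ((int q)\<^sup>2 * t j) (int m)" if "j \<in> U" for j
  proof -
    have "coprime (-1) (int m)" by simp
    hence "coprime ((int q)\<^sup>2 * t j * int j) (int m)" using cong_imp_coprime[OF cong_sym[OF t[OF that]]] by blast
    thus ?thesis by simp
  qed
  have "bij_betw T U U"
  proof -
    have "inj_on T U"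
    proof (rule inj_onI)
      fix i j assume ij: "i \<in> U" "j \<in> U" and "T i = T j"
      hence "t i mod int m = t j mod int m" using T by metis
      hence "[t j = t i] (mod int m)" by (simp add: cong_def)
      hence "[((int q)\<^sup>2 * t j) * int j = ((int q)\<^sup>2 * t i) * int j] (mod int m)"
        by (intro cong_scalar_right cong_scalar_left)
      moreover have "[((int q)\<^sup>2 * t i) * int i = ((int q)\<^sup>2 * t j) * int j] (mod int m)"
        using t[OF ij(1)] t[OF ij(2)] cong_sym cong_trans by blast
      ultimately have "[((int q)\<^sup>2 * t i) * int i = ((int q)\<^sup>2 * t i) * int j] (mod int m)" by (rule cong_trans[rotated])
      hence "[int i = int j] (mod int m)" using cong_mult_lcancel[OF cop[OF ij(1)]] by blast
      hence "[i = j] (mod m)" by (simp only: cong_int_iff)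
      thus "i = j" using ij by (simp add: U_def cong_def)
    qed
    moreover have "T ` U \<subseteq> U"
    proof (rule image_subsetI)
      fix j assume j: "j \<in> U"
      have "coprime (t j) (int m)" using cop[OF j] by simp
      hence "coprime (int (T j)) (int m)" using cong_imp_coprime[OF cong_sym[OF Tt[of j]]] by blast
      moreover have "int (T j) < int m" unfolding T using m by simp
      ultimately show "T j \<in> U" by (simp add: U_def)
    qed
    moreover have "finite U" by (simp add: U_def)
    ultimately show ?thesis by (simp add: bij_betw_def endo_inj_surj)
  qed
  show thesis
  proof (rule that[of "of_int A0 / real r"])
    fix y :: real assume y: "y > 0"
    define y' where "y' = 1 / ((real q)\<^sup>2 * (real m)\<^sup>2 * y)"
    have y': "y' > 0" using y q m by (simp add: y'_def)
    have "(\<Sum>j\<in>U. f (Complex (of_int p / real q + real j / real m) y)) =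
        (\<Sum>j\<in>U. f (Complex (of_int A0 / real r + real (T j) / real m) y'))"
    proof (intro sum.cong refl)
      fix j assume j: "j \<in> U"
      define k where "k = t j div int m"
      have "t j = int (T j) + k * int m" unfolding T k_def by (simp add: minus_mult_div_eq_mod[symmetric])
      hence "real_of_int (t j) = real (T j) + of_int k * real m" by (metis of_int_add of_int_mult of_int_of_nat_eq)
      hence "of_int (t j) / real m = real (T j) / real m + of_int k" using m by (simp add: add_divide_distrib)
      hence "Complex (of_int A0 / real r + of_int (t j) / real m) y' = Complex (of_int A0 / real r + real (T j) / real m) y' + of_int k"
        by (simp add: complex_eq_iff)
      thus "f (Complex (of_int p / real q + real j / real m) y) = f (Complex (of_int A0 / real r + real (T j) / real m) y')"
        unfolding ft[OF j y] y'_def[symmetric] using Cc_modular_add_int[OF f, of "Complex (of_int A0 / real r + real (T j) / real m) y'" k] y' by simp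
    qed
    also have "\<dots> = (\<Sum>j\<in>U. f (Complex (of_int A0 / real r + real j / real m) y'))"
      by (rule sum.reindex_bij_betw[OF \<open>bij_betw T U U\<close>])
    finally show "delta_pr_integral m (of_int p / real q) y f =
      delta_pr_integral m (of_int A0 / real r) (1 / ((real q)\<^sup>2 * (real m)\<^sup>2 * y)) f"
      by (simp only: delta_pr_integral_def U_def y'_def)
  qed
qed

lemma delta_integral_eq_sum_divisors:
  assumes n: "n > 0"
  shows "delta_integral n x y f = (\<Sum>m | m dvd n. real (totient m) * delta_pr_integral m x y f) / real n"
proof -
  let ?h = "\<lambda>u. f (Complex (x + u) y)"
  let ?S = "SIGMA m:{m. m dvd n}. {j. j < m \<and> coprime j m}"
  have fin: "finite {m. m dvd n}" using n by simp
  have "(\<Sum>m | m dvd n. real (totient m) * delta_pr_integral m x y f) =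
      (\<Sum>m | m dvd n. \<Sum>j | j < m \<and> coprime j m. ?h (real j / real m))"
  proof (intro sum.cong refl)
    fix m assume "m \<in> {m. m dvd n}"
    hence "m > 0" using n by (auto intro!: Nat.gr0I)
    thus "real (totient m) * delta_pr_integral m x y f = (\<Sum>j | j < m \<and> coprime j m. ?h (real j / real m))"
      by (simp add: delta_pr_integral_def)
  qed
  also have "\<dots> = (\<Sum>(m, j)\<in>?S. ?h (real j / real m))"
    using fin by (intro sum.Sigma) auto
  also have "\<dots> = (\<Sum>j<n. ?h (real j / real n))"
  \<comment> \<open>The fractions j / n are sorted by their reduced denominators m; j = 0
    corresponds to m = 1 with numerator 0.\<close>
  proof (rule sum.reindex_bij_witness[where i = "\<lambda>j. (n div gcd j n, j div gcd j n)" and j = "\<lambda>(m, j). j * (n div m)"], goal_cases)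
    case (1 a)
    then obtain m j where a: "a = (m, j)" "m dvd n" "j < m" "coprime j m" by auto
    then obtain k where k: "n = m * k" by (auto simp: dvd_def)
    have "k > 0" "m > 0" using n k by auto
    hence "n div m = k" using k by simp
    moreover have "gcd (k * j) (k * m) = k * gcd j m" by (rule gcd_mult_distrib_nat[symmetric])
    hence "gcd (j * k) (m * k) = k" using a(4) by (simp add: mult.commute)
    ultimately show ?case using a k \<open>k > 0\<close> by simp
  next
    case (2 a)
    then obtain m j where a: "a = (m, j)" "m dvd n" "j < m" by auto
    then obtain k where k: "n = m * k" by (auto simp: dvd_def)
    have "k > 0" "m > 0" using n k by auto
    thus ?case using a k by simp
  next
    case (3 j)
    have g: "gcd j n > 0" using n by simp
    have "n div (n div gcd j n) = gcd j n"
      using n by (metis dvd_div_eq_mult dvd_mult_div_cancel gcd_dvd2 nonzero_mult_div_cancel_left div_eq_0_iff gcd_le2_nat not_less g neq0_conv mult.commute)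
    thus ?case by simp
  next
    case (4 j)
    have g: "gcd j n > 0" using n by simp
    have "coprime (j div gcd j n) (n div gcd j n)" using g by (intro div_gcd_coprime) auto
    moreover have "j div gcd j n < n div gcd j n"
    proof -
      have "j div gcd j n * gcd j n < n div gcd j n * gcd j n" using 4 by simp
      thus ?thesis by (rule mult_less_cancel2[THEN iffD1, THEN conjunct2])
    qed
    moreover have "n div gcd j n dvd n" by (metis dvd_div_mult_self dvd_triv_left gcd_dvd2)
    ultimately show ?case by simp
  next
    case (5 a)
    then obtain m j where a: "a = (m, j)" "m dvd n" "j < m" by auto
    then obtain k where k: "n = m * k" by (auto simp: dvd_def)
    have "k > 0" "m > 0" using n k by auto
    thus ?case using a k by simp
  qed
  finally show ?thesis by (simp add: delta_integral_def)
qed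

lemma delta_integral_shift:
  assumes f: "f \<in> Cc_modular" and n: "n > 0" and y: "y > 0"
  shows "delta_integral n (x + of_int k / real n) y f = delta_integral n x y f"
proof -
  define T where "T = (\<lambda>j. nat ((k + int j) mod int n))"
  have T: "int (T j) = (k + int j) mod int n" for j using n by (simp add: T_def)
  have "bij_betw T {..<n} {..<n}"
  proof -
    have "inj_on T {..<n}"
    proof (rule inj_onI)
      fix i j assume ij: "i \<in> {..<n}" "j \<in> {..<n}" and "T i = T j"
      hence "[k + int i = k + int j] (mod int n)" using T unfolding cong_def by metis
      hence "[int i = int j] (mod int n)" by (simp only: cong_add_lcancel)
      hence "[i = j] (mod n)" by (simp only: cong_int_iff)
      thus "i = j" using ij by (simp add: cong_def)
    qed
    moreover have "T ` {..<n} \<subseteq> {..<n}"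
    proof (rule image_subsetI)
      fix j
      have "int (T j) < int n" unfolding T using n by simp
      thus "T j \<in> {..<n}" by simp
    qed
    ultimately show ?thesis by (simp add: bij_betw_def endo_inj_surj)
  qed
  have "(\<Sum>j<n. f (Complex (x + of_int k / real n + real j / real n) y)) = (\<Sum>j<n. f (Complex (x + real (T j) / real n) y))"
  proof (intro sum.cong refl)
    fix j
    define l where "l = (k + int j) div int n"
    have "k + int j = int (T j) + l * int n" unfolding T l_def by (simp add: minus_mult_div_eq_mod[symmetric])
    hence "of_int k + real j = real (T j) + of_int l * real n" by (metis of_int_add of_int_mult of_int_of_nat_eq)
    hence "of_int k / real n + real j / real n = real (T j) / real n + of_int l"
      using n by (simp add: add_divide_distrib[symmetric]) (simp add: add_divide_distrib)
    hence "Complex (x + of_int k / real n + real j / real n) y = Complex (x + real (T j) / real n) y + of_int l"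
      by (simp add: complex_eq_iff)
    thus "f (Complex (x + of_int k / real n + real j / real n) y) = f (Complex (x + real (T j) / real n) y)"
      using Cc_modular_add_int[OF f, of "Complex (x + real (T j) / real n) y" l] y by simp
  qed
  also have "\<dots> = (\<Sum>j<n. f (Complex (x + real j / real n) y))"
    by (rule sum.reindex_bij_betw[OF \<open>bij_betw T {..<n} {..<n}\<close>])
  finally show ?thesis by (simp add: delta_integral_def)
qed

text \<open>When q1 = gcd(n^2, q) divides n, the quotient n^2 / q1 is still a multiple of n, so its
  coprimality to q / q1 makes the remaining denominator coprime to n. Bezout splits p / q into
  fractions over q1 and q / q1, and the first of them is a multiple of 1 / n.\<close>

lemma delta_integral_coprime_denominator:
  fixes p :: int and q n :: nat
  assumes f: "f \<in> Cc_modular" and q: "q > 0" and pq: "coprime p (int q)" and n: "n \<in> N_q q"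
  obtains p' :: int and q' :: nat where "0 < q'" "q' \<le> q" "coprime q' n" "coprime p' (int q')"
    "\<And>y. y > 0 \<Longrightarrow> delta_integral n (of_int p / real q) y f = delta_integral n (of_int p' / real q') y f"
proof -
  have n0: "n > 0" and dvd: "gcd (n\<^sup>2) q dvd n" using n by (auto simp: N_q_def)
  define q1 where "q1 = gcd (n\<^sup>2) q"
  define q2 where "q2 = q div q1"
  have q1: "q1 > 0" using q by (simp add: q1_def)
  have qq: "q = q1 * q2" by (simp add: q2_def q1_def)
  have q2: "q2 > 0" "q2 \<le> q" using q qq q1 by (auto intro!: Nat.gr0I)
  obtain k where k: "n = q1 * k" using dvd unfolding q1_def by (rule dvdE)
  have "coprime (n\<^sup>2 div q1) q2" unfolding q1_def q2_def using q by (intro div_gcd_coprime) auto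
  moreover have "n\<^sup>2 div q1 = n * k" using q1 k by (simp add: power2_eq_square)
  ultimately have cop: "coprime q2 n" by (simp add: coprime_commute)
  have "coprime q2 q1" using cop unfolding k by simp
  hence "coprime (int q2) (int q1)" by simp
  then obtain u v where "u * int q2 + v * int q1 = 1" using bezout_int[of "int q2" "int q1"] by auto
  hence uv: "p = (p * u) * int q2 + (p * v) * int q1" by (metis distrib_left mult.assoc mult.right_neutral)
  have cop2: "coprime (p * v) (int q2)"
  proof (rule coprimeI)
    fix l assume l: "l dvd p * v" "l dvd int q2"
    hence "l dvd (p * u) * int q2 + (p * v) * int q1" by (intro dvd_add) auto
    hence "l dvd p" using uv by simp
    moreover have "l dvd int q" using l(2) unfolding qq by simp
    ultimately show "is_unit l" using pq by (metis coprime_common_divisor)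
  qed
  show thesis
  proof (rule that[OF q2 cop cop2])
    fix y :: real assume y: "y > 0"
    have "real_of_int p = of_int (p * u) * real q2 + of_int (p * v) * real q1"
      using uv by (metis of_int_add of_int_mult of_int_of_nat_eq)
    hence "of_int p / real q = of_int (p * u) / real q1 + of_int (p * v) / real q2"
      using q1 q2 by (simp add: qq add_frac_eq mult.commute)
    also have "of_int (p * u) / real q1 = of_int (p * u * int k) / real n"
      using q1 n0 unfolding k by simp
    finally have "of_int p / real q = of_int (p * v) / real q2 + of_int (p * u * int k) / real n" by (simp add: add.commute)
    thus "delta_integral n (of_int p / real q) y f = delta_integral n (of_int (p * v) / real q2) y f"
      using delta_integral_shift[OF f n0 y] by (simp only:)
  qed
qed

text \<open>Duality replaces the height by one that is at most of order n^(-2e) and at least of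
  order n^(-4e). Denominators q' <= q are treated uniformly, because the reduction for the full set
  produces one that depends on n.\<close>

lemma good_divisor_equidistribution:
  fixes q :: nat and y :: "nat \<Rightarrow> real" and \<alpha> :: real
  assumes f: "f \<in> Cc_modular" and q: "q > 0" and \<alpha>: "64/39 \<le> \<alpha>" "\<alpha> < 2" and c: "c1 > 0" "c2 > 0"
    and y: "\<And>n. n \<ge> 1 \<Longrightarrow> c1 * real n powr (-\<alpha>) \<le> y n \<and> y n \<le> c2 * real n powr (-\<alpha>)"
    and eps: "\<epsilon> > 0"
  defines "e \<equiv> (2 - \<alpha>) / 4"
  obtains n0 where "n0 \<ge> 1" "\<And>n m p' q'. n \<ge> n0 \<Longrightarrow> m \<le> n \<Longrightarrow> real n powr (1 - e) \<le> real m \<Longrightarrow>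
      0 < q' \<Longrightarrow> q' \<le> q \<Longrightarrow> coprime q' m \<Longrightarrow> coprime p' (int q') \<Longrightarrow>
      \<bar>delta_pr_integral m (of_int p' / real q') (y n) f - mu_M_integral f\<bar> \<le> \<epsilon>"
proof -
  \<comment> \<open>The bound e <= 7/78 is alpha >= 64/39 rewritten, and 64/39 is 2 / (1 + 2 theta)
    for theta = 7/64. It makes the exponent \<open>1/2 - 9/2 * e\<close> below positive.\<close>
  have e: "e > 0" "e \<le> 7/78" "\<alpha> = 2 - 4 * e" using \<alpha> by (auto simp: e_def field_simps)
  obtain m0 :: nat and y0 where y0: "y0 > 0"
    and eq: "\<And>m \<xi> y. m \<ge> m0 \<Longrightarrow> real m powr (-1/2) \<le> y \<Longrightarrow> y \<le> y0 \<Longrightarrow> \<bar>delta_pr_integral m \<xi> y f - mu_M_integral f\<bar> \<le> \<epsilon>"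
    by (rule primitive_equidistribution[OF f eps]) blast
  obtain n1 where n1: "\<And>n. n \<ge> n1 \<Longrightarrow> real m0 * real n powr (-(1 - e)) \<le> 1"
    using e by (rule_tac powr_neg_small[of "1 - e" 1 "real m0"]) auto
  \<comment> \<open>The denominator q'^2 m^2 y is at most of order n^(4e) and must not exceed
    n^((1-e)/2); the quotient has exponent 4e - (1-e)/2 = -(1/2 - 9e/2).\<close>
  obtain n2 where n2: "\<And>n. n \<ge> n2 \<Longrightarrow> ((real q)\<^sup>2 * c2) * real n powr (-(1/2 - 9/2 * e)) \<le> 1"
    using e by (rule_tac powr_neg_small[of "1/2 - 9/2 * e" 1 "(real q)\<^sup>2 * c2"]) auto
  \<comment> \<open>From m >= n^(1-e) the denominator is at least c1 n^(2 - 2e - alpha) = c1 n^(2e),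
    so the dual height eventually drops below \<open>y0\<close>.\<close>
  obtain n3 where n3: "\<And>n. n \<ge> n3 \<Longrightarrow> (1 / c1) * real n powr (-(2 * e)) \<le> y0"
    using e y0 by (rule_tac powr_neg_small[of "2 * e" y0 "1 / c1"]) auto
  show thesis
  proof (rule that[of "max (max n1 n2) (max n3 1)"])
    fix n m :: nat and p' :: int and q' :: nat
    assume n: "n \<ge> max (max n1 n2) (max n3 1)" and mn: "m \<le> n" and me: "real n powr (1 - e) \<le> real m"
      and q': "0 < q'" "q' \<le> q" "coprime q' m" "coprime p' (int q')"
    have n_ge: "n \<ge> n1" "n \<ge> n2" "n \<ge> n3" "n \<ge> 1" using n by auto
    define X where "X = real n"
    have X: "X \<ge> 1" using n_ge by (simp add: X_def)
    have pow_pos: "X powr a > 0" for a using X by simp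
    have m_pos: "real m > 0" using pow_pos[of "1 - e"] me unfolding X_def by (rule less_le_trans)
    hence m: "m > 0" by simp
    have yn: "c1 * X powr (-\<alpha>) \<le> y n" "y n \<le> c2 * X powr (-\<alpha>)" using y[OF n_ge(4)] by (auto simp: X_def)
    have y_pos: "y n > 0" using yn(1) mult_pos_pos[OF c(1) pow_pos[of "-\<alpha>"]] by linarith
    define Y where "Y = 1 / ((real q')\<^sup>2 * (real m)\<^sup>2 * y n)"
    have den_pos: "(real q')\<^sup>2 * (real m)\<^sup>2 * y n > 0" using q' m y_pos by simp
    obtain \<xi> where \<xi>: "delta_pr_integral m (of_int p' / real q') (y n) f = delta_pr_integral m \<xi> Y f"
      unfolding Y_def using y_pos by (rule_tac modular_duality[OF f q'(1) m q'(3) q'(4)]) auto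
    have "m \<ge> m0"
    proof -
      have "real m0 * X powr (-(1 - e)) * X powr (1 - e) \<le> 1 * X powr (1 - e)"
        using n1[OF n_ge(1)] pow_pos[of "1 - e"] by (intro mult_right_mono) (auto simp: X_def)
      moreover have "X powr (-(1 - e)) * X powr (1 - e) = 1" using X by (simp add: powr_add[symmetric])
      ultimately have "real m0 \<le> X powr (1 - e)" by (simp add: mult.assoc)
      thus ?thesis using me by (simp add: X_def)
    qed
    moreover have "real m powr (-1/2) \<le> Y"
    proof -
      have "real m powr (-1/2) \<le> (X powr (1 - e)) powr (-1/2)"
        using me pow_pos[of "1 - e"] by (intro powr_mono2') (auto simp: X_def)
      hence 1: "real m powr (-1/2) \<le> X powr (-((1 - e)/2))" by (simp add: powr_powr)
      have "(real q')\<^sup>2 * (real m)\<^sup>2 * y n \<le> (real q)\<^sup>2 * X\<^sup>2 * (c2 * X powr (-\<alpha>))"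
        using q' mn yn y_pos by (intro mult_mono power_mono) (auto simp: X_def)
      also have "\<dots> = ((real q)\<^sup>2 * c2) * (X powr 2 * X powr (-\<alpha>))" using X by simp
      also have "X powr 2 * X powr (-\<alpha>) = X powr (-(1/2 - 9/2 * e)) * X powr ((1 - e)/2)"
        unfolding powr_add[symmetric] by (rule arg_cong[of _ _ "\<lambda>a. X powr a"]) (simp add: e(3) field_simps)
      also have "((real q)\<^sup>2 * c2) * (X powr (-(1/2 - 9/2 * e)) * X powr ((1 - e)/2)) =
          (((real q)\<^sup>2 * c2) * X powr (-(1/2 - 9/2 * e))) * X powr ((1 - e)/2)" by simp
      also have "\<dots> \<le> 1 * X powr ((1 - e)/2)"
        using n2[OF n_ge(2)] pow_pos[of "(1 - e)/2"] by (intro mult_right_mono) (auto simp: X_def)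
      finally have "(real q')\<^sup>2 * (real m)\<^sup>2 * y n \<le> X powr ((1 - e)/2)" by simp
      hence "1 / X powr ((1 - e)/2) \<le> Y" unfolding Y_def using mult_pos_pos[OF pow_pos den_pos]
        by (intro divide_left_mono) auto
      moreover have "1 / X powr ((1 - e)/2) = X powr (-((1 - e)/2))" by (simp add: powr_minus_divide)
      ultimately show ?thesis using 1 by linarith
    qed
    moreover have "Y \<le> y0"
    proof -
      have "1 * (X powr (1 - e))\<^sup>2 * (c1 * X powr (-\<alpha>)) \<le> (real q')\<^sup>2 * (real m)\<^sup>2 * y n"
        using q' me yn c(1) X by (intro mult_mono power_mono one_le_power) (auto simp: X_def)
      moreover have "1 * (X powr (1 - e))\<^sup>2 * (c1 * X powr (-\<alpha>)) = c1 * X powr (2 * e)"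
      proof -
        have "(X powr (1 - e))\<^sup>2 = X powr (1 - e) * X powr (1 - e)" by (simp add: power2_eq_square)
        hence "1 * (X powr (1 - e))\<^sup>2 * (c1 * X powr (-\<alpha>)) = c1 * (X powr (1 - e) * X powr (1 - e) * X powr (-\<alpha>))" by simp
        also have "X powr (1 - e) * X powr (1 - e) * X powr (-\<alpha>) = X powr (2 * e)"
          unfolding powr_add[symmetric] by (simp add: e(3))
        finally show ?thesis .
      qed
      ultimately have "c1 * X powr (2 * e) \<le> (real q')\<^sup>2 * (real m)\<^sup>2 * y n" by (simp only:)
      hence "Y \<le> 1 / (c1 * X powr (2 * e))"
        unfolding Y_def using den_pos mult_pos_pos[OF c(1) pow_pos[of "2 * e"]]
        by (intro divide_left_mono mult_pos_pos[of "(real q')\<^sup>2 * (real m)\<^sup>2 * y n"]) auto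
      also have "\<dots> = (1 / c1) * X powr (-(2 * e))" by (simp add: powr_minus_divide)
      also have "\<dots> \<le> y0" using n3[OF n_ge(3)] by (simp only: X_def)
      finally show ?thesis .
    qed
    ultimately show "\<bar>delta_pr_integral m (of_int p' / real q') (y n) f - mu_M_integral f\<bar> \<le> \<epsilon>"
      unfolding \<xi> by (rule eq)
  qed simp
qed

lemma delta_pr_integral_bounded:
  assumes M: "\<And>z. Im z > 0 \<Longrightarrow> \<bar>f z\<bar> \<le> M" and y: "y > 0" and m: "m > 0"
  shows "\<bar>delta_pr_integral m x y f\<bar> \<le> M"
proof -
  have "\<bar>\<Sum>j | j < m \<and> coprime j m. f (Complex (x + real j / real m) y)\<bar> \<le> (\<Sum>j | j < m \<and> coprime j m. M)"
    using y by (intro order_trans[OF sum_abs] sum_mono M) simp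
  also have "\<dots> = real (totient m) * M" using card_coprime_below[OF m] by simp
  finally show ?thesis using m by (simp add: delta_pr_integral_def abs_mult pos_divide_le_eq mult.commute)
qed

theorem theorem1p2:
  fixes p :: int and q :: nat and y :: "nat \<Rightarrow> real" and \<alpha> \<theta> :: real
  assumes "q \<ge> 1" and "coprime p (int q)"
    and "\<theta> = 7/64"
    and "2 / (1 + 2 * \<theta>) \<le> \<alpha>" and "\<alpha> < 2"
    and "\<And>n. n \<ge> 1 \<Longrightarrow> y n > 0"
    and "\<exists>c1 c2. c1 > 0 \<and> c2 > 0 \<and>
           (\<forall>n\<ge>1. c1 * real n powr (-\<alpha>) \<le> y n \<and> y n \<le> c2 * real n powr (-\<alpha>))"
  shows "\<forall>f\<in>Cc_modular.
           ((\<lambda>n. delta_integral n (of_int p / real q) (y n) f) \<longlongrightarrow> mu_M_integral f)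
              (inf sequentially (principal (N_q q))) \<and>
           ((\<lambda>n. delta_pr_integral n (of_int p / real q) (y n) f) \<longlongrightarrow> mu_M_integral f)
              (inf sequentially (principal (N_q_pr q)))"
proof
  fix f assume f: "f \<in> Cc_modular"
  have q: "q > 0" using assms(1) by simp
  have \<alpha>: "64/39 \<le> \<alpha>" "\<alpha> < 2" using assms(4,5) unfolding assms(3) by simp_all
  obtain c1 c2 where c: "c1 > 0" "c2 > 0"
    and yc: "\<And>n. n \<ge> 1 \<Longrightarrow> c1 * real n powr (-\<alpha>) \<le> y n \<and> y n \<le> c2 * real n powr (-\<alpha>)"
    using assms(7) by blast
  define e where "e = (2 - \<alpha>) / 4"
  have e: "e > 0" "e < 1" using \<alpha> by (auto simp: e_def)
  have pow_le: "real n powr (1 - e) \<le> real n" if "n \<ge> 1" for n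
  proof -
    have "real n powr (1 - e) \<le> real n powr 1" using that e by (intro powr_mono) auto
    thus ?thesis using that by simp
  qed
  let ?good = "\<lambda>n0 \<epsilon> n m p' q'. n \<ge> n0 \<longrightarrow> m \<le> n \<longrightarrow> real n powr (1 - e) \<le> real m \<longrightarrow>
      0 < q' \<longrightarrow> q' \<le> q \<longrightarrow> coprime q' m \<longrightarrow> coprime p' (int q') \<longrightarrow>
      \<bar>delta_pr_integral m (of_int p' / real q') (y n) f - mu_M_integral f\<bar> \<le> \<epsilon>"
  have good: "\<exists>n0\<ge>1. \<forall>n m p' q'. ?good n0 \<epsilon> n m p' q'" if "\<epsilon> > 0" for \<epsilon>
    using good_divisor_equidistribution[OF f q \<alpha> c yc that, folded e_def] by metis
  have "eventually (\<lambda>n. n \<in> N_q_pr q \<longrightarrow> dist (delta_pr_integral n (of_int p / real q) (y n) f) (mu_M_integral f) < \<epsilon>) sequentially"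
    if \<epsilon>: "\<epsilon> > 0" for \<epsilon>
  proof -
    have "\<epsilon>/2 > 0" using \<epsilon> by simp
    from good[OF this] obtain n0 where n0: "n0 \<ge> 1" "\<And>n m p' q'. ?good n0 (\<epsilon>/2) n m p' q'" by metis
    show ?thesis unfolding eventually_sequentially
    proof (intro exI[of _ n0] allI impI)
      fix n assume n: "n0 \<le> n" and "n \<in> N_q_pr q"
      hence "n \<ge> 1" "coprime q n" by (auto simp: N_q_pr_def coprime_commute)
      \<comment> \<open>The primitive case is m = n with the given p and q.\<close>
      hence "\<bar>delta_pr_integral n (of_int p / real q) (y n) f - mu_M_integral f\<bar> \<le> \<epsilon>/2"
        using n q assms(2) pow_le by (intro n0(2)[rule_format]) auto
      thus "dist (delta_pr_integral n (of_int p / real q) (y n) f) (mu_M_integral f) < \<epsilon>"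
        unfolding dist_real_def using \<epsilon> by linarith
    qed
  qed
  hence prim: "((\<lambda>n. delta_pr_integral n (of_int p / real q) (y n) f) \<longlongrightarrow> mu_M_integral f) (inf sequentially (principal (N_q_pr q)))"
    unfolding tendsto_iff eventually_inf_principal by (intro allI impI)
  have "eventually (\<lambda>n. n \<in> N_q q \<longrightarrow> dist (delta_integral n (of_int p / real q) (y n) f) (mu_M_integral f) < \<epsilon>) sequentially"
    if \<epsilon>: "\<epsilon> > 0" for \<epsilon>
  proof -
    have \<epsilon>3: "\<epsilon>/3 > 0" using \<epsilon> by simp
    from good[OF this] obtain n0 where n0: "n0 \<ge> 1" "\<And>n m p' q'. ?good n0 (\<epsilon>/3) n m p' q'" by metis
    obtain M where M: "M > 0" "\<And>z. Im z > 0 \<Longrightarrow> \<bar>f z\<bar> \<le> M" by (rule Cc_modular_bounded[OF f]) blast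
    define \<mu> where "\<mu> = mu_M_integral f"
    define K where "K = M + \<bar>\<mu>\<bar>"
    have K: "K > 0" using M by (simp add: K_def)
    \<comment> \<open>The exponent e/2 is half of the gap between n^(1-e) and n; the other half, a
      factor n^(-e/2), makes the small divisors negligible.\<close>
    obtain C where C: "C \<ge> 1" "\<And>n. n > 0 \<Longrightarrow> real (\<Prod>p\<in>prime_factors n. multiplicity p n + 1) \<le> C * real n powr (e/2)"
      using e by (rule_tac prod_multiplicity_bound[of "e/2"]) auto
    obtain n1 where n1: "\<And>n. n \<ge> n1 \<Longrightarrow> (C * K) * real n powr (-(e/2)) \<le> \<epsilon>/3"
      using e \<epsilon>3 by (rule_tac powr_neg_small[of "e/2" "\<epsilon>/3" "C * K"]) auto
    show ?thesis unfolding eventually_sequentially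
    proof (intro exI[of _ "max n0 n1"] allI impI)
      fix n assume n: "max n0 n1 \<le> n" and nq: "n \<in> N_q q"
      have n_ge: "n \<ge> n0" "n \<ge> n1" "n > 0" using n n0(1) by auto
      have y: "y n > 0" using assms(6) n_ge by simp
      obtain p' q' where q': "0 < q'" "q' \<le> q" "coprime q' n" "coprime p' (int q')"
        and eq: "delta_integral n (of_int p / real q) (y n) f = delta_integral n (of_int p' / real q') (y n) f"
        using y by (rule_tac delta_integral_coprime_denominator[OF f q assms(2) nq]) blast
      define x where "x = of_int p' / real q'"
      define D where "D = (\<lambda>m. delta_pr_integral m x (y n) f - \<mu>)"
      have D_good: "\<bar>D m\<bar> \<le> \<epsilon>/3" if "m dvd n" "real n powr (1 - e) \<le> real m" for m
        unfolding D_def x_def \<mu>_def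
      proof (rule n0(2)[rule_format, OF n_ge(1) _ that(2) q'(1,2) _ q'(4)])
        show "m \<le> n" using that(1) n_ge(3) by (rule dvd_imp_le)
        show "coprime q' m" using q'(3) that(1) coprime_divisors[OF dvd_refl that(1)] by blast
      qed
      have D_all: "\<bar>D m\<bar> \<le> K" if "m dvd n" for m
      proof -
        have m: "m > 0" using that n_ge(3) by (auto intro!: Nat.gr0I)
        have "\<bar>delta_pr_integral m x (y n) f\<bar> \<le> M"
        proof (rule delta_pr_integral_bounded[OF _ y m])
          fix z assume "Im z > 0"
          thus "\<bar>f z\<bar> \<le> M" by (rule M(2))
        qed
        thus ?thesis unfolding D_def K_def by linarith
      qed
      have fin: "finite {m. m dvd n}" using n_ge by simp
      \<comment> \<open>Large divisors are controlled by the first summand and small ones by the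
        second; adding both keeps the sum over divisors in one piece.\<close>
      have D_term: "\<bar>real (totient m) * D m\<bar> \<le> \<epsilon>/3 * real (totient m) + K * real n powr (1 - e)" if "m dvd n" for m
      proof (cases "real n powr (1 - e) \<le> real m")
        case True
        have "\<bar>real (totient m) * D m\<bar> \<le> real (totient m) * (\<epsilon>/3)"
          unfolding abs_mult abs_of_nat using D_good[OF that True] by (rule mult_left_mono) simp
        moreover have "K * real n powr (1 - e) \<ge> 0" using K by simp
        ultimately show ?thesis unfolding mult.commute[of "real (totient m)" "\<epsilon>/3"] by linarith
      next
        case False
        have "real (totient m) \<le> real m" by (simp add: totient_le)
        hence "real (totient m) \<le> real n powr (1 - e)" using False by linarith
        hence "real (totient m) * \<bar>D m\<bar> \<le> real n powr (1 - e) * K" using D_all[OF that] by (intro mult_mono) auto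
        moreover have "\<epsilon>/3 * real (totient m) \<ge> 0" using \<epsilon> by simp
        ultimately show ?thesis unfolding abs_mult abs_of_nat mult.commute[of "real n powr (1 - e)" K] by linarith
      qed
      \<comment> \<open>As the totients of the divisors add up to n, the weights totient m / n have
        total mass 1, so the limit may be subtracted term by term.\<close>
      have tot: "(\<Sum>m | m dvd n. real (totient m)) = real n"
        using totient_divisor_sum[of n] by (metis of_nat_sum)
      have "\<bar>\<Sum>m | m dvd n. real (totient m) * D m\<bar> \<le> (\<Sum>m | m dvd n. \<epsilon>/3 * real (totient m) + K * real n powr (1 - e))"
        using D_term by (intro order_trans[OF sum_abs] sum_mono) simp
      also have "\<dots> = \<epsilon>/3 * real n + real (card {m. m dvd n}) * (K * real n powr (1 - e))"
        unfolding sum.distrib sum_distrib_left[symmetric] tot by simp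
      also have "\<dots> \<le> \<epsilon>/3 * real n + \<epsilon>/3 * real n"
      proof -
        have "real (card {m. m dvd n}) \<le> real (\<Prod>p\<in>prime_factors n. multiplicity p n + 1)"
          using card_divisors_le[OF n_ge(3)] by (simp only: of_nat_le_iff)
        also have "\<dots> \<le> C * real n powr (e/2)" by (rule C(2)[OF n_ge(3)])
        finally have "real (card {m. m dvd n}) * (K * real n powr (1 - e)) \<le> (C * real n powr (e/2)) * (K * real n powr (1 - e))"
          using K by (intro mult_right_mono) auto
        also have "\<dots> = (C * K) * (real n powr (e/2) * real n powr (1 - e))" by simp
        also have "real n powr (e/2) * real n powr (1 - e) = real n powr (-(e/2)) * real n"
        proof -
          have "real n powr (-(e/2)) * real n = real n powr (-(e/2)) * real n powr 1" using n_ge by simp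
          also have "\<dots> = real n powr (e/2) * real n powr (1 - e)"
            unfolding powr_add[symmetric] by (rule arg_cong[of _ _ "\<lambda>a. real n powr a"]) simp
          finally show ?thesis by simp
        qed
        also have "(C * K) * (real n powr (-(e/2)) * real n) = ((C * K) * real n powr (-(e/2))) * real n" by simp
        also have "\<dots> \<le> \<epsilon>/3 * real n" using n1[OF n_ge(2)] by (rule mult_right_mono) simp
        finally show ?thesis by linarith
      qed
      finally have le: "\<bar>\<Sum>m | m dvd n. real (totient m) * D m\<bar> \<le> 2 * (\<epsilon>/3) * real n" by simp
      have "(\<Sum>m | m dvd n. real (totient m) * D m) =
          (\<Sum>m | m dvd n. real (totient m) * delta_pr_integral m x (y n) f) - real n * \<mu>"
        unfolding D_def right_diff_distrib sum_subtractf sum_distrib_right[symmetric] tot ..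
      hence "delta_integral n x (y n) f - \<mu> = (\<Sum>m | m dvd n. real (totient m) * D m) / real n"
        unfolding delta_integral_eq_sum_divisors[OF n_ge(3)] using n_ge(3) by (simp add: diff_divide_distrib)
      hence "\<bar>delta_integral n x (y n) f - \<mu>\<bar> \<le> 2 * (\<epsilon>/3)"
        using le n_ge(3) by (simp add: abs_divide pos_divide_le_eq)
      thus "dist (delta_integral n (of_int p / real q) (y n) f) (mu_M_integral f) < \<epsilon>"
        unfolding eq dist_real_def x_def[symmetric] \<mu>_def[symmetric] using \<epsilon> by linarith
    qed
  qed
  hence full: "((\<lambda>n. delta_integral n (of_int p / real q) (y n) f) \<longlongrightarrow> mu_M_integral f) (inf sequentially (principal (N_q q)))"
    unfolding tendsto_iff eventually_inf_principal by (intro allI impI)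
  show "((\<lambda>n. delta_integral n (of_int p / real q) (y n) f) \<longlongrightarrow> mu_M_integral f)
              (inf sequentially (principal (N_q q))) \<and>
           ((\<lambda>n. delta_pr_integral n (of_int p / real q) (y n) f) \<longlongrightarrow> mu_M_integral f)
              (inf sequentially (principal (N_q_pr q)))"
    using full prim by (rule conjI)
qed

end
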